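(* For a positive integer $n$ let $\Gamma\subset\mathbb{R}^n$ be a lattice and $\mathbb{T}^n:=\Gamma\backslash\mathbb{R}^n$ the corresponding $n$-dimensional flat torus. Let $P_{\mathbb{U}_1}\to\mathbb{T}^n$ be a fixed $\mathbb{U}_1$-bundle and let a square root of that bundle be given. Fix a basis $(\gamma_1,\ldots,\gamma_n)$ of $\Gamma$ and $\delta_1,\ldots,\delta_n\in\{0,1\}$. Denote by $\theta_1,\ldots,\theta_n\in[0,1[$ the real numbers fixing the square root of $P_{\mathbb{U}_1}\to\mathbb{T}^n$. Let $A$ be a parallel one-form on $\mathbb{T}^n$. Then the spectrum of the Dirac operator of $\mathbb{T}^n$ endowed with the induced flat metric and the spin$^c$ structure provided by $(\delta_1,\ldots,\delta_n)$ and $(\theta_1,\ldots,\theta_n)$ is given by $$\Big\{\pm2\pi\Big|\gamma^*+\frac12\sum_{j=1}^n(\delta_j+\theta_j)\gamma_j^*+\frac{A}{4\pi}\Big|,\quad\gamma^*\in\Gamma^*\Big\},$$ where $\Gamma^*:=\{\theta\in(\mathbb{R}^n)^*\,|\,\theta(\Gamma)\subset\mathbb{Z}\}$ is the dual lattice and $(\gamma_1^*,\ldots,\gamma_n^* )$ the basis of $\Gamma^*$ dual to $(\gamma_1,\ldots,\gamma_n)$. If non-zero, the eigenvalue provided by $\gamma^*$ has multiplicity at least $2^{[\frac n2]-1}$. Furthermore, $0$ is an eigenvalue if and only if there exists $\gamma^*\in\Gamma^*$ such that $A=-4\pi\big(\gamma^*+\frac12\sum_{j=1}^n(\delta_j+\theta_j)\gamma_j^*\big)$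 and, in that case, its multiplicity is exactly $2^{[\frac n2]}$ and the corresponding eigenspace consists of $\nabla^A$-parallel spinors.
   Context: The auxiliary bundle $P_{\mathbb{U}_1}$ is described by a group homomorphism $\beta:\Gamma\to\mathbb{U}_1$ with $\beta(\gamma_j)=e^{2i\pi\theta_j}$, $\theta_j\in[0,1[$, and the chosen square root by the homomorphism $\tilde\beta:\Gamma\to\mathbb{U}_1$ with $\tilde\beta(\gamma_j)=e^{i\pi\theta_j}$. The numbers $\delta_j$ determine a homomorphism $\varepsilon:\Gamma\to\{\pm1\}$ by $\varepsilon(\gamma_j)=(-1)^{\delta_j}$. The spin$^c$ structure provided by $(\delta_j)$ and $(\theta_j)$ is the one for which spinor fields on $\mathbb{T}^n$ are identified with maps $\phi:\mathbb{R}^n\to\Sigma_n=\mathbb{C}^{2^{[n/2]}}$ (the standard spinor module, with Clifford multiplication satisfying $X\cdot Y\cdot+Y\cdot X\cdot=-2\langle X,Y\rangle$) satisfying $\phi(x+\gamma)=\varepsilon(\gamma)\tilde\beta(\gamma)\phi(x)$ for all $x\in\mathbb{R}^n$, $\gamma\in\Gamma$. A real one-form $A$ on $\mathbb{T}^n$ (a $\Gamma$-invariant one-form on $\mathbb{R}^n$; if parallel, an element of $(\mathbb{R}^n)^*$) gives the connection one-form $iA$ on the auxiliary bundle and induces on spinors the connection $\nabla^A_X\phi=\nabla_X\phi+\frac i2A(X)\phi$, where $\nabla$ is the Levi-Civita (flat) derivative; the Dirac operator in question is $D^A=\sum_{j=1}^ne_j\cdot\nabla^A_{e_j}$, with $(e_j)$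 an orthonormal basis. $|\cdot|$ is the Euclidean norm on $(\mathbb{R}^n)^*$.
   Formalization: For n = 1 the set with both signs is wrong (e.g. Γ=ℤ, δ=0, θ=1/2, A=0); there ± is read as the single sign occurring for each γ*, fixed by the Clifford multiplication, and the multiplicity bound concerns that sign. For n ≥ 2 both signs are kept. *)

theory Defs
  imports "HOL-Analysis.Analysis" "HOL-Library.Function_Algebras"
begin

text \<open>The dimension of the torus is \<open>n = CARD('n)\<close>; since the basis of the lattice also has \<open>n\<close>
  members, it is indexed by \<open>'n\<close> as well. The dual space of \<open>real ^ 'n\<close> is the type
  \<open>(real ^ 'n) \<Rightarrow>\<^sub>L real\<close>. Spinors take values in \<open>complex ^ 's\<close> with
  \<open>CARD('s) = 2 ^ (n div 2)\<close>.\<close>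

section \<open>Lattices\<close>

definition lattice_basis :: "(real ^ 'n) set \<Rightarrow> ('n \<Rightarrow> real ^ 'n) \<Rightarrow> bool" where
  "lattice_basis \<Gamma> \<gamma> \<longleftrightarrow>
     inj \<gamma> \<and> independent (range \<gamma>) \<and>
     \<Gamma> = {\<Sum>j\<in>UNIV. of_int (k j) *\<^sub>R \<gamma> j | k :: 'n \<Rightarrow> int. True}"

definition dual_lattice :: "(real ^ 'n) set \<Rightarrow> ((real ^ 'n) \<Rightarrow>\<^sub>L real) set" where
  "dual_lattice \<Gamma> = {\<xi>. \<forall>v\<in>\<Gamma>. blinfun_apply \<xi> v \<in> \<int>}"

definition dual_basis :: "('n \<Rightarrow> real ^ 'n) \<Rightarrow> ('n \<Rightarrow> (real ^ 'n) \<Rightarrow>\<^sub>L real) \<Rightarrow> bool" where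
  "dual_basis \<gamma> \<gamma>' \<longleftrightarrow> (\<forall>i j. blinfun_apply (\<gamma>' i) (\<gamma> j) = (if i = j then 1 else 0))"

text \<open>The Euclidean norm of a covector: its components with respect to the standard orthonormal
  basis are its values on that basis.\<close>

definition dual_norm :: "((real ^ 'n) \<Rightarrow>\<^sub>L real) \<Rightarrow> real" where
  "dual_norm \<xi> = L2_set (blinfun_apply \<xi>) Basis"

definition fundamental_domain :: "('n \<Rightarrow> real ^ 'n) \<Rightarrow> (real ^ 'n) set" where
  "fundamental_domain \<gamma> = {\<Sum>j\<in>UNIV. t j *\<^sub>R \<gamma> j | t. \<forall>j. 0 \<le> t j \<and> t j < 1}"

text \<open>A homomorphism from \<open>\<Gamma>\<close> to a multiplicative group \<open>G\<close> of complex numbers; values outside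
  \<open>\<Gamma>\<close> are irrelevant.\<close>

definition character :: "complex set \<Rightarrow> (real ^ 'n) set \<Rightarrow> (real ^ 'n \<Rightarrow> complex) \<Rightarrow> bool" where
  "character G \<Gamma> \<rho> \<longleftrightarrow> \<rho> ` \<Gamma> \<subseteq> G \<and> (\<forall>a\<in>\<Gamma>. \<forall>b\<in>\<Gamma>. \<rho> (a + b) = \<rho> a * \<rho> b)"

section \<open>Spinor fields\<close>

text \<open>Clifford multiplication by \<open>X\<close> is the matrix \<open>c X\<close>. Together with the dimension condition on
  \<open>'s\<close> this characterises the spinor modules: for even \<open>n\<close> there is one up to isomorphism, for
  odd \<open>n\<close> there are two, exchanged by \<open>c \<mapsto> - c\<close>.\<close>

definition clifford_mult :: "(real ^ 'n \<Rightarrow> complex ^ 's ^ 's) \<Rightarrow> bool" where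
  "clifford_mult c \<longleftrightarrow>
     linear c \<and> (\<forall>X Y. c X ** c Y + c Y ** c X = mat (complex_of_real (- 2 * (X \<bullet> Y))))"

primrec C_diff :: "nat \<Rightarrow> ('a::euclidean_space \<Rightarrow> 'b::real_normed_vector) \<Rightarrow> bool" where
  "C_diff 0 f \<longleftrightarrow> continuous_on UNIV f"
| "C_diff (Suc k) f \<longleftrightarrow>
     f differentiable_on UNIV \<and> (\<forall>v. C_diff k (\<lambda>x. frechet_derivative f (at x) v))"

definition smooth :: "('a::euclidean_space \<Rightarrow> 'b::real_normed_vector) \<Rightarrow> bool" where
  "smooth f \<longleftrightarrow> (\<forall>k. C_diff k f)"

definition equivariant ::
    "(real ^ 'n) set \<Rightarrow> (real ^ 'n \<Rightarrow> complex) \<Rightarrow> (real ^ 'n \<Rightarrow> complex ^ 's) \<Rightarrow> bool" where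
  "equivariant \<Gamma> \<rho> \<phi> \<longleftrightarrow> (\<forall>x. \<forall>v\<in>\<Gamma>. \<phi> (x + v) = \<rho> v *s \<phi> x)"

text \<open>Smooth and square-integrable spinor fields on the torus. The latter are Borel functions, not
  classes modulo null functions.\<close>

definition smooth_spinors ::
    "(real ^ 'n) set \<Rightarrow> (real ^ 'n \<Rightarrow> complex) \<Rightarrow> (real ^ 'n \<Rightarrow> complex ^ 's) set" where
  "smooth_spinors \<Gamma> \<rho> = {\<phi>. smooth \<phi> \<and> equivariant \<Gamma> \<rho> \<phi>}"

definition L2_spinors ::
    "(real ^ 'n) set \<Rightarrow> ('n \<Rightarrow> real ^ 'n) \<Rightarrow> (real ^ 'n \<Rightarrow> complex) \<Rightarrow>
      (real ^ 'n \<Rightarrow> complex ^ 's) set" where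
  "L2_spinors \<Gamma> \<gamma> \<rho> =
     {\<phi>. \<phi> \<in> borel_measurable borel \<and> equivariant \<Gamma> \<rho> \<phi> \<and>
          set_integrable lborel (fundamental_domain \<gamma>) (\<lambda>x. (norm (\<phi> x))\<^sup>2)}"

definition L2_norm :: "('n \<Rightarrow> real ^ 'n) \<Rightarrow> (real ^ 'n \<Rightarrow> complex ^ 's) \<Rightarrow> real" where
  "L2_norm \<gamma> \<phi> = sqrt (LINT x:fundamental_domain \<gamma>|lborel. (norm (\<phi> x))\<^sup>2)"

section \<open>The Dirac operator\<close>

definition spinor_connection ::
    "((real ^ 'n) \<Rightarrow>\<^sub>L real) \<Rightarrow> real ^ 'n \<Rightarrow> (real ^ 'n \<Rightarrow> complex ^ 's) \<Rightarrow>
      real ^ 'n \<Rightarrow> complex ^ 's" where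
  "spinor_connection A X \<phi> x =
     frechet_derivative \<phi> (at x) X + (\<i> / 2 * complex_of_real (blinfun_apply A X)) *s \<phi> x"

definition parallel_spinor ::
    "((real ^ 'n) \<Rightarrow>\<^sub>L real) \<Rightarrow> (real ^ 'n \<Rightarrow> complex ^ 's) \<Rightarrow> bool" where
  "parallel_spinor A \<phi> \<longleftrightarrow> (\<forall>X x. spinor_connection A X \<phi> x = 0)"

definition dirac ::
    "(real ^ 'n \<Rightarrow> complex ^ 's ^ 's) \<Rightarrow> ((real ^ 'n) \<Rightarrow>\<^sub>L real) \<Rightarrow>
      (real ^ 'n \<Rightarrow> complex ^ 's) \<Rightarrow> real ^ 'n \<Rightarrow> complex ^ 's" where
  "dirac c A \<phi> x = (\<Sum>e\<in>Basis. c e *v spinor_connection A e \<phi> x)"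

text \<open>The spectrum of the Dirac operator as an unbounded operator in the Hilbert space of
  square-integrable spinor fields, with the smooth ones as its domain: \<open>\<mu>\<close> is in the resolvent set
  iff \<open>D - \<mu>\<close> has a bounded inverse on its range and this range is dense. This is the textbook
  definition for operators that need not be closed, and it gives the spectrum of the closure.\<close>

definition dirac_resolvent_set ::
    "(real ^ 'n) set \<Rightarrow> ('n \<Rightarrow> real ^ 'n) \<Rightarrow> (real ^ 'n \<Rightarrow> complex) \<Rightarrow>
      (real ^ 'n \<Rightarrow> complex ^ 's ^ 's) \<Rightarrow> ((real ^ 'n) \<Rightarrow>\<^sub>L real) \<Rightarrow> complex set" where
  "dirac_resolvent_set \<Gamma> \<gamma> \<rho> c A =
     {\<mu>. (\<exists>C. \<forall>\<phi>\<in>smooth_spinors \<Gamma> \<rho>.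
             L2_norm \<gamma> \<phi> \<le> C * L2_norm \<gamma> (\<lambda>x. dirac c A \<phi> x - \<mu> *s \<phi> x)) \<and>
          (\<forall>\<psi>\<in>L2_spinors \<Gamma> \<gamma> \<rho>. \<forall>\<epsilon>>0. \<exists>\<phi>\<in>smooth_spinors \<Gamma> \<rho>.
             L2_norm \<gamma> (\<lambda>x. dirac c A \<phi> x - \<mu> *s \<phi> x - \<psi> x) < \<epsilon>)}"

definition dirac_spectrum ::
    "(real ^ 'n) set \<Rightarrow> ('n \<Rightarrow> real ^ 'n) \<Rightarrow> (real ^ 'n \<Rightarrow> complex) \<Rightarrow>
      (real ^ 'n \<Rightarrow> complex ^ 's ^ 's) \<Rightarrow> ((real ^ 'n) \<Rightarrow>\<^sub>L real) \<Rightarrow> complex set" where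
  "dirac_spectrum \<Gamma> \<gamma> \<rho> c A = - dirac_resolvent_set \<Gamma> \<gamma> \<rho> c A"

definition dirac_eigenspace ::
    "(real ^ 'n) set \<Rightarrow> (real ^ 'n \<Rightarrow> complex) \<Rightarrow> (real ^ 'n \<Rightarrow> complex ^ 's ^ 's) \<Rightarrow>
      ((real ^ 'n) \<Rightarrow>\<^sub>L real) \<Rightarrow> complex \<Rightarrow> (real ^ 'n \<Rightarrow> complex ^ 's) set" where
  "dirac_eigenspace \<Gamma> \<rho> c A \<mu> =
     {\<phi> \<in> smooth_spinors \<Gamma> \<rho>. \<forall>x. dirac c A \<phi> x = \<mu> *s \<phi> x}"

definition dirac_eigenvalue ::
    "(real ^ 'n) set \<Rightarrow> (real ^ 'n \<Rightarrow> complex) \<Rightarrow> (real ^ 'n \<Rightarrow> complex ^ 's ^ 's) \<Rightarrow>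
      ((real ^ 'n) \<Rightarrow>\<^sub>L real) \<Rightarrow> complex \<Rightarrow> bool" where
  "dirac_eigenvalue \<Gamma> \<rho> c A \<mu> \<longleftrightarrow> (\<exists>\<phi>\<in>dirac_eigenspace \<Gamma> \<rho> c A \<mu>. \<exists>x. \<phi> x \<noteq> 0)"

lemma vector_space_spinor_fields:
  "vector_space (\<lambda>a (\<phi> :: 'a \<Rightarrow> complex ^ 's) x. a *s \<phi> x)"
  by unfold_locales (auto simp: fun_eq_iff vec_eq_iff algebra_simps)

text \<open>The complex dimension of the eigenspace. As \<open>dim\<close> is \<open>0\<close> for spaces of infinite dimension, a
  positive lower bound includes finiteness.\<close>

definition dirac_multiplicity ::
    "(real ^ 'n) set \<Rightarrow> (real ^ 'n \<Rightarrow> complex) \<Rightarrow> (real ^ 'n \<Rightarrow> complex ^ 's ^ 's) \<Rightarrow>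
      ((real ^ 'n) \<Rightarrow>\<^sub>L real) \<Rightarrow> complex \<Rightarrow> nat" where
  "dirac_multiplicity \<Gamma> \<rho> c A \<mu> =
     vector_space.dim (\<lambda>a \<phi> x. a *s \<phi> x) (dirac_eigenspace \<Gamma> \<rho> c A \<mu>)"

end

(* A parallel form A enters the symbol of D^A only as a shift, so D^A preserves each Fourier mode
   x |-> exp(2 pi i (gamma^* + tau)(x)) v and acts there by the matrix 2 pi i c(xi) with
   xi = gamma^* + tau + A / (4 pi), whose square is 4 pi^2 |xi|^2.  For n >= 2, Clifford
   multiplication by a vector orthogonal to xi anticommutes with this matrix, so both signs occur,
   each on half of the spinor module.

   Trigonometric polynomials are dense in L^2, by Stone-Weierstrass on a product of circles.
   Therefore the spectrum consists of the mu for which some 2 pi i c(xi) - mu is singular.  For all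
   other mu the inverses are bounded uniformly in gamma^*, because
   (2 pi i c(xi) + mu) (2 pi i c(xi) - mu) = 4 pi^2 |xi|^2 - mu^2; this does not need c to be
   skew-Hermitian.  The xi lie in a discrete set, so an eigenspace involves finitely many modes. *)
theory Submission
  imports Defs
begin

text \<open>As \<open>c\<close> is not assumed skew-Hermitian, the symmetry of the operator and the
  identity |c(X) v| = |X| |v| cannot be used: every estimate is made on one Fourier mode at a time
  and has to be carried back to L^2. No space of classes and no infinite series is formed for this.
  Completing the square against a finite trigonometric sum gives Bessel's inequality and, together
  with density, Parseval's identity up to epsilon.

  Equivariant fields are not periodic, but multiplication by the wave of -(gamma^* + tau) makes them
  so. Differentiation then becomes multiplication on coefficients, because the derivative of a
  periodic function has integral zero over a half-open cell. This follows from translation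
  invariance and difference quotients, without boundary terms.

  In dimension one no nonzero vector is orthogonal to a nonzero xi. The spinor module is a line,
  each mode contributes one eigenvalue with one sign, and this case is treated separately.\<close>

section \<open>Density of polynomials in square-integrable functions\<close>

text \<open>Integrability is demanded explicitly because the integral of a non-integrable function
  is 0 by convention, which would make the bound vacuous.\<close>

definition L2_approximable :: "'a::euclidean_space measure \<Rightarrow> ('a \<Rightarrow> real) \<Rightarrow> bool" where
  "L2_approximable \<nu> f \<longleftrightarrow> (\<forall>\<epsilon>>0. \<exists>p. real_polynomial_function p \<and>
     integrable \<nu> (\<lambda>x. (f x - p x)\<^sup>2) \<and> (LINT x|\<nu>. (f x - p x)\<^sup>2) < \<epsilon>)"

lemma real_polynomial_function_borel [measurable]:
  fixes p :: "'a::euclidean_space \<Rightarrow> real"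
  shows "real_polynomial_function p \<Longrightarrow> p \<in> borel_measurable borel"
  by (simp add: borel_measurable_continuous_onI continuous_on_polymonial_function real_polynomial_function_eq)

text \<open>Replaces Minkowski's inequality without square roots: two errors below epsilon/4 add up
  to one below epsilon, whence the quarters in the following proofs.\<close>

lemma integral_add_square_le:
  fixes f g :: "'a \<Rightarrow> real"
  assumes [measurable]: "f \<in> borel_measurable M" "g \<in> borel_measurable M"
    and f: "integrable M (\<lambda>x. (f x)\<^sup>2)" and g: "integrable M (\<lambda>x. (g x)\<^sup>2)"
  shows "integrable M (\<lambda>x. (f x + g x)\<^sup>2)"
    and "(LINT x|M. (f x + g x)\<^sup>2) \<le> 2 * (LINT x|M. (f x)\<^sup>2) + 2 * (LINT x|M. (g x)\<^sup>2)"
proof -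
  have le: "(f x + g x)\<^sup>2 \<le> 2 * (f x)\<^sup>2 + 2 * (g x)\<^sup>2" for x
    using sum_squares_bound[of "f x" "g x"] by (simp add: power2_sum)
  have i: "integrable M (\<lambda>x. 2 * (f x)\<^sup>2 + 2 * (g x)\<^sup>2)"
    using f g by simp
  show j: "integrable M (\<lambda>x. (f x + g x)\<^sup>2)"
    by (rule Bochner_Integration.integrable_bound[OF i]) (use le in auto)
  have "(LINT x|M. (f x + g x)\<^sup>2) \<le> (LINT x|M. 2 * (f x)\<^sup>2 + 2 * (g x)\<^sup>2)"
    by (intro integral_mono i j le)
  then show "(LINT x|M. (f x + g x)\<^sup>2) \<le> 2 * (LINT x|M. (f x)\<^sup>2) + 2 * (LINT x|M. (g x)\<^sup>2)"
    using f g by simp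
qed

context
  fixes \<nu> :: "'a::euclidean_space measure" and K :: "'a set"
  assumes fin: "finite_measure \<nu>" and sets_\<nu>: "sets \<nu> = sets borel"
    and K: "compact K" and AE_K: "AE x in \<nu>. x \<in> K"
begin

lemma borel_measurable_nu: "f \<in> borel_measurable borel \<Longrightarrow> f \<in> borel_measurable \<nu>"
  using sets_\<nu> measurable_cong_sets by blast

text \<open>Uniform closeness on \<open>K\<close> suffices: the complement of \<open>K\<close> is
  null, so the size of the polynomial there is irrelevant, and the measure is finite.\<close>

lemma L2_approximable_cont:
  assumes f: "continuous_on UNIV f"
  shows "L2_approximable \<nu> f"
  unfolding L2_approximable_def
proof (intro allI impI)
  interpret finite_measure \<nu> by (rule fin)
  fix \<epsilon> :: real assume "\<epsilon> > 0"
  \<comment> \<open>The summand 1 keeps \<open>m\<close> positive for the zero measure;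
    \<open>e\<close> is chosen so that e^2 * m = epsilon/4.\<close>
  define m where "m = measure \<nu> (space \<nu>) + 1"
  have m: "m > 0" by (simp add: m_def add_nonneg_pos)
  define e where "e = sqrt (\<epsilon> / m) / 2"
  have e: "e > 0" using \<open>\<epsilon> > 0\<close> m by (simp add: e_def)
  obtain p where p: "real_polynomial_function p" "\<And>x. x \<in> K \<Longrightarrow> \<bar>f x - p x\<bar> < e"
    using Stone_Weierstrass_real_polynomial_function[OF K continuous_on_subset[OF f] e] by blast
  have [measurable]: "p \<in> borel_measurable \<nu>" "f \<in> borel_measurable \<nu>"
    using borel_measurable_nu[OF real_polynomial_function_borel[OF p(1)]]
      borel_measurable_nu[OF borel_measurable_continuous_onI[OF f]] by auto
  have le: "AE x in \<nu>. (f x - p x)\<^sup>2 \<le> e\<^sup>2"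
    using AE_K
  proof eventually_elim
    case (elim x)
    then have "\<bar>f x - p x\<bar> \<le> \<bar>e\<bar>" using p(2) e by force
    then show ?case by (simp only: abs_le_square_iff)
  qed
  have i: "integrable \<nu> (\<lambda>x. (f x - p x)\<^sup>2)"
    by (rule integrable_const_bound[where B = "e\<^sup>2"]) (use le in auto)
  have "(LINT x|\<nu>. (f x - p x)\<^sup>2) \<le> (LINT x|\<nu>. e\<^sup>2)"
    by (intro integral_mono_AE i le) auto
  also have "\<dots> = e\<^sup>2 * measure \<nu> (space \<nu>)" by simp
  also have "\<dots> \<le> e\<^sup>2 * m" by (intro mult_left_mono) (auto simp: m_def)
  also have "\<dots> = \<epsilon> / 4" using m \<open>\<epsilon> > 0\<close> by (simp add: e_def power_divide)
  also have "\<dots> < \<epsilon>" using \<open>\<epsilon> > 0\<close> by simp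
  finally show "\<exists>p. real_polynomial_function p \<and>
     integrable \<nu> (\<lambda>x. (f x - p x)\<^sup>2) \<and> (LINT x|\<nu>. (f x - p x)\<^sup>2) < \<epsilon>"
    using i p by blast
qed

lemma L2_approximable_closed:
  assumes f: "f \<in> borel_measurable borel"
    and h: "\<And>\<epsilon>. \<epsilon> > 0 \<Longrightarrow> \<exists>h. h \<in> borel_measurable borel \<and> L2_approximable \<nu> h \<and>
      integrable \<nu> (\<lambda>x. (f x - h x)\<^sup>2) \<and> (LINT x|\<nu>. (f x - h x)\<^sup>2) < \<epsilon>"
  shows "L2_approximable \<nu> f"
  unfolding L2_approximable_def
proof (intro allI impI)
  fix \<epsilon> :: real assume "\<epsilon> > 0"
  then have "\<epsilon> / 4 > 0" by simp
  then obtain h where h: "h \<in> borel_measurable borel" "L2_approximable \<nu> h"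
      "integrable \<nu> (\<lambda>x. (f x - h x)\<^sup>2)" "(LINT x|\<nu>. (f x - h x)\<^sup>2) < \<epsilon> / 4"
    using h by meson
  from h(2) \<open>\<epsilon> / 4 > 0\<close> obtain p where p: "real_polynomial_function p"
      "integrable \<nu> (\<lambda>x. (h x - p x)\<^sup>2)" "(LINT x|\<nu>. (h x - p x)\<^sup>2) < \<epsilon> / 4"
    unfolding L2_approximable_def by meson
  have [measurable]: "f \<in> borel_measurable \<nu>" "h \<in> borel_measurable \<nu>" "p \<in> borel_measurable \<nu>"
    using f h(1) p(1) by (auto intro!: borel_measurable_nu real_polynomial_function_borel)
  have m: "(\<lambda>x. f x - h x) \<in> borel_measurable \<nu>" "(\<lambda>x. h x - p x) \<in> borel_measurable \<nu>"
    by measurable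
  show "\<exists>p. real_polynomial_function p \<and>
     integrable \<nu> (\<lambda>x. (f x - p x)\<^sup>2) \<and> (LINT x|\<nu>. (f x - p x)\<^sup>2) < \<epsilon>"
    using integral_add_square_le[OF m h(3) p(2)] p h by (intro exI[of _ p]) auto
qed

lemma L2_approximable_cmult:
  assumes "L2_approximable \<nu> f"
  shows "L2_approximable \<nu> (\<lambda>x. c * f x)"
  unfolding L2_approximable_def
proof (intro allI impI)
  fix \<epsilon> :: real assume "\<epsilon> > 0"
  \<comment> \<open>Dividing by c^2 + 1 instead of c^2 covers c = 0.\<close>
  have c: "c\<^sup>2 + 1 > 0" by (simp add: add_nonneg_pos)
  with \<open>\<epsilon> > 0\<close> have "\<epsilon> / (c\<^sup>2 + 1) > 0" by simp
  then obtain p where p: "real_polynomial_function p"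
      "integrable \<nu> (\<lambda>x. (f x - p x)\<^sup>2)" "(LINT x|\<nu>. (f x - p x)\<^sup>2) < \<epsilon> / (c\<^sup>2 + 1)"
    using assms unfolding L2_approximable_def by meson
  have eq: "(c * f x - c * p x)\<^sup>2 = c\<^sup>2 * (f x - p x)\<^sup>2" for x
    by (simp add: power_mult_distrib flip: right_diff_distrib)
  have nn: "0 \<le> (LINT x|\<nu>. (f x - p x)\<^sup>2)" by simp
  have "(c\<^sup>2 + 1) * (LINT x|\<nu>. (f x - p x)\<^sup>2) < \<epsilon>"
    using p(3) c by (simp add: field_simps)
  then have "c\<^sup>2 * (LINT x|\<nu>. (f x - p x)\<^sup>2) < \<epsilon>"
    unfolding distrib_right using nn by linarith
  then show "\<exists>p. real_polynomial_function p \<and>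
     integrable \<nu> (\<lambda>x. (c * f x - p x)\<^sup>2) \<and> (LINT x|\<nu>. (c * f x - p x)\<^sup>2) < \<epsilon>"
    using p by (intro exI[of _ "\<lambda>x. c * p x"]) (auto simp: eq)
qed

lemma L2_approximable_add:
  assumes f: "L2_approximable \<nu> f" and g: "L2_approximable \<nu> g"
    and m: "f \<in> borel_measurable borel" "g \<in> borel_measurable borel"
  shows "L2_approximable \<nu> (\<lambda>x. f x + g x)"
  unfolding L2_approximable_def
proof (intro allI impI)
  fix \<epsilon> :: real assume "\<epsilon> > 0"
  then have e: "\<epsilon> / 4 > 0" by simp
  obtain p where p: "real_polynomial_function p"
      "integrable \<nu> (\<lambda>x. (f x - p x)\<^sup>2)" "(LINT x|\<nu>. (f x - p x)\<^sup>2) < \<epsilon> / 4"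
    using f e unfolding L2_approximable_def by meson
  obtain q where q: "real_polynomial_function q"
      "integrable \<nu> (\<lambda>x. (g x - q x)\<^sup>2)" "(LINT x|\<nu>. (g x - q x)\<^sup>2) < \<epsilon> / 4"
    using g e unfolding L2_approximable_def by meson
  have [measurable]: "f \<in> borel_measurable \<nu>" "g \<in> borel_measurable \<nu>"
     "p \<in> borel_measurable \<nu>" "q \<in> borel_measurable \<nu>"
    using m p(1) q(1) by (auto intro!: borel_measurable_nu real_polynomial_function_borel)
  have m: "(\<lambda>x. f x - p x) \<in> borel_measurable \<nu>" "(\<lambda>x. g x - q x) \<in> borel_measurable \<nu>"
    by measurable
  show "\<exists>p. real_polynomial_function p \<and>
     integrable \<nu> (\<lambda>x. (f x + g x - p x)\<^sup>2) \<and> (LINT x|\<nu>. (f x + g x - p x)\<^sup>2) < \<epsilon>"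
    using integral_add_square_le[OF m p(2) q(2)] p q
    by (intro exI[of _ "\<lambda>x. p x + q x"]) (auto simp: algebra_simps)
qed

text \<open>Regularity of the measure puts \<open>B\<close> between a compact \<open>C\<close> and
  an open \<open>U\<close> whose difference has measure below epsilon. A Urysohn function between
  them is continuous and differs from the indicator only on \<open>U - C\<close>, by at most
  1.\<close>

lemma L2_approximable_indicator:
  assumes B: "B \<in> sets borel"
  shows "L2_approximable \<nu> (indicator B)"
proof (rule L2_approximable_closed)
  interpret finite_measure \<nu> by (rule fin)
  show "indicator B \<in> borel_measurable borel" using B by simp
  fix \<epsilon> :: real assume "\<epsilon> > 0"
  have fn: "emeasure \<nu> (space \<nu>) \<noteq> \<infinity>" unfolding infinity_ennreal_def by (rule emeasure_finite)
  have e: "ennreal (\<epsilon> / 2) > 0" using \<open>\<epsilon> > 0\<close> by simp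
  have Bn: "emeasure \<nu> B \<noteq> \<infinity>" unfolding infinity_ennreal_def by (rule emeasure_finite)
  obtain C where C: "C \<subseteq> B" "compact C" "measure \<nu> B < measure \<nu> C + \<epsilon> / 2"
  proof -
    \<comment> \<open>Null sets are split off because no extended nonnegative number lies strictly
      below 0; for them the empty set serves as \<open>C\<close>.\<close>
    have "emeasure \<nu> B \<noteq> 0 \<or> emeasure \<nu> B = 0" by simp
    then show thesis
    proof
      assume "emeasure \<nu> B = 0"
      then show thesis using \<open>\<epsilon> > 0\<close> by (intro that[of "{}"]) (auto simp: emeasure_eq_measure)
    next
      assume nz: "emeasure \<nu> B \<noteq> 0"
      have "emeasure \<nu> B - ennreal (\<epsilon> / 2) < emeasure \<nu> B"
        using e nz Bn by (intro ennreal_between) (auto simp: zero_less_iff_neq_zero less_top[symmetric])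
      also have "\<dots> = (SUP K \<in> {K. K \<subseteq> B \<and> compact K}. emeasure \<nu> K)"
        by (rule inner_regular[OF sets_\<nu> fn B])
      finally obtain C where "C \<subseteq> B" "compact C" "emeasure \<nu> B - ennreal (\<epsilon> / 2) < emeasure \<nu> C"
        by (auto simp: less_SUP_iff)
      moreover from this(3) have "ennreal (measure \<nu> B - \<epsilon> / 2) < ennreal (measure \<nu> C)"
        using \<open>\<epsilon> > 0\<close> by (simp only: emeasure_eq_measure ennreal_minus less_imp_le half_gt_zero)
      then have "\<not> measure \<nu> C \<le> measure \<nu> B - \<epsilon> / 2"
        using ennreal_leI leD by blast
      ultimately show thesis by (intro that[of C]) auto
    qed
  qed
  obtain U where U: "B \<subseteq> U" "open U" "emeasure \<nu> U < emeasure \<nu> B + ennreal (\<epsilon> / 2)"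
  proof -
    have "(INF U \<in> {U. B \<subseteq> U \<and> open U}. emeasure \<nu> U) = emeasure \<nu> B"
      by (rule outer_regular[OF sets_\<nu> fn B, symmetric])
    also have "\<dots> < emeasure \<nu> B + ennreal (\<epsilon> / 2)"
      using e Bn by (simp add: ennreal_add_left_cancel_less)
    finally show thesis using that by (auto simp: INF_less_iff)
  qed
  have [measurable]: "C \<in> sets \<nu>" "U \<in> sets \<nu>" "B \<in> sets \<nu>"
    using C U B sets_\<nu> by (auto simp: borel_compact)
  obtain h :: "'a \<Rightarrow> real" where h: "continuous_on UNIV h" "\<And>x. h x \<in> closed_segment 1 0"
      "\<And>x. x \<in> C \<Longrightarrow> h x = 1" "\<And>x. x \<in> - U \<Longrightarrow> h x = 0"
  proof (rule Urysohn[of C "- U" "1 :: real" 0])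
    show "closed C" by (rule compact_imp_closed[OF C(2)])
    show "closed (- U)" using U(2) by (rule closed_Compl)
    show "C \<inter> - U = {}" using C(1) U(1) by blast
  qed (rule that)
  have h01: "0 \<le> h x" "h x \<le> 1" for x
    using h(2)[of x] by (auto simp: closed_segment_eq_real_ivl split: if_splits)
  have [measurable]: "h \<in> borel_measurable \<nu>"
    using h(1) by (intro borel_measurable_nu borel_measurable_continuous_onI)
  have le: "(indicator B x - h x)\<^sup>2 \<le> indicator (U - C) x" for x
  proof -
    consider "x \<in> C" | "x \<notin> U" | "x \<in> U - C" by blast
    then show ?thesis
    proof cases
      case 3
      have "\<bar>indicator B x - h x\<bar> \<le> 1" using h01[of x] by (simp add: indicator_def)
      then have "(indicator B x - h x)\<^sup>2 \<le> 1"  by (simp add: abs_square_le_1)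
      then show ?thesis using 3 by simp
    qed (use C U h in \<open>auto simp: indicator_def\<close>)
  qed
  have ii: "integrable \<nu> (indicator (U - C) :: 'a \<Rightarrow> real)"
    by (intro integrable_real_indicator) (auto simp: less_top[symmetric])
  have i: "integrable \<nu> (\<lambda>x. (indicator B x - h x)\<^sup>2)"
    by (rule Bochner_Integration.integrable_bound[OF ii]) (use le in auto)
  have "(LINT x|\<nu>. (indicator B x - h x)\<^sup>2) \<le> (LINT x|\<nu>. indicator (U - C) x)"
    by (intro integral_mono i ii le)
  also have "\<dots> = measure \<nu> (U - C)"
    by (simp add: Int_absorb2 sets.sets_into_space)
  also have "\<dots> = measure \<nu> U - measure \<nu> C"
    using C U by (intro finite_measure_Diff) auto
  also have "\<dots> < \<epsilon>"
  proof -
    have "ennreal (measure \<nu> U) < ennreal (measure \<nu> B) + ennreal (\<epsilon> / 2)"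
      using U(3) by (simp_all add: emeasure_eq_measure)
    then have "measure \<nu> U < measure \<nu> B + \<epsilon> / 2"
      using \<open>\<epsilon> > 0\<close> by (simp add: ennreal_less_iff flip: ennreal_plus)
    with C(3) show ?thesis by simp
  qed
  finally show "\<exists>h. h \<in> borel_measurable borel \<and> L2_approximable \<nu> h \<and>
      integrable \<nu> (\<lambda>x. (indicator B x - h x)\<^sup>2) \<and> (LINT x|\<nu>. (indicator B x - h x)\<^sup>2) < \<epsilon>"
    using i L2_approximable_cont[OF h(1)] h(1)
    by (intro exI[of _ h]) (auto intro: borel_measurable_continuous_onI)
qed

text \<open>Induction over indicators, multiples, sums and monotone limits. Nonnegativity is what
  lets square integrability descend to the pieces, each being dominated by the whole.\<close>

lemma L2_approximable_nonneg:
  assumes "f \<in> borel_measurable borel" "\<And>x. 0 \<le> f x" "integrable \<nu> (\<lambda>x. (f x)\<^sup>2)"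
  shows "L2_approximable \<nu> f"
proof -
  have meas: "borel_measurable \<nu> = (borel_measurable borel :: ('a \<Rightarrow> real) set)"
    using sets_\<nu> measurable_cong_sets by blast
  have sp: "space \<nu> = UNIV"
    using sets_\<nu> by (metis sets_eq_imp_space_eq space_borel)
  have "f \<in> borel_measurable \<nu>" using assms meas by simp
  then show ?thesis using assms(2,3)
  proof (induction rule: borel_measurable_induct_real)
    case (set A)
    then show ?case using L2_approximable_indicator sets_\<nu> by simp
  next
    case (mult u c)
    show ?case
    \<comment> \<open>For c = 0 the integrability of (c * u)^2 says nothing about \<open>u\<close>,
      so the induction hypothesis is out of reach.\<close>
    proof (cases "c = 0")
      case True
      then show ?thesis using L2_approximable_cont[of "\<lambda>x. 0"] by simp
    next
      case False
      then have "integrable \<nu> (\<lambda>x. (u x)\<^sup>2)"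
        using mult.prems by (simp add: power_mult_distrib)
      then show ?thesis using mult by (intro L2_approximable_cmult) auto
    qed
  next
    case (add u v)
    have "(u x)\<^sup>2 \<le> (v x + u x)\<^sup>2" "(v x)\<^sup>2 \<le> (v x + u x)\<^sup>2" for x
      using add.hyps(2,4)[of x] by (auto intro!: power_mono)
    then have "integrable \<nu> (\<lambda>x. (u x)\<^sup>2)" "integrable \<nu> (\<lambda>x. (v x)\<^sup>2)"
      using add.hyps by (auto intro!: Bochner_Integration.integrable_bound[OF add.prems])
    then show ?case using add meas by (intro L2_approximable_add) auto
  next
    case (seq U)
    have U_le: "U i x \<le> f x" for i x
      using seq sp by (intro incseq_le) (auto simp: incseq_def le_fun_def)
    have fm: "f \<in> borel_measurable \<nu>" by fact
    note seq.hyps(1)[measurable] fm[measurable]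
    have Ui: "integrable \<nu> (\<lambda>x. (U i x)\<^sup>2)" for i
      by (rule Bochner_Integration.integrable_bound[OF seq.prems])
        (use seq.hyps U_le in \<open>auto intro!: power_mono\<close>)
    have le: "(f x - U i x)\<^sup>2 \<le> (f x)\<^sup>2" for i x
      using U_le[of i x] seq.hyps(2)[of i x] by (intro power_mono) auto
    have di: "integrable \<nu> (\<lambda>x. (f x - U i x)\<^sup>2)" for i
      by (rule Bochner_Integration.integrable_bound[OF seq.prems]) (use le in auto)
    have lim: "(\<lambda>i. LINT x|\<nu>. (f x - U i x)\<^sup>2) \<longlonglongrightarrow> (LINT x|\<nu>. 0)"
    proof (rule integral_dominated_convergence[where w = "\<lambda>x. (f x)\<^sup>2"])
      show "AE x in \<nu>. (\<lambda>i. (f x - U i x)\<^sup>2) \<longlonglongrightarrow> 0"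
      proof (rule AE_I2)
        fix x assume "x \<in> space \<nu>"
        from seq.hyps(4)[OF this] have "(\<lambda>i. (f x - U i x)\<^sup>2) \<longlonglongrightarrow> (f x - f x)\<^sup>2"
          by (intro tendsto_intros)
        then show "(\<lambda>i. (f x - U i x)\<^sup>2) \<longlonglongrightarrow> 0" by simp
      qed
    qed (use seq.prems le in auto)
    show ?case
    proof (rule L2_approximable_closed)
      show "f \<in> borel_measurable borel" using fm meas by simp
      fix \<epsilon> :: real assume "\<epsilon> > 0"
      with lim obtain i where "(LINT x|\<nu>. (f x - U i x)\<^sup>2) < \<epsilon>"
        using order_tendstoD(2)[OF lim, of \<epsilon>] by (auto simp: eventually_sequentially)
      then show "\<exists>h. h \<in> borel_measurable borel \<and> L2_approximable \<nu> h \<and>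
        integrable \<nu> (\<lambda>x. (f x - h x)\<^sup>2) \<and> (LINT x|\<nu>. (f x - h x)\<^sup>2) < \<epsilon>"
        using seq.hyps(1)[of i] seq.IH[OF Ui] di meas seq.hyps(2) by (intro exI[of _ "U i"]) auto
    qed
  qed
qed

text \<open>Splits \<open>f\<close> into its positive and negative parts, both square-integrable
  because they are dominated by |f|.\<close>

lemma polynomials_dense_L2:
  assumes f: "f \<in> borel_measurable borel" and i: "integrable \<nu> (\<lambda>x. (f x)\<^sup>2)"
  shows "L2_approximable \<nu> f"
proof -
  have "(\<lambda>x. max 0 (f x) + (-1) * max 0 (- f x)) = f" by (auto simp: fun_eq_iff max_def)
  moreover have "L2_approximable \<nu> (\<lambda>x. max 0 (f x))" "L2_approximable \<nu> (\<lambda>x. max 0 (- f x))"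
    using f borel_measurable_nu[OF f]
    by (auto intro!: L2_approximable_nonneg Bochner_Integration.integrable_bound[OF i] simp: max_def)
  ultimately show ?thesis
    using L2_approximable_add[of "\<lambda>x. max 0 (f x)" "\<lambda>x. (-1) * max 0 (- f x)"]
      L2_approximable_cmult[of "\<lambda>x. max 0 (- f x)" "-1"] f by simp
qed

end

section \<open>The principal symbol\<close>

lemma mat_mult_vec: "mat a *v v = a *s (v :: complex ^ 's)"
  by (simp add: vec_eq_iff matrix_vector_mult_def mat_def if_distrib if_distribR sum.delta' cong: if_cong)

lemma norm_smult_vec: "norm (a *s v) = norm a * norm (v :: complex ^ 's)"
  by (simp add: norm_vec_def norm_mult L2_set_right_distrib)

lemma scaleR_eq_smult: "r *\<^sub>R v = complex_of_real r *s (v :: complex ^ 's)"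
  by (simp add: vec_eq_iff flip: scaleR_conv_of_real)

lemma scaleR_matrix_vector: "(r *\<^sub>R A) *v v = r *\<^sub>R (A *v (v :: complex ^ 's))"
  by (simp add: vec_eq_iff matrix_vector_mult_def scaleR_sum_right)

text \<open>The Riesz representative of the covector; it is needed because Clifford multiplication
  takes vectors.\<close>

definition sharp :: "((real ^ 'n) \<Rightarrow>\<^sub>L real) \<Rightarrow> real ^ 'n" where
  "sharp \<xi> = (\<Sum>e\<in>Basis. blinfun_apply \<xi> e *\<^sub>R e)"

lemma sharp_inner: "sharp \<xi> \<bullet> x = blinfun_apply \<xi> x"
proof -
  have "blinfun_apply \<xi> x = blinfun_apply \<xi> (\<Sum>e\<in>Basis. (x \<bullet> e) *\<^sub>R e)"
    by (simp add: euclidean_representation)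
  also have "\<dots> = (\<Sum>e\<in>Basis. (x \<bullet> e) * blinfun_apply \<xi> e)"
    by (simp add: blinfun.sum_right blinfun.scaleR_right)
  finally show ?thesis
    by (simp add: sharp_def inner_sum_left) (simp add: inner_commute mult.commute)
qed

lemma norm_sharp: "norm (sharp \<xi>) = dual_norm \<xi>"
proof -
  have "sharp \<xi> \<bullet> sharp \<xi> = (\<Sum>b\<in>Basis. (sharp \<xi> \<bullet> b) * (sharp \<xi> \<bullet> b))"
    by (rule euclidean_inner)
  then show ?thesis
    by (simp add: norm_eq_sqrt_inner dual_norm_def L2_set_def sharp_inner power2_eq_square)
qed

lemma dual_norm_nonneg: "0 \<le> dual_norm \<xi>"
  by (simp flip: norm_sharp)

lemma abs_le_dual_norm: "\<bar>blinfun_apply \<xi> x\<bar> \<le> dual_norm \<xi> * norm x"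
  unfolding norm_sharp[symmetric] sharp_inner[symmetric] by (rule Cauchy_Schwarz_ineq2)

lemma dual_norm_eq_0_iff: "dual_norm \<xi> = 0 \<longleftrightarrow> \<xi> = 0"
proof
  assume "dual_norm \<xi> = 0"
  then have "blinfun_apply \<xi> x = 0" for x
    using abs_le_dual_norm[of \<xi> x] by simp
  then show "\<xi> = 0" by (auto intro!: blinfun_eqI)
qed (simp add: dual_norm_def L2_set_def)

text \<open>With 2 pi i in front, the term iA/2 of the connection becomes the shift A/(4 pi) of the
  covector.\<close>

definition dirac_symbol ::
    "(real ^ 'n \<Rightarrow> complex ^ 's ^ 's) \<Rightarrow> ((real ^ 'n) \<Rightarrow>\<^sub>L real) \<Rightarrow> complex ^ 's \<Rightarrow> complex ^ 's" where
  "dirac_symbol c \<xi> v = (2 * pi * \<i>) *s (c (sharp \<xi>) *v v)"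

lemma dirac_symbol_add: "dirac_symbol c \<xi> (v + w) = dirac_symbol c \<xi> v + dirac_symbol c \<xi> w"
  and dirac_symbol_smult: "dirac_symbol c \<xi> (a *s v) = a *s dirac_symbol c \<xi> v"
  and dirac_symbol_diff: "dirac_symbol c \<xi> (v - w) = dirac_symbol c \<xi> v - dirac_symbol c \<xi> w"
  by (simp_all only: dirac_symbol_def matrix_vector_right_distrib matrix_vector_mult_diff_distrib
      vector_scalar_commute vec.scale_right_distrib vec.scale_right_diff_distrib vec.scale_scale mult.commute)

lemma linear_dirac_symbol: "linear (dirac_symbol c \<xi>)"
  by (rule linearI) (simp_all add: dirac_symbol_add dirac_symbol_smult scaleR_eq_smult)

context
  fixes c :: "real ^ 'n \<Rightarrow> complex ^ 's ^ 's"
  assumes c: "clifford_mult c"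
begin

lemma linear_clifford: "linear c"
  using c by (simp add: clifford_mult_def)

lemma clifford_anticomm:
  "c X *v (c Y *v v) + c Y *v (c X *v v) = complex_of_real (- 2 * (X \<bullet> Y)) *s v"
proof -
  have "c X ** c Y + c Y ** c X = mat (complex_of_real (- 2 * (X \<bullet> Y)))"
    using c by (simp add: clifford_mult_def)
  then have "(c X ** c Y + c Y ** c X) *v v = complex_of_real (- 2 * (X \<bullet> Y)) *s v"
    by (simp only: mat_mult_vec)
  then show ?thesis
    by (simp only: matrix_vector_mult_add_rdistrib matrix_vector_mul_assoc)
qed

lemma clifford_square: "c X *v (c X *v v) = complex_of_real (- (norm X)\<^sup>2) *s v"
proof -
  define u where "u = c X *v (c X *v v)"
  have "2 *s u = u + u"
    by (simp only: vec_eq_iff vector_smult_component vector_add_component mult_2 simp_thms)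
  also have "u + u = complex_of_real (- 2 * (X \<bullet> X)) *s v"
    unfolding u_def by (rule clifford_anticomm)
  also have "complex_of_real (- 2 * (X \<bullet> X)) = 2 * complex_of_real (- (norm X)\<^sup>2)"
    by (simp add: power2_norm_eq_inner)
  finally have "2 *s u = 2 *s (complex_of_real (- (norm X)\<^sup>2) *s v)"
    by (simp only: vec.scale_scale)
  then have "u = complex_of_real (- (norm X)\<^sup>2) *s v"
    by (rule vec.scale_left_imp_eq[rotated]) simp
  then show ?thesis by (simp only: u_def)
qed

lemma dirac_symbol_square:
  "dirac_symbol c \<xi> (dirac_symbol c \<xi> v) = complex_of_real ((2 * pi * dual_norm \<xi>)\<^sup>2) *s v"
  unfolding dirac_symbol_def vector_scalar_commute clifford_square norm_sharp
  by (simp add: power2_eq_square mult_ac vec.scale_scale)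

text \<open>Applying the symbol twice gives mu^2 = (2 pi |xi|)^2. Eigenvalues are therefore real
  without any Hermitian structure.\<close>

lemma dirac_symbol_eigen:
  assumes "dirac_symbol c \<xi> v = \<mu> *s v" "v \<noteq> 0"
  shows "\<mu> = complex_of_real (2 * pi * dual_norm \<xi>) \<or> \<mu> = - complex_of_real (2 * pi * dual_norm \<xi>)"
proof -
  have "\<mu>\<^sup>2 *s v = (complex_of_real (2 * pi * dual_norm \<xi>))\<^sup>2 *s v"
    using dirac_symbol_square[of \<xi> v] assms(1)
    by (simp add: dirac_symbol_smult power2_eq_square)
  then have "\<mu>\<^sup>2 = (complex_of_real (2 * pi * dual_norm \<xi>))\<^sup>2"
    using assms(2) vec.scale_right_imp_eq by blast
  then show ?thesis by (simp only: power2_eq_iff)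
qed

lemma dirac_symbol_factor:
  "dirac_symbol c \<xi> (dirac_symbol c \<xi> v - \<mu> *s v) + \<mu> *s (dirac_symbol c \<xi> v - \<mu> *s v) =
     (complex_of_real ((2 * pi * dual_norm \<xi>)\<^sup>2) - \<mu>\<^sup>2) *s v"
  unfolding dirac_symbol_diff dirac_symbol_smult dirac_symbol_square
  by (simp add: vec_eq_iff power2_eq_square algebra_simps)

text \<open>Continuity of a bilinear map in finite dimension. The constant \<open>B\<close> stands
  in for |c(X) v| = |X| |v|, which a skew-Hermitian \<open>c\<close> would give.\<close>

lemma dirac_symbol_bounded: "\<exists>B>0. \<forall>\<xi> v. norm (dirac_symbol c \<xi> v) \<le> 2 * pi * B * dual_norm \<xi> * norm v"
proof -
  have "bilinear (\<lambda>X v. c X *v v)"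
    unfolding bilinear_def using linear_clifford
    by (auto intro!: linearI simp: linear_add linear_scale matrix_vector_right_distrib
        matrix_vector_mult_add_rdistrib matrix_vector_mult_scaleR scaleR_matrix_vector)
  then interpret bounded_bilinear "\<lambda>X v. c X *v v"
    by (simp add: bilinear_conv_bounded_bilinear)
  obtain B where "B > 0" "\<And>X v. norm (c X *v v) \<le> B * (norm v * norm X)"
    using pos_bounded by (metis mult.commute)
  have "norm (dirac_symbol c \<xi> v) \<le> 2 * pi * B * dual_norm \<xi> * norm v" for \<xi> v
    using mult_left_mono[OF \<open>\<And>X v. norm (c X *v v) \<le> B * (norm v * norm X)\<close>, of "2 * pi" "sharp \<xi>" v]
    by (simp add: dirac_symbol_def norm_smult_vec norm_mult norm_sharp mult_ac)
  with \<open>B > 0\<close> show ?thesis by blast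
qed

text \<open>Uniformity comes from splitting \<open>G\<close>. The finitely many covectors of norm at
  most |mu| + 1 each have a constant, by injectivity in finite dimension. For the others, with S the
  symbol and x = 2 pi |xi|, the scalar (S + mu) (S - mu) grows like x^2, while S + mu grows only
  like x.\<close>

lemma dirac_symbol_bounded_below:
  assumes fin: "\<And>R. finite {\<xi>\<in>G. dual_norm \<xi> \<le> R}"
    and inj: "\<And>\<xi> v. \<xi> \<in> G \<Longrightarrow> dirac_symbol c \<xi> v = \<mu> *s v \<Longrightarrow> v = 0"
  shows "\<exists>C\<ge>0. \<forall>\<xi>\<in>G. \<forall>v. norm v \<le> C * norm (dirac_symbol c \<xi> v - \<mu> *s v)"
proof -
  obtain B where B: "B > 0"
      "\<And>\<xi> v. norm (dirac_symbol c \<xi> v) \<le> 2 * pi * B * dual_norm \<xi> * norm v"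
    using dirac_symbol_bounded by blast
  define m where "m = norm \<mu>"
  define F where "F = {\<xi>\<in>G. dual_norm \<xi> \<le> m + 1}"
  have "finite F" unfolding F_def by (rule fin)
  have "\<exists>C. 0 \<le> C \<and> (\<forall>v. norm v \<le> C * norm (dirac_symbol c \<xi> v - \<mu> *s v))" if "\<xi> \<in> F" for \<xi>
  proof -
    let ?f = "\<lambda>v. dirac_symbol c \<xi> v - \<mu> *s v"
    have lin: "linear ?f"
      by (rule linearI) (simp_all add: dirac_symbol_add dirac_symbol_smult scaleR_eq_smult
          vec.scale_right_distrib vec.scale_right_diff_distrib vec.scale_left_commute)
    have "inj ?f"
      using inj[of \<xi>] that by (subst linear_injective_0[OF lin]) (auto simp: F_def)
    with lin obtain b where "b > 0" "\<And>v. b * norm v \<le> norm (?f v)"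
      using linear_inj_bounded_below_pos by blast
    then show ?thesis
      by (intro exI[of _ "1 / b"]) (auto simp: field_simps)
  qed
  then obtain C where C: "\<And>\<xi>. \<xi> \<in> F \<Longrightarrow> 0 \<le> C \<xi>"
      "\<And>\<xi> v. \<xi> \<in> F \<Longrightarrow> norm v \<le> C \<xi> * norm (dirac_symbol c \<xi> v - \<mu> *s v)"
    by metis
  \<comment> \<open>The sum dominates every \<open>C \<xi>\<close> on the finite part, and
    \<open>B + 1\<close> is the constant found off it.\<close>
  define K where "K = sum C F + (B + 1)"
  have K0: "0 \<le> K" using C(1) B(1) by (auto simp: K_def intro!: add_nonneg_nonneg sum_nonneg)
  have "norm v \<le> K * norm (dirac_symbol c \<xi> v - \<mu> *s v)" if "\<xi> \<in> G" for \<xi> v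
  proof (cases "\<xi> \<in> F")
    case True
    then have "C \<xi> \<le> sum C F" using C(1) \<open>finite F\<close> by (intro member_le_sum) auto
    then have "C \<xi> \<le> K" using B(1) by (simp add: K_def)
    then show ?thesis
      using C(2)[OF True, of v] by (meson mult_right_mono norm_ge_zero order_trans)
  next
    case False
    \<comment> \<open>The estimate is (x^2 - m^2) |v| <= (x + m) (B + 1) |w|. Division by x + m
      leaves the factor x - m, which is at least 1 because the cut was made at
      \<open>m + 1\<close>.\<close>
    define w where "w = dirac_symbol c \<xi> v - \<mu> *s v"
    define x where "x = 2 * pi * dual_norm \<xi>"
    have "1 * (m + 1) \<le> 2 * pi * dual_norm \<xi>"
      using False that pi_gt3 by (intro mult_mono) (auto simp: F_def m_def)
    then have x: "m + 1 \<le> x" by (simp add: x_def)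
    have m: "0 \<le> m" by (simp add: m_def)
    have "(x\<^sup>2 - m\<^sup>2) * norm v \<le> norm (complex_of_real (x\<^sup>2) - \<mu>\<^sup>2) * norm v"
      using norm_triangle_ineq2[of "complex_of_real (x\<^sup>2)" "\<mu>\<^sup>2"]
      by (intro mult_right_mono) (auto simp: m_def norm_power)
    also have "\<dots> = norm (dirac_symbol c \<xi> w + \<mu> *s w)"
      unfolding w_def dirac_symbol_factor x_def by (simp only: norm_smult_vec)
    also have "\<dots> \<le> x * B * norm w + m * norm w"
      using norm_triangle_ineq[of "dirac_symbol c \<xi> w" "\<mu> *s w"] B(2)[of \<xi> w]
      by (simp add: x_def m_def norm_smult_vec mult_ac)
    also have "\<dots> \<le> (x + m) * ((B + 1) * norm w)"
      using x m B(1) by (simp add: algebra_simps)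
    finally have *: "(x + m) * ((x - m) * norm v) \<le> (x + m) * ((B + 1) * norm w)"
      by (simp add: power2_eq_square algebra_simps)
    have "1 * norm v \<le> (x - m) * norm v" using x by (intro mult_right_mono) auto
    also have "\<dots> \<le> (B + 1) * norm w"
      using * x m by (subst (asm) mult_le_cancel_left_pos) auto
    also have "\<dots> \<le> K * norm w"
      using C(1) by (intro mult_right_mono) (auto simp: K_def sum_nonneg)
    finally show ?thesis by (simp add: w_def)
  qed
  with K0 show ?thesis by blast
qed

text \<open>For nonzero \<open>\<xi>\<close> the eigenspaces for mu and -mu together span the
  module, and Clifford multiplication by an orthogonal \<open>Y\<close> embeds the second into the
  first, which thus has at least half the dimension. Since \<open>\<mu>\<close> may be either square
  root, the bound holds for both signs. For \<open>\<xi> = 0\<close> the eigenspace is the whole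
  module.\<close>

lemma dim_dirac_symbol_eigenspace:
  assumes n: "2 \<le> CARD('n)" and \<mu>: "\<mu>\<^sup>2 = complex_of_real ((2 * pi * dual_norm \<xi>)\<^sup>2)"
  shows "CARD('s) \<le> 2 * vec.dim {v. dirac_symbol c \<xi> v = \<mu> *s v}"
proof (cases "\<xi> = 0")
  case True
  then have z: "sharp \<xi> = 0" by (simp add: sharp_def)
  have "\<mu> = 0" using \<mu> True dual_norm_eq_0_iff[of \<xi>] by simp
  then have "{v. dirac_symbol c \<xi> v = \<mu> *s v} = UNIV"
    using linear_0[OF linear_clifford] by (simp add: dirac_symbol_def z)
  then show ?thesis by (simp add: vec_dim_card del: vec.dim_UNIV)
next
  case False
  define E where "E = (\<lambda>a. {v. dirac_symbol c \<xi> v = a *s v})"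
  have sub: "vec.subspace (E a)" for a
    unfolding E_def
    by (rule vec.subspaceI) (auto simp: dirac_symbol_add dirac_symbol_smult vec.scale_right_distrib
        mult.commute linear_0[OF linear_dirac_symbol])
  have \<mu>0: "\<mu> \<noteq> 0" using \<mu> False dual_norm_eq_0_iff[of \<xi>] by auto
  have "v \<in> {x + y |x y. x \<in> E \<mu> \<and> y \<in> E (- \<mu>)}" for v
  proof -
    define w where "w = dirac_symbol c \<xi> v"
    have w: "dirac_symbol c \<xi> w = \<mu>\<^sup>2 *s v" by (simp add: w_def \<mu> dirac_symbol_square)
    \<comment> \<open>With S the symbol, (mu + S) / (2 mu) and (mu - S) / (2 mu) are the projections
      onto the two eigenspaces.\<close>
    have "v = (1 / (2 * \<mu>)) *s (\<mu> *s v + w) + (1 / (2 * \<mu>)) *s (\<mu> *s v - w)"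
      using \<mu>0 by (simp add: vec_eq_iff field_simps)
    moreover have "(1 / (2 * \<mu>)) *s (\<mu> *s v + w) \<in> E \<mu>" "(1 / (2 * \<mu>)) *s (\<mu> *s v - w) \<in> E (- \<mu>)"
      unfolding E_def mem_Collect_eq dirac_symbol_smult dirac_symbol_add dirac_symbol_diff w
      using \<mu>0 by (simp_all add: vec_eq_iff power2_eq_square algebra_simps flip: w_def)
    ultimately show ?thesis by blast
  qed
  then have "{x + y |x y. x \<in> E \<mu> \<and> y \<in> E (- \<mu>)} = UNIV" by blast
  with vec.dim_sums_Int[OF sub sub, of \<mu> "- \<mu>"]
  have le: "CARD('s) \<le> vec.dim (E \<mu>) + vec.dim (E (- \<mu>))"
    by (simp add: vec_dim_card del: vec.dim_UNIV)
  obtain Y where Y: "Y \<noteq> 0" "sharp \<xi> \<bullet> Y = 0"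
    using orthogonal_to_vector_exists[of "sharp \<xi>"] n by (auto simp: orthogonal_def)
  have linY: "Vector_Spaces.linear (*s) (*s) ((*v) (c Y))" by simp
  \<comment> \<open>The square of \<open>c Y\<close> is the nonzero scalar -|Y|^2.\<close>
  have injY: "inj_on ((*v) (c Y)) S" for S
  proof (rule inj_onI)
    fix u v assume "c Y *v u = c Y *v v"
    then have "complex_of_real (- (norm Y)\<^sup>2) *s u = complex_of_real (- (norm Y)\<^sup>2) *s v"
      by (simp only: clifford_square[symmetric])
    then show "u = v" using Y(1) by simp
  qed
  have "c (sharp \<xi>) *v (c Y *v v) = - (c Y *v (c (sharp \<xi>) *v v))" for v
    using clifford_anticomm[of "sharp \<xi>" Y v] Y(2) by (simp add: eq_neg_iff_add_eq_0)
  then have anti: "dirac_symbol c \<xi> (c Y *v v) = - (c Y *v dirac_symbol c \<xi> v)" for v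
    by (simp add: dirac_symbol_def vector_scalar_commute)
  have im: "(*v) (c Y) ` E (- \<mu>) \<subseteq> E \<mu>"
    by (auto simp: E_def anti linear_neg[OF matrix_vector_mul_linear] vector_scalar_commute vec.scale_minus_left)
  have "vec.dim (E (- \<mu>)) = vec.dim ((*v) (c Y) ` E (- \<mu>))"
    by (rule vec.dim_image_eq[symmetric, OF linY injY])
  also have "\<dots> \<le> vec.dim (E \<mu>)"
    by (rule vec.dim_subset[OF im])
  finally show ?thesis using le by (simp add: E_def)
qed

text \<open>On a one-dimensional module \<open>c\<close> of a unit vector is a scalar with square
  -1. Orienting \<open>e\<close> so that this scalar is -i turns the factor 2 pi i into 2 pi, and
  the only eigenvalue at \<open>\<xi>\<close> is 2 pi times the signed number
  \<open>\<xi>(e)\<close>.\<close>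

lemma dirac_symbol_dim_1:
  assumes n: "CARD('n) = 1" and s: "CARD('s) = 1"
  obtains e where "norm e = 1" "c e = mat (- \<i>)"
    "\<And>\<xi> v. dirac_symbol c \<xi> v = complex_of_real (2 * pi * blinfun_apply \<xi> e) *s v"
    "\<And>\<xi>. \<bar>blinfun_apply \<xi> e\<bar> = dual_norm \<xi>"
proof -
  obtain i :: 's where i: "UNIV = {i}" using s by (metis card_1_singletonE)
  then have all_i: "j = i" for j by blast
  obtain j :: 'n where j: "UNIV = {j}" using n by (metis card_1_singletonE)
  define e\<^sub>0 :: "real ^ 'n" where "e\<^sub>0 = axis j 1"
  have e0: "norm e\<^sub>0 = 1" by (simp add: e\<^sub>0_def)
  have B: "Basis = {e\<^sub>0}" by (auto simp: Basis_vec_def e\<^sub>0_def j)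
  define a where "a = c e\<^sub>0 $ i $ i"
  have mat: "A = mat (A $ i $ i)" for A :: "complex ^ 's ^ 's"
    by (auto simp: vec_eq_iff mat_def) (metis all_i)+
  have m: "c e\<^sub>0 = mat a" unfolding a_def by (rule mat)
  have "a\<^sup>2 = \<i>\<^sup>2"
    using clifford_square[of e\<^sub>0 1] unfolding m mat_mult_vec e0
    by (simp add: vec_eq_iff power2_eq_square)
  then have "a = \<i> \<or> a = - \<i>" by (simp only: power2_eq_iff)
  define e where "e = (if a = \<i> then - e\<^sub>0 else e\<^sub>0)"
  have e: "norm e = 1" by (simp add: e_def e0)
  have ce: "c e = mat (- \<i>)"
  proof (cases "a = \<i>")
    case True
    then have "c e = - mat \<i>" by (simp add: e_def linear_neg[OF linear_clifford] m)
    also have "\<dots> = mat (- \<i>)" by (simp add: vec_eq_iff mat_def)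
    finally show ?thesis .
  next
    case False
    with \<open>a = \<i> \<or> a = - \<i>\<close> show ?thesis by (simp add: e_def m)
  qed
  have sh: "sharp \<xi> = blinfun_apply \<xi> e *\<^sub>R e" for \<xi>
    by (simp add: sharp_def B e_def blinfun.minus_right)
  have "dirac_symbol c \<xi> v = complex_of_real (2 * pi * blinfun_apply \<xi> e) *s v" for \<xi> v
  proof -
    have "c (sharp \<xi>) *v v = complex_of_real (blinfun_apply \<xi> e) *s (- \<i> *s v)"
      unfolding sh linear_scale[OF linear_clifford] ce scaleR_matrix_vector mat_mult_vec scaleR_eq_smult ..
    then have "dirac_symbol c \<xi> v = (2 * pi * \<i> * (complex_of_real (blinfun_apply \<xi> e) * - \<i>)) *s v"
      unfolding dirac_symbol_def by (simp only: vec.scale_scale)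
    also have "2 * pi * \<i> * (complex_of_real (blinfun_apply \<xi> e) * - \<i>) =
        complex_of_real (2 * pi * blinfun_apply \<xi> e)"
      by (simp add: complex_eq_iff)
    finally show ?thesis .
  qed
  moreover have "\<bar>blinfun_apply \<xi> e\<bar> = dual_norm \<xi>" for \<xi>
    unfolding norm_sharp[symmetric] sh by (simp add: e)
  ultimately show thesis using that[OF e ce] by blast
qed

end

section \<open>Lattices and fundamental domains\<close>

text \<open>The factor 2 pi makes covectors that are integral on the lattice give periodic
  functions.\<close>

definition wave :: "((real ^ 'n) \<Rightarrow>\<^sub>L real) \<Rightarrow> real ^ 'n \<Rightarrow> complex" where
  "wave \<zeta> x = cis (2 * pi * blinfun_apply \<zeta> x)"

lemma wave_add: "wave (\<zeta> + \<eta>) x = wave \<zeta> x * wave \<eta> x"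
  by (simp add: wave_def blinfun.add_left cis_mult distrib_left)

lemma wave_add_arg: "wave \<zeta> (x + y) = wave \<zeta> x * wave \<zeta> y"
  by (simp add: wave_def blinfun.add_right cis_mult distrib_left)

lemma wave_0 [simp]: "wave 0 x = 1" "wave \<zeta> 0 = 1"
  by (simp_all add: wave_def blinfun.zero_right)

lemma norm_wave [simp]: "norm (wave \<zeta> x) = 1"
  by (simp add: wave_def)

lemma wave_minus: "wave (- \<zeta>) x = cnj (wave \<zeta> x)"
  by (simp add: wave_def blinfun.minus_left cis_cnj)

lemma wave_nonzero [simp]: "wave \<zeta> x \<noteq> 0"
  using norm_wave[of \<zeta> x] by (metis norm_zero zero_neq_one)

lemma wave_mult_cnj: "wave \<zeta> x * cnj (wave \<zeta> x) = 1"
  by (simp add: complex_norm_square[symmetric])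

lemma continuous_on_wave [continuous_intros]: "continuous_on S (wave \<zeta>)"
  unfolding wave_def cis_conv_exp by (intro continuous_intros)

lemma has_derivative_wave:
  "(wave \<zeta> has_derivative (\<lambda>v. (2 * pi * \<i> * blinfun_apply \<zeta> v) * wave \<zeta> x)) (at x)"
proof -
  have "((\<lambda>x. \<i> * complex_of_real (2 * pi * blinfun_apply \<zeta> x)) has_derivative
      (\<lambda>v. \<i> * complex_of_real (2 * pi * blinfun_apply \<zeta> v))) (at x)"
    by (intro bounded_linear.has_derivative[OF bounded_linear_const_mult] bounded_linear_of_real
        has_derivative_of_real has_derivative_mult_right bounded_linear.has_derivative[OF blinfun.bounded_linear_right])
      (auto intro: has_derivative_ident bounded_linear_ident)
  from has_derivative_compose[OF this DERIV_exp[unfolded has_field_derivative_def]] show ?thesis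
    unfolding wave_def cis_conv_exp by (simp add: mult_ac)
qed

lemma wave_eq_1: "blinfun_apply \<zeta> x \<in> \<int> \<Longrightarrow> wave \<zeta> x = 1"
  by (auto simp: wave_def elim!: Ints_cases)

locale flat_torus =
  fixes \<Gamma> :: "(real ^ 'n) set" and \<gamma> :: "'n \<Rightarrow> real ^ 'n" and \<gamma>' :: "'n \<Rightarrow> (real ^ 'n) \<Rightarrow>\<^sub>L real"
  assumes basis: "lattice_basis \<Gamma> \<gamma>" and dual: "dual_basis \<gamma> \<gamma>'"
begin

lemma dual_apply [simp]: "blinfun_apply (\<gamma>' i) (\<gamma> j) = (if i = j then 1 else 0)"
  using dual by (simp add: dual_basis_def)

lemma dual_sum: "blinfun_apply (\<gamma>' i) (\<Sum>j\<in>UNIV. t j *\<^sub>R \<gamma> j) = t i"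
  by (simp add: blinfun.sum_right blinfun.scaleR_right if_distrib cong: if_cong)

text \<open>The n independent vectors span by counting dimensions, and the dual basis reads off the
  coordinates.\<close>

lemma expansion: "(\<Sum>j\<in>UNIV. blinfun_apply (\<gamma>' j) x *\<^sub>R \<gamma> j) = x"
proof -
  have inj: "inj \<gamma>" and ind: "independent (range \<gamma>)"
    using basis by (auto simp: lattice_basis_def)
  have "UNIV \<subseteq> span (range \<gamma>)"
    using inj by (intro card_ge_dim_independent ind) (auto simp: card_image)
  then have "x \<in> range (\<lambda>u. \<Sum>v\<in>range \<gamma>. u v *\<^sub>R v)"
    by (subst span_finite[symmetric]) auto
  then obtain u where "x = (\<Sum>v\<in>range \<gamma>. u v *\<^sub>R v)" by blast
  then have x: "x = (\<Sum>j\<in>UNIV. u (\<gamma> j) *\<^sub>R \<gamma> j)"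
    by (simp add: sum.reindex[OF inj])
  show ?thesis by (subst (1 2) x) (simp only: dual_sum)
qed

lemma covector_expansion: "(\<Sum>j\<in>UNIV. blinfun_apply (\<gamma>' j) x * blinfun_apply \<zeta> (\<gamma> j)) = blinfun_apply \<zeta> x"
  by (subst (2) expansion[of x, symmetric]) (simp add: blinfun.sum_right blinfun.scaleR_right)

lemma mem_lattice_iff: "x \<in> \<Gamma> \<longleftrightarrow> (\<forall>j. blinfun_apply (\<gamma>' j) x \<in> \<int>)"
proof
  assume "x \<in> \<Gamma>"
  then obtain k :: "'n \<Rightarrow> int" where "x = (\<Sum>j\<in>UNIV. of_int (k j) *\<^sub>R \<gamma> j)"
    using basis by (auto simp: lattice_basis_def)
  then show "\<forall>j. blinfun_apply (\<gamma>' j) x \<in> \<int>" by (simp add: dual_sum)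
next
  assume "\<forall>j. blinfun_apply (\<gamma>' j) x \<in> \<int>"
  then have "\<forall>j. \<exists>k. blinfun_apply (\<gamma>' j) x = of_int k"
    by (auto simp: Ints_def)
  then obtain k :: "'n \<Rightarrow> int" where "\<And>j. blinfun_apply (\<gamma>' j) x = of_int (k j)"
    by metis
  then have "x = (\<Sum>j\<in>UNIV. of_int (k j) *\<^sub>R \<gamma> j)" using expansion[of x] by simp
  then show "x \<in> \<Gamma>" using basis by (auto simp: lattice_basis_def)
qed

lemma lattice_add: "x \<in> \<Gamma> \<Longrightarrow> y \<in> \<Gamma> \<Longrightarrow> x + y \<in> \<Gamma>"
  and lattice_minus: "x \<in> \<Gamma> \<Longrightarrow> - x \<in> \<Gamma>"
  and lattice_zero: "0 \<in> \<Gamma>"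
  and lattice_gen: "\<gamma> j \<in> \<Gamma>"
  by (auto simp: mem_lattice_iff blinfun.add_right blinfun.minus_right blinfun.zero_right)

lemma mem_dual_lattice_iff: "g \<in> dual_lattice \<Gamma> \<longleftrightarrow> (\<forall>j. blinfun_apply g (\<gamma> j) \<in> \<int>)"
proof
  assume *: "\<forall>j. blinfun_apply g (\<gamma> j) \<in> \<int>"
  have "blinfun_apply g v \<in> \<int>" if "v \<in> \<Gamma>" for v
    unfolding covector_expansion[of v g, symmetric]
    using * that by (auto simp: mem_lattice_iff intro!: Ints_sum Ints_mult)
  then show "g \<in> dual_lattice \<Gamma>" by (simp add: dual_lattice_def)
qed (auto simp: dual_lattice_def lattice_gen)

lemma dual_lattice_add: "g \<in> dual_lattice \<Gamma> \<Longrightarrow> h \<in> dual_lattice \<Gamma> \<Longrightarrow> g + h \<in> dual_lattice \<Gamma>"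
  and dual_lattice_minus: "g \<in> dual_lattice \<Gamma> \<Longrightarrow> - g \<in> dual_lattice \<Gamma>"
  and dual_lattice_diff: "g \<in> dual_lattice \<Gamma> \<Longrightarrow> h \<in> dual_lattice \<Gamma> \<Longrightarrow> g - h \<in> dual_lattice \<Gamma>"
  and dual_lattice_zero: "0 \<in> dual_lattice \<Gamma>"
  and dual_lattice_gen: "\<gamma>' j \<in> dual_lattice \<Gamma>"
  by (auto simp: mem_dual_lattice_iff blinfun.add_left blinfun.minus_left blinfun.diff_left)

section \<open>The half-open fundamental cell as a finite measure space\<close>

lemma fundamental_domain_iff:
  "x \<in> fundamental_domain \<gamma> \<longleftrightarrow> (\<forall>j. 0 \<le> blinfun_apply (\<gamma>' j) x \<and> blinfun_apply (\<gamma>' j) x < 1)"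
proof
  assume "\<forall>j. 0 \<le> blinfun_apply (\<gamma>' j) x \<and> blinfun_apply (\<gamma>' j) x < 1"
  then show "x \<in> fundamental_domain \<gamma>"
    unfolding fundamental_domain_def mem_Collect_eq
    by (intro exI[of _ "\<lambda>j. blinfun_apply (\<gamma>' j) x"]) (simp add: expansion)
qed (auto simp: fundamental_domain_def dual_sum)

lemma borel_fundamental_domain [measurable]: "fundamental_domain \<gamma> \<in> sets borel"
proof -
  have "fundamental_domain \<gamma> = (\<Inter>j. {x. 0 \<le> blinfun_apply (\<gamma>' j) x} \<inter> {x. blinfun_apply (\<gamma>' j) x < 1})"
    by (auto simp: fundamental_domain_iff)
  also have "\<dots> \<in> sets borel"
    by (intro sets.finite_INT sets.Int borel_closed borel_open closed_Collect_le open_Collect_less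
        continuous_intros) auto
  finally show ?thesis .
qed

definition radius :: real where "radius = (\<Sum>j\<in>UNIV. norm (\<gamma> j))"

lemma fundamental_domain_norm: "x \<in> fundamental_domain \<gamma> \<Longrightarrow> norm x \<le> radius"
proof -
  assume x: "x \<in> fundamental_domain \<gamma>"
  have "norm x \<le> (\<Sum>j\<in>UNIV. norm (blinfun_apply (\<gamma>' j) x *\<^sub>R \<gamma> j))"
    by (subst (1) expansion[of x, symmetric]) (rule norm_sum)
  also have "\<dots> \<le> (\<Sum>j\<in>UNIV. norm (\<gamma> j))"
    using x by (intro sum_mono) (auto simp: fundamental_domain_iff intro!: mult_left_le_one_le intro: less_imp_le)
  finally show ?thesis by (simp add: radius_def)
qed

lemma bounded_fundamental_domain: "bounded (fundamental_domain \<gamma>)"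
  using fundamental_domain_norm bounded_iff by blast

definition M :: "(real ^ 'n) measure" where "M = restrict_space lborel (fundamental_domain \<gamma>)"

lemma space_M: "space M = fundamental_domain \<gamma>"
  by (simp add: M_def space_restrict_space)

lemma borel_M: "f \<in> borel_measurable borel \<Longrightarrow> f \<in> borel_measurable M"
  unfolding M_def by (rule measurable_restrict_space1) simp

lemma continuous_M: "continuous_on UNIV f \<Longrightarrow> f \<in> borel_measurable M"
  by (intro borel_M borel_measurable_continuous_onI)

lemma finite_measure_M: "finite_measure M"
  unfolding M_def
  using emeasure_bounded_finite[OF bounded_fundamental_domain]
  by (intro finite_measureI) (simp add: space_restrict_space emeasure_restrict_space)

sublocale finite_measure M by (rule finite_measure_M)

lemma integral_M: "(LINT x:fundamental_domain \<gamma>|lborel. f x) = integral\<^sup>L M f"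
  for f :: "real ^ 'n \<Rightarrow> 'b::{banach, second_countable_topology}"
  unfolding set_lebesgue_integral_def M_def by (subst integral_restrict_space) auto

lemma integrable_M: "set_integrable lborel (fundamental_domain \<gamma>) f \<longleftrightarrow> integrable M f"
  for f :: "real ^ 'n \<Rightarrow> 'b::{banach, second_countable_topology}"
  unfolding set_integrable_def M_def by (subst integrable_restrict_space) auto

lemma integrable_bounded_set:
  fixes f :: "real ^ 'n \<Rightarrow> 'b::{banach, second_countable_topology}"
  assumes "continuous_on UNIV f" "S \<in> sets borel" "bounded S"
  shows "set_integrable lborel S f"
proof -
  have "set_integrable lborel (closure S) f"
    unfolding set_integrable_def using assms
    by (intro borel_integrable_compact) (auto simp: compact_closure intro: continuous_on_subset)
  then show ?thesis
    by (rule set_integrable_subset) (use assms closure_subset in auto)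
qed

lemma integrable_M_cont:
  fixes f :: "real ^ 'n \<Rightarrow> 'b::{banach, second_countable_topology}"
  assumes "continuous_on UNIV f"
  shows "integrable M f"
  using integrable_bounded_set[OF assms borel_fundamental_domain bounded_fundamental_domain]
  by (simp add: integrable_M)

definition vol :: real where "vol = measure M (space M)"

text \<open>The cell is not open, so a point on one of its lower faces need not be interior. This
  lemma is what turns almost-everywhere statements into pointwise ones there too.\<close>

lemma fundamental_domain_open_subset:
  assumes "x \<in> fundamental_domain \<gamma>" "open V" "x \<in> V"
  obtains U where "open U" "U \<noteq> {}" "U \<subseteq> fundamental_domain \<gamma>" "U \<subseteq> V"
proof -
  let ?I = "\<Inter>j. {x. 0 < blinfun_apply (\<gamma>' j) x} \<inter> {x. blinfun_apply (\<gamma>' j) x < 1}"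
  \<comment> \<open>Adding t > 0 to every coordinate leaves the lower faces, and for small t it
    respects the strict upper bounds and stays in \<open>V\<close>.\<close>
  let ?y = "\<lambda>t::real. x + t *\<^sub>R (\<Sum>j\<in>UNIV. 1 *\<^sub>R \<gamma> j)"
  have coord: "blinfun_apply (\<gamma>' j) (?y t) = blinfun_apply (\<gamma>' j) x + t" for j t
    by (simp only: blinfun.add_right blinfun.scaleR_right dual_sum) simp
  have I: "open ?I"
    by (intro open_INT ballI open_Int open_Collect_less continuous_intros) auto
  have y: "(?y \<longlongrightarrow> x) (at_right 0)"
    by (rule tendsto_eq_intros refl tendsto_ident_at | simp)+
  have "\<forall>\<^sub>F t in at_right 0. ?y t \<in> V"
    by (rule topological_tendstoD[OF y assms(2,3)])
  moreover have "\<forall>\<^sub>F t in at_right 0. \<forall>j\<in>UNIV. blinfun_apply (\<gamma>' j) x + t < 1"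
  proof (rule eventually_ball_finite[OF finite_class.finite_UNIV], rule ballI)
    fix j
    have "((\<lambda>t. blinfun_apply (\<gamma>' j) x + t) \<longlongrightarrow> blinfun_apply (\<gamma>' j) x + 0) (at_right 0)"
      by (intro tendsto_intros)
    then show "\<forall>\<^sub>F t in at_right 0. blinfun_apply (\<gamma>' j) x + t < 1"
      using assms(1) by (intro order_tendstoD(2)) (auto simp: fundamental_domain_iff)
  qed
  moreover have "\<forall>\<^sub>F t::real in at_right 0. 0 < t"
    by (rule eventually_at_right_less)
  ultimately have "\<forall>\<^sub>F t in at_right 0. ?y t \<in> ?I \<inter> V"
  proof eventually_elim
    case (elim t)
    have "0 < blinfun_apply (\<gamma>' j) x + t" for j
      using elim assms(1) by (auto simp: fundamental_domain_iff intro: add_nonneg_pos)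
    with elim show ?case by (simp only: coord INT_iff Int_iff mem_Collect_eq) simp
  qed
  then obtain t where "?y t \<in> ?I \<inter> V"
    using eventually_happens'[OF trivial_limit_at_right_real] by blast
  then show thesis
    using I assms(2) by (intro that[of "?I \<inter> V"]) (auto simp: fundamental_domain_iff less_imp_le)
qed

lemma vol_pos: "vol > 0"
proof -
  obtain U where U: "open U" "U \<noteq> {}" "U \<subseteq> fundamental_domain \<gamma>"
    by (rule fundamental_domain_open_subset[of 0 UNIV])
      (auto simp: fundamental_domain_iff blinfun.zero_right)
  have "emeasure lborel U \<noteq> 0"
    using open_not_negligible[OF U(1,2)] U(1) by (auto simp: negligible_iff_emeasure0)
  then have "emeasure lborel (fundamental_domain \<gamma>) \<noteq> 0"
    using emeasure_mono[OF U(3), of lborel] by auto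
  then have "emeasure M (space M) \<noteq> 0"
    by (simp add: space_M) (simp add: M_def emeasure_restrict_space)
  then show ?thesis
    unfolding vol_def by (simp add: emeasure_eq_measure zero_less_measure_iff)
qed

text \<open>If \<open>f\<close> did not vanish at \<open>x\<close>, it would be nonzero on a
  nonempty open part of the cell, which has positive measure.\<close>

lemma AE_M_cont_zero:
  fixes f :: "real ^ 'n \<Rightarrow> real"
  assumes f: "continuous_on UNIV f" "AE x in M. f x = 0" and x: "x \<in> fundamental_domain \<gamma>"
  shows "f x = 0"
proof (rule ccontr)
  assume "f x \<noteq> 0"
  have "open {x. f x \<noteq> 0}"
    by (intro open_Collect_neq f continuous_intros)
  with x \<open>f x \<noteq> 0\<close> obtain V where V: "open V" "V \<noteq> {}" "V \<subseteq> fundamental_domain \<gamma>" "V \<subseteq> {x. f x \<noteq> 0}"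
    using fundamental_domain_open_subset[of x "{x. f x \<noteq> 0}"] by auto
  have "AE x in lborel. x \<in> fundamental_domain \<gamma> \<longrightarrow> f x = 0"
    using f(2) unfolding M_def by (subst (asm) AE_restrict_space_iff) auto
  then have "AE x in lborel. x \<notin> V"
    by eventually_elim (use V in auto)
  then have "emeasure lborel V = 0"
    using V(1) AE_iff_null_sets[of V lborel] by (auto simp: null_sets_def)
  then have "negligible V"
    using V(1) by (auto simp: negligible_iff_emeasure0)
  then show False
    using open_not_negligible[OF V(1,2)] by auto
qed

end

section \<open>Integration by parts on the torus\<close>

lemma lborel_integral_shift:
  fixes f :: "'a::euclidean_space \<Rightarrow> 'b::{banach, second_countable_topology}"
  assumes [measurable]: "f \<in> borel_measurable borel"
  shows "(LINT x|lborel. f (x + v)) = (LINT x|lborel. f x)"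
proof -
  have "(LINT x|lborel. f x) = (LINT x|distr lborel borel ((+) v). f x)"
    by (simp add: lborel_distr_plus)
  also have "\<dots> = (LINT x|lborel. f (x + v))"
    by (subst integral_distr) (auto simp: add.commute)
  finally show ?thesis ..
qed

lemma continuous_on_shift: "continuous_on UNIV f \<Longrightarrow> continuous_on UNIV (\<lambda>x. f (x + v))"
  for f :: "'a::real_normed_vector \<Rightarrow> 'b::topological_space"
  by (rule continuous_on_compose2) (auto intro!: continuous_intros)

context flat_torus
begin

definition periodic :: "(real ^ 'n \<Rightarrow> 'b) \<Rightarrow> bool" where
  "periodic f \<longleftrightarrow> (\<forall>x. \<forall>v\<in>\<Gamma>. f (x + v) = f x)"

text \<open>A shift along one generator pushes a slab out of the cell. Periodicity brings the slab
  back through the opposite face, so the integral is unchanged.\<close>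

lemma integral_M_shift:
  fixes f :: "real ^ 'n \<Rightarrow> 'b::{banach, second_countable_topology}"
  assumes f: "continuous_on UNIV f" "periodic f" and s: "0 \<le> s" "s \<le> 1"
  shows "(LINT x|M. f (x + s *\<^sub>R \<gamma> j)) = (LINT x|M. f x)"
proof -
  let ?D = "fundamental_domain \<gamma>"
  have [measurable]: "f \<in> borel_measurable borel"
    by (rule borel_measurable_continuous_onI) fact
  \<comment> \<open>The cell is cut where the j-th coordinate equals 1 - s. The shift by s carries
    \<open>P1\<close> onto \<open>Q1\<close>, the shift by s - 1 carries \<open>P2\<close> onto
    \<open>Q2\<close>, and the two images again fill the cell.\<close>
  define P1 where "P1 = {x \<in> ?D. blinfun_apply (\<gamma>' j) x < 1 - s}"
  define P2 where "P2 = {x \<in> ?D. 1 - s \<le> blinfun_apply (\<gamma>' j) x}"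
  define Q1 where "Q1 = {x \<in> ?D. s \<le> blinfun_apply (\<gamma>' j) x}"
  define Q2 where "Q2 = {x \<in> ?D. blinfun_apply (\<gamma>' j) x < s}"
  note defs = P1_def P2_def Q1_def Q2_def
  have [measurable]: "(\<lambda>x. blinfun_apply (\<gamma>' j) x) \<in> borel_measurable borel"
    by (intro borel_measurable_continuous_onI continuous_intros)
  have sets: "P1 \<in> sets borel" "P2 \<in> sets borel" "Q1 \<in> sets borel" "Q2 \<in> sets borel"
    unfolding defs by measurable
  note sets[measurable]
  have "P1 \<subseteq> ?D" "P2 \<subseteq> ?D" "Q1 \<subseteq> ?D" "Q2 \<subseteq> ?D" by (auto simp: defs)
  then have bnd: "bounded P1" "bounded P2" "bounded Q1" "bounded Q2"
    using bounded_fundamental_domain bounded_subset by blast+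
  note shift = continuous_on_shift[OF f(1)]
  have move: "(LINT x:P|lborel. f (x + v)) = (LINT x:Q|lborel. f x)"
    if [measurable]: "P \<in> sets borel" "Q \<in> sets borel" and "\<And>x. x + v \<in> Q \<longleftrightarrow> x \<in> P" for P Q v
  proof -
    have "(\<lambda>x. indicator Q x *\<^sub>R f x) \<in> borel_measurable borel" by measurable
    from lborel_integral_shift[OF this, of v] that(3) show ?thesis
      by (simp add: set_lebesgue_integral_def indicator_def)
  qed
  have coord: "blinfun_apply (\<gamma>' i) (x + t *\<^sub>R \<gamma> j) = blinfun_apply (\<gamma>' i) x + (if i = j then t else 0)"
    for i x t by (simp add: blinfun.add_right blinfun.scaleR_right)
  have dom: "x \<in> ?D \<longleftrightarrow> (0 \<le> blinfun_apply (\<gamma>' j) x \<and> blinfun_apply (\<gamma>' j) x < 1) \<and>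
      (\<forall>i. i \<noteq> j \<longrightarrow> 0 \<le> blinfun_apply (\<gamma>' i) x \<and> blinfun_apply (\<gamma>' i) x < 1)" for x
    unfolding fundamental_domain_iff by metis
  have "(LINT x|M. f (x + s *\<^sub>R \<gamma> j)) = (LINT x:P1 \<union> P2|lborel. f (x + s *\<^sub>R \<gamma> j))"
    unfolding integral_M[symmetric] by (rule arg_cong[where f = "\<lambda>S. set_lebesgue_integral lborel S _"]) (auto simp: defs)
  also have "\<dots> = (LINT x:P1|lborel. f (x + s *\<^sub>R \<gamma> j)) + (LINT x:P2|lborel. f (x + s *\<^sub>R \<gamma> j))"
    by (intro set_integral_Un integrable_bounded_set shift sets bnd) (auto simp: defs)
  also have "(LINT x:P2|lborel. f (x + s *\<^sub>R \<gamma> j)) = (LINT x:P2|lborel. f (x + (s - 1) *\<^sub>R \<gamma> j))"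
  proof -
    have "f (x + (s - 1) *\<^sub>R \<gamma> j + \<gamma> j) = f (x + (s - 1) *\<^sub>R \<gamma> j)" for x
      using f(2) lattice_gen[of j] by (simp only: periodic_def)
    then have "f (x + s *\<^sub>R \<gamma> j) = f (x + (s - 1) *\<^sub>R \<gamma> j)" for x
      by (simp add: algebra_simps)
    then show ?thesis by simp
  qed
  also have "(LINT x:P1|lborel. f (x + s *\<^sub>R \<gamma> j)) = (LINT x:Q1|lborel. f x)"
  proof (intro move sets)
    fix x show "x + s *\<^sub>R \<gamma> j \<in> Q1 \<longleftrightarrow> x \<in> P1"
      unfolding defs mem_Collect_eq dom coord using s by auto
  qed
  also have "(LINT x:P2|lborel. f (x + (s - 1) *\<^sub>R \<gamma> j)) = (LINT x:Q2|lborel. f x)"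
  proof (intro move sets)
    fix x show "x + (s - 1) *\<^sub>R \<gamma> j \<in> Q2 \<longleftrightarrow> x \<in> P2"
      unfolding defs mem_Collect_eq dom coord using s by auto
  qed
  also have "(LINT x:Q1|lborel. f x) + (LINT x:Q2|lborel. f x) = (LINT x:Q1 \<union> Q2|lborel. f x)"
    by (intro set_integral_Un[symmetric] integrable_bounded_set f sets bnd) (auto simp: defs)
  also have "\<dots> = (LINT x|M. f x)"
    unfolding integral_M[symmetric] by (rule arg_cong[where f = "\<lambda>S. set_lebesgue_integral lborel S _"]) (auto simp: defs)
  finally show ?thesis .
qed

text \<open>Difference quotients of a periodic function have integral zero by
  \<open>integral_M_shift\<close>, and dominated convergence passes this to the derivative. No
  boundary of the cell enters.\<close>

lemma integral_M_derivative_gen: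
  fixes f :: "real ^ 'n \<Rightarrow> 'b::{banach, second_countable_topology}"
  assumes f: "\<And>x. (f has_derivative f' x) (at x)" and per: "periodic f"
    and cont: "continuous_on UNIV (\<lambda>x. f' x (\<gamma> j))"
  shows "(LINT x|M. f' x (\<gamma> j)) = 0"
proof -
  have contf: "continuous_on UNIV f"
    by (intro continuous_at_imp_continuous_on ballI has_derivative_continuous[OF f])
  have lin: "linear (f' x)" for x using f has_derivative_linear by blast
  \<comment> \<open>The ball of this radius contains every segment from a point of the cell along at
    most one full generator, so a single bound \<open>B\<close> serves all difference quotients
    through the mean value inequality.\<close>
  define R where "R = radius + norm (\<gamma> j)"
  have "bounded ((\<lambda>x. f' x (\<gamma> j)) ` cball 0 R)"
    by (rule compact_imp_bounded[OF compact_continuous_image[OF continuous_on_subset[OF cont subset_UNIV] compact_cball]])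
  then obtain B where "\<forall>y\<in>(\<lambda>x. f' x (\<gamma> j)) ` cball 0 R. norm y \<le> B"
    unfolding bounded_iff ..
  then have B: "norm (f' x (\<gamma> j)) \<le> B" if "x \<in> cball 0 R" for x
    using that by blast
  \<comment> \<open>The increments 1/(k+1) stay in the range (0, 1] for which shift invariance is
    available.\<close>
  define s :: "nat \<Rightarrow> real" where "s = (\<lambda>k. inverse (real (Suc k)))"
  have s: "0 < s k" "s k \<le> 1" for k by (auto simp: s_def divide_simps)
  define q where "q = (\<lambda>k x. (f (x + s k *\<^sub>R \<gamma> j) - f x) /\<^sub>R s k)"
  have contq: "continuous_on UNIV (q k)" for k
    unfolding q_def by (intro continuous_intros continuous_on_shift contf)
  have int0: "(LINT x|M. q k x) = 0" for k
  proof -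
    note continuous_on_shift[OF contf]
    then have "(LINT x|M. f (x + s k *\<^sub>R \<gamma> j) - f x) = (LINT x|M. f (x + s k *\<^sub>R \<gamma> j)) - (LINT x|M. f x)"
      by (intro Bochner_Integration.integral_diff integrable_M_cont contf)
    also have "\<dots> = 0" using s[of k] integral_M_shift[OF contf per, of "s k" j] by simp
    finally show ?thesis unfolding q_def by simp
  qed
  have "(\<lambda>k. LINT x|M. q k x) \<longlonglongrightarrow> (LINT x|M. f' x (\<gamma> j))"
  proof (rule integral_dominated_convergence[where w = "\<lambda>_. B"])
    show "(\<lambda>x. f' x (\<gamma> j)) \<in> borel_measurable M" by (rule continuous_M[OF cont])
    show "q k \<in> borel_measurable M" for k by (rule continuous_M[OF contq])
    show "integrable M (\<lambda>_. B)" by simp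
    show "AE x in M. (\<lambda>k. q k x) \<longlonglongrightarrow> f' x (\<gamma> j)"
    proof (rule AE_I2)
      fix x
      have "((\<lambda>t. f (x + t *\<^sub>R \<gamma> j)) has_derivative (\<lambda>t. f' x (t *\<^sub>R \<gamma> j))) (at 0)"
      proof -
        have "((\<lambda>t. x + t *\<^sub>R \<gamma> j) has_derivative (\<lambda>t. t *\<^sub>R \<gamma> j)) (at 0)"
          by (auto intro!: derivative_eq_intros)
        moreover have "(f has_derivative f' x) (at (x + 0 *\<^sub>R \<gamma> j))" using f[of x] by simp
        ultimately show ?thesis by (rule has_derivative_compose)
      qed
      then have lim: "((\<lambda>t. norm (f (x + t *\<^sub>R \<gamma> j) - f x - t *\<^sub>R f' x (\<gamma> j)) / norm t) \<longlongrightarrow> 0) (at 0)"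
        by (simp add: has_derivative_at linear_scale[OF lin])
      have "filterlim s (at 0) sequentially"
        unfolding filterlim_at s_def using LIMSEQ_inverse_real_of_nat by (auto simp del: of_nat_Suc)
      from filterlim_compose[OF lim this]
      have "(\<lambda>k. norm (f (x + s k *\<^sub>R \<gamma> j) - f x - s k *\<^sub>R f' x (\<gamma> j)) / norm (s k)) \<longlonglongrightarrow> 0" .
      also have "(\<lambda>k. norm (f (x + s k *\<^sub>R \<gamma> j) - f x - s k *\<^sub>R f' x (\<gamma> j)) / norm (s k)) =
          (\<lambda>k. norm (q k x - f' x (\<gamma> j)))"
      proof
        fix k
        have "q k x - f' x (\<gamma> j) = (f (x + s k *\<^sub>R \<gamma> j) - f x - s k *\<^sub>R f' x (\<gamma> j)) /\<^sub>R s k"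
          using s(1)[of k] by (simp add: q_def scaleR_right_diff_distrib)
        then show "norm (f (x + s k *\<^sub>R \<gamma> j) - f x - s k *\<^sub>R f' x (\<gamma> j)) / norm (s k) =
            norm (q k x - f' x (\<gamma> j))"
          by (simp add: divide_inverse_commute)
      qed
      finally show "(\<lambda>k. q k x) \<longlonglongrightarrow> f' x (\<gamma> j)"
        by (simp only: tendsto_norm_zero_iff LIM_zero_iff)
    qed
    show "AE x in M. norm (q k x) \<le> B" for k
    proof (rule AE_I2)
      fix x assume "x \<in> space M"
      then have x: "norm x \<le> radius" by (simp add: space_M fundamental_domain_norm)
      have "norm (f (x + s k *\<^sub>R \<gamma> j) - f (x + 0 *\<^sub>R \<gamma> j)) \<le> B * norm (s k - 0)"
      proof (rule differentiable_bound[of "{0..s k}" "\<lambda>t. f (x + t *\<^sub>R \<gamma> j)"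
            "\<lambda>t h. h *\<^sub>R f' (x + t *\<^sub>R \<gamma> j) (\<gamma> j)"])
        fix t assume t: "t \<in> {0..s k}"
        have "((\<lambda>t. x + t *\<^sub>R \<gamma> j) has_derivative (\<lambda>t. t *\<^sub>R \<gamma> j)) (at t within {0..s k})"
          by (auto intro!: derivative_eq_intros)
        from has_derivative_compose[OF this f]
        show "((\<lambda>t. f (x + t *\<^sub>R \<gamma> j)) has_derivative (\<lambda>h. h *\<^sub>R f' (x + t *\<^sub>R \<gamma> j) (\<gamma> j))) (at t within {0..s k})"
          by (simp add: linear_scale[OF lin])
        have "norm (x + t *\<^sub>R \<gamma> j) \<le> norm x + norm (t *\<^sub>R \<gamma> j)" by (rule norm_triangle_ineq)
        also have "norm (t *\<^sub>R \<gamma> j) \<le> 1 * norm (\<gamma> j)"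
          unfolding norm_scaleR using t s(2)[of k] by (intro mult_right_mono) auto
        finally have "norm (f' (x + t *\<^sub>R \<gamma> j) (\<gamma> j)) \<le> B"
          using x by (intro B) (auto simp: R_def)
        then show "onorm (\<lambda>h. h *\<^sub>R f' (x + t *\<^sub>R \<gamma> j) (\<gamma> j)) \<le> B"
          by (intro onorm_le) (simp add: mult.commute[of B] mult_left_mono)
      qed (use s[of k] in auto)
      then show "norm (q k x) \<le> B"
        using s(1)[of k] by (simp add: q_def pos_divide_le_eq flip: divide_inverse_commute)
    qed
  qed
  then show ?thesis
    unfolding int0 by (simp add: LIMSEQ_const_iff)
qed

lemma integral_M_derivative:
  fixes f :: "real ^ 'n \<Rightarrow> 'b::{banach, second_countable_topology}"
  assumes f: "\<And>x. (f has_derivative f' x) (at x)" and per: "periodic f"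
    and cont: "\<And>v. continuous_on UNIV (\<lambda>x. f' x v)"
  shows "(LINT x|M. f' x v) = 0"
proof -
  have lin: "linear (f' x)" for x using f has_derivative_linear by blast
  have "f' x v = (\<Sum>j\<in>UNIV. blinfun_apply (\<gamma>' j) v *\<^sub>R f' x (\<gamma> j))" for x
    using expansion[of v] linear_sum[OF lin[of x], of "\<lambda>j. blinfun_apply (\<gamma>' j) v *\<^sub>R \<gamma> j" UNIV]
    by (simp add: linear_scale[OF lin])
  then have "(LINT x|M. f' x v) = (\<Sum>j\<in>UNIV. LINT x|M. blinfun_apply (\<gamma>' j) v *\<^sub>R f' x (\<gamma> j))"
    using cont by (simp add: Bochner_Integration.integral_sum integrable_M_cont)
  also have "\<dots> = 0"
    using integral_M_derivative_gen[OF f per cont] by simp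
  finally show ?thesis .
qed

lemma periodic_wave: "g \<in> dual_lattice \<Gamma> \<Longrightarrow> periodic (wave g)"
  unfolding periodic_def dual_lattice_def by (auto simp: wave_add_arg wave_eq_1)

text \<open>For \<open>g \<noteq> 0\<close> the derivative of the wave along some direction is a
  nonzero multiple of the wave, and integrals of derivatives vanish.\<close>

lemma integral_wave:
  assumes "g \<in> dual_lattice \<Gamma>"
  shows "(LINT x|M. wave g x) = (if g = 0 then of_real vol else 0)"
proof (cases "g = 0")
  case True
  then show ?thesis by (simp add: vol_def scaleR_conv_of_real)
next
  case False
  then obtain v where v: "blinfun_apply g v \<noteq> 0"
    by (metis blinfun_eqI zero_blinfun.rep_eq)
  have "(LINT x|M. (2 * pi * \<i> * blinfun_apply g v) * wave g x) = 0"
    by (rule integral_M_derivative[OF has_derivative_wave periodic_wave[OF assms]])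
      (intro continuous_intros)
  then show ?thesis using False v by simp
qed

end

section \<open>Density of trigonometric polynomials\<close>

text \<open>The function is continuous off the nonnegative real axis and equal to 0 on it, so
  cutting it off by the indicator of that open complement changes nothing.\<close>

lemma Arg2pi_measurable [measurable]: "Arg2pi \<in> borel_measurable borel"
proof -
  have "(\<lambda>z. indicator (- \<real>\<^sub>\<ge>\<^sub>0) z *\<^sub>R Arg2pi z) \<in> borel_measurable borel"
    by (intro borel_measurable_continuous_on_indicator continuous_at_imp_continuous_on ballI
        continuous_at_Arg2pi borel_open open_Compl) auto
  moreover have "(\<lambda>z. indicator (- \<real>\<^sub>\<ge>\<^sub>0) z *\<^sub>R Arg2pi z) = Arg2pi"
    by (auto simp: fun_eq_iff indicator_def Arg2pi_eq_0 complex_nonneg_Reals_iff complex_is_Real_iff)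
  ultimately show ?thesis by simp
qed

lemma measurable_vec_nth [measurable]: "(\<lambda>x :: 'a::euclidean_space ^ 'n. x $ i) \<in> borel_measurable borel"
  by (intro borel_measurable_continuous_onI continuous_intros)

lemma norm_vec_square: "(norm x)\<^sup>2 = (\<Sum>i\<in>UNIV. (norm (x $ i))\<^sup>2)"
  by (simp add: norm_vec_def L2_set_def sum_nonneg)

context flat_torus
begin

text \<open>Generating the class by single waves and sums spares index sets while closure under
  products is proved; explicit coefficients return with \<open>trig_poly\<close>.\<close>

inductive trig :: "(real ^ 'n \<Rightarrow> complex) \<Rightarrow> bool" where
  wave: "g \<in> dual_lattice \<Gamma> \<Longrightarrow> trig (\<lambda>x. a * wave g x)"
| add: "trig f \<Longrightarrow> trig h \<Longrightarrow> trig (\<lambda>x. f x + h x)"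

lemma trig_const: "trig (\<lambda>x. a)"
  using trig.wave[OF dual_lattice_zero, of a] by simp

lemma trig_sum: "finite I \<Longrightarrow> (\<And>i. i \<in> I \<Longrightarrow> trig (f i)) \<Longrightarrow> trig (\<lambda>x. \<Sum>i\<in>I. f i x)"
  by (induction rule: finite_induct) (auto intro: trig_const trig.add)

lemma trig_mult_wave: "trig f \<Longrightarrow> h \<in> dual_lattice \<Gamma> \<Longrightarrow> trig (\<lambda>x. f x * (b * wave h x))"
proof (induction rule: trig.induct)
  case (wave g a)
  then show ?case
    using trig.wave[OF dual_lattice_add, of g h "a * b"] by (simp add: wave_add mult_ac)
qed (auto simp: distrib_right intro: trig.add)

lemma trig_mult: "trig h \<Longrightarrow> trig f \<Longrightarrow> trig (\<lambda>x. f x * h x)"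
  by (induction rule: trig.induct) (auto simp: distrib_left intro: trig.add trig_mult_wave)

text \<open>The map \<open>torus_embed\<close> identifies the torus with a product of circles, on which polynomials
  restrict to trigonometric polynomials.\<close>

definition torus_embed :: "real ^ 'n \<Rightarrow> complex ^ 'n" where
  "torus_embed x = (\<chi> j. wave (\<gamma>' j) x)"

text \<open>Values of \<open>Arg2pi\<close> lie in [0, 2 pi), matching the half-open cell, so this
  is a left inverse of \<open>torus_embed\<close> there. It is discontinuous; only its measurability
  is used.\<close>

definition torus_unembed :: "complex ^ 'n \<Rightarrow> real ^ 'n" where
  "torus_unembed z = (\<Sum>j\<in>UNIV. (Arg2pi (z $ j) / (2 * pi)) *\<^sub>R \<gamma> j)"

lemma unembed_embed: "x \<in> fundamental_domain \<gamma> \<Longrightarrow> torus_unembed (torus_embed x) = x"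
proof -
  assume x: "x \<in> fundamental_domain \<gamma>"
  have "Arg2pi (wave (\<gamma>' j) x) = 2 * pi * blinfun_apply (\<gamma>' j) x" for j
    unfolding wave_def cis_conv_exp using x
    by (subst Arg2pi_exp) (auto simp: fundamental_domain_iff)
  then show ?thesis by (simp add: torus_unembed_def torus_embed_def expansion)
qed

lemma continuous_embed: "continuous_on UNIV torus_embed"
  unfolding torus_embed_def by (intro continuous_intros)

lemma borel_unembed [measurable]: "torus_unembed \<in> borel_measurable borel"
  unfolding torus_unembed_def by measurable

definition product_of_circles :: "(complex ^ 'n) set" where
  "product_of_circles = {z. \<forall>j. norm (z $ j) = 1}"

lemma compact_product_of_circles: "compact product_of_circles"
proof -
  have "norm z \<le> (\<Sum>j\<in>(UNIV :: 'n set). 1)" if "z \<in> product_of_circles" for z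
    unfolding norm_vec_def using that L2_set_le_sum[of UNIV "\<lambda>j. norm (z $ j)"]
    by (simp add: product_of_circles_def)
  then have "bounded product_of_circles" unfolding bounded_iff by blast
  moreover have "closed (\<Inter>j. {z :: complex ^ 'n. norm (z $ j) = 1})"
    by (intro closed_INT ballI closed_Collect_eq continuous_intros)
  moreover have "product_of_circles = (\<Inter>j. {z. norm (z $ j) = 1})"
    by (auto simp: product_of_circles_def)
  ultimately show ?thesis by (simp add: compact_eq_bounded_closed)
qed

text \<open>Real and imaginary parts of a wave are combinations of the wave and its conjugate, the
  wave of the negative covector; products stay inside because the dual lattice is a group.\<close>

lemma trig_polynomial_embed:
  "real_polynomial_function p \<Longrightarrow> trig (\<lambda>x. of_real (p (torus_embed x)))"
proof (induction rule: real_polynomial_function.induct)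
  case (linear f)
  have re: "trig (\<lambda>x. of_real (Re (wave (\<gamma>' j) x)))" for j
  proof -
    have "of_real (Re w) = (1 / 2) * w + (1 / 2) * cnj w" for w
      by (simp add: complex_eq_iff)
    then show ?thesis
      using trig.add[OF trig.wave[OF dual_lattice_gen] trig.wave[OF dual_lattice_minus[OF dual_lattice_gen]], of "1 / 2" j "1 / 2" j]
      by (simp add: wave_minus)
  qed
  have im: "trig (\<lambda>x. of_real (Im (wave (\<gamma>' j) x)))" for j
  proof -
    have "of_real (Im w) = (- \<i> / 2) * w + (\<i> / 2) * cnj w" for w
      by (simp add: complex_eq_iff)
    then show ?thesis
      using trig.add[OF trig.wave[OF dual_lattice_gen] trig.wave[OF dual_lattice_minus[OF dual_lattice_gen]], of "- \<i> / 2" j "\<i> / 2" j]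
      by (simp add: wave_minus)
  qed
  have "trig (\<lambda>x. of_real (torus_embed x \<bullet> b))" if "b \<in> Basis" for b
  proof -
    from that obtain j where "b = axis j 1 \<or> b = axis j \<i>"
      by (auto simp: Basis_vec_def Basis_complex_def)
    then show ?thesis
      using re[of j] im[of j] by (auto simp: inner_axis torus_embed_def inner_complex_def)
  qed
  then have t: "trig (\<lambda>x. \<Sum>b\<in>Basis. of_real (f b) * of_real (torus_embed x \<bullet> b))"
    by (intro trig_sum trig_mult trig_const) auto
  have fz: "f z = (\<Sum>b\<in>Basis. f b * (z \<bullet> b))" for z
  proof -
    have "f z = f (\<Sum>b\<in>Basis. (z \<bullet> b) *\<^sub>R b)" by (simp only: euclidean_representation)
    also have "\<dots> = (\<Sum>b\<in>Basis. f ((z \<bullet> b) *\<^sub>R b))"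
      by (rule linear_sum[OF bounded_linear.linear[OF linear]])
    also have "\<dots> = (\<Sum>b\<in>Basis. f b * (z \<bullet> b))"
      by (intro sum.cong refl) (simp add: linear_scale[OF bounded_linear.linear[OF linear]])
    finally show ?thesis .
  qed
  have eq: "complex_of_real (f (torus_embed x)) = (\<Sum>b\<in>Basis. of_real (f b) * of_real (torus_embed x \<bullet> b))" for x
    by (subst (1) fz) simp
  from t show ?case by (simp only: eq)
qed (auto intro: trig_const trig.add trig_mult)

text \<open>Pushing the measure forward to the product of circles brings \<open>f\<close> under
  \<open>polynomials_dense_L2\<close>. Only the values of \<open>f\<close> on the cell matter, so
  \<open>f\<close> itself may be any square-integrable Borel function there.\<close>

lemma trig_dense_real:
  fixes f :: "real ^ 'n \<Rightarrow> real"
  assumes f: "f \<in> borel_measurable borel" "integrable M (\<lambda>x. (f x)\<^sup>2)" and "\<epsilon> > 0"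
  obtains p where "continuous_on UNIV p" "trig (\<lambda>x. of_real (p x))"
    "integrable M (\<lambda>x. (f x - p x)\<^sup>2)" "(LINT x|M. (f x - p x)\<^sup>2) < \<epsilon>"
proof -
  define \<nu> where "\<nu> = distr M borel torus_embed"
  have E: "torus_embed \<in> measurable M borel" by (rule continuous_M[OF continuous_embed])
  have fin: "finite_measure \<nu>" unfolding \<nu>_def by (rule finite_measure_distr[OF E])
  have sets: "sets \<nu> = sets borel" by (simp add: \<nu>_def)
  have AE: "AE z in \<nu>. z \<in> product_of_circles"
    unfolding \<nu>_def
    by (subst AE_distr_iff[OF E]) (auto simp: product_of_circles_def torus_embed_def
       intro: borel_closed compact_imp_closed[OF compact_product_of_circles, unfolded product_of_circles_def])
  define F where "F = (\<lambda>z. f (torus_unembed z))"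
  have F: "F \<in> borel_measurable borel"
    unfolding F_def using f(1) by measurable
  have FE: "F (torus_embed x) = f x" if "x \<in> space M" for x
    using that by (simp add: F_def space_M unembed_embed)
  have "integrable M (\<lambda>x. (F (torus_embed x))\<^sup>2)"
    using f(2) FE by (simp cong: Bochner_Integration.integrable_cong)
  then have "integrable \<nu> (\<lambda>z. (F z)\<^sup>2)"
    unfolding \<nu>_def using F by (subst integrable_distr_eq[OF E]) auto
  from polynomials_dense_L2[OF fin sets compact_product_of_circles AE F this] \<open>\<epsilon> > 0\<close>
  obtain p where p: "real_polynomial_function p" "integrable \<nu> (\<lambda>z. (F z - p z)\<^sup>2)"
      "(LINT z|\<nu>. (F z - p z)\<^sup>2) < \<epsilon>"
    unfolding L2_approximable_def by blast
  have m: "(\<lambda>z. (F z - p z)\<^sup>2) \<in> borel_measurable borel"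
    using F real_polynomial_function_borel[OF p(1)] by measurable
  show thesis
  proof (rule that[of "\<lambda>x. p (torus_embed x)"])
    show "continuous_on UNIV (\<lambda>x. p (torus_embed x))"
      using p(1) continuous_embed
      by (metis continuous_on_compose2 continuous_on_polymonial_function real_polynomial_function_eq subset_UNIV)
    show "trig (\<lambda>x. of_real (p (torus_embed x)))" by (rule trig_polynomial_embed[OF p(1)])
    show "integrable M (\<lambda>x. (f x - p (torus_embed x))\<^sup>2)"
      using p(2) FE unfolding \<nu>_def by (subst (asm) integrable_distr_eq[OF E m]) (simp cong: Bochner_Integration.integrable_cong)
    show "(LINT x|M. (f x - p (torus_embed x))\<^sup>2) < \<epsilon>"
      using p(3) FE unfolding \<nu>_def by (subst (asm) integral_distr[OF E m]) (simp cong: Bochner_Integration.integral_cong)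
  qed
qed

text \<open>Modes are indexed by points \<open>g\<close> of the dual lattice and shifted by
  \<open>\<tau>\<close>, so periodic (\<open>\<tau> = 0\<close>) and twisted fields share one
  form.\<close>

definition trig_poly :: "((real ^ 'n) \<Rightarrow>\<^sub>L real) \<Rightarrow> ((real ^ 'n) \<Rightarrow>\<^sub>L real) set \<Rightarrow>
    (((real ^ 'n) \<Rightarrow>\<^sub>L real) \<Rightarrow> complex ^ 's) \<Rightarrow> real ^ 'n \<Rightarrow> complex ^ 's" where
  "trig_poly \<tau> F a x = (\<Sum>g\<in>F. wave (g + \<tau>) x *s a g)"

lemma trig_poly_add:
  assumes "finite F" "finite G"
  shows "trig_poly \<tau> F a x + trig_poly \<tau> G b x =
    trig_poly \<tau> (F \<union> G) (\<lambda>g. (if g \<in> F then a g else 0) + (if g \<in> G then b g else 0)) x"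
proof -
  have "trig_poly \<tau> F a x = (\<Sum>g\<in>F \<union> G. wave (g + \<tau>) x *s (if g \<in> F then a g else 0))"
    unfolding trig_poly_def by (rule sum.mono_neutral_cong_left) (use assms in auto)
  moreover have "trig_poly \<tau> G b x = (\<Sum>g\<in>F \<union> G. wave (g + \<tau>) x *s (if g \<in> G then b g else 0))"
    unfolding trig_poly_def by (rule sum.mono_neutral_cong_left) (use assms in auto)
  ultimately show ?thesis
    by (simp add: trig_poly_def sum.distrib vec.scale_right_distrib)
qed

lemma trig_poly_sum:
  assumes "finite I" "\<And>i. i \<in> I \<Longrightarrow> \<exists>F a. finite F \<and> F \<subseteq> dual_lattice \<Gamma> \<and> f i = trig_poly \<tau> F a"
  shows "\<exists>F a. finite F \<and> F \<subseteq> dual_lattice \<Gamma> \<and> (\<lambda>x. \<Sum>i\<in>I. f i x) = trig_poly \<tau> F (a :: _ \<Rightarrow> complex ^ 's)"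
  using assms
proof (induction rule: finite_induct)
  case empty
  show ?case by (rule exI[of _ "{}"]) (auto simp: trig_poly_def)
next
  case (insert i I)
  obtain F :: "((real ^ 'n) \<Rightarrow>\<^sub>L real) set" and a where F: "finite F" "F \<subseteq> dual_lattice \<Gamma>" "f i = trig_poly \<tau> F a"
    using insert.prems[of i] by auto
  obtain G :: "((real ^ 'n) \<Rightarrow>\<^sub>L real) set" and b where G: "finite G" "G \<subseteq> dual_lattice \<Gamma>"
      "(\<lambda>x. \<Sum>i\<in>I. f i x) = trig_poly \<tau> G b"
    using insert.IH insert.prems by auto
  have "(\<Sum>i\<in>insert i I. f i x) = trig_poly \<tau> F a x + trig_poly \<tau> G b x" for x
    using insert.hyps F(3) G(3) by (simp add: fun_eq_iff)
  then show ?case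
    unfolding trig_poly_add[OF F(1) G(1)] using F G
    by (intro exI[of _ "F \<union> G"] exI conjI) (auto simp: fun_eq_iff)
qed

lemma trig_imp_trig_poly:
  "trig f \<Longrightarrow> \<exists>F a. finite F \<and> F \<subseteq> dual_lattice \<Gamma> \<and> (\<lambda>x. f x *s v) = trig_poly 0 F (a :: _ \<Rightarrow> complex ^ 's)"
proof (induction rule: trig.induct)
  case (wave g a)
  then show ?case
    by (intro exI[of _ "{g}"] exI[of _ "\<lambda>_. a *s v"]) (auto simp: trig_poly_def fun_eq_iff mult.commute)
next
  case (add f h)
  then obtain F G :: "((real ^ 'n) \<Rightarrow>\<^sub>L real) set" and a b where
     F: "finite F" "F \<subseteq> dual_lattice \<Gamma>" "(\<lambda>x. f x *s v) = trig_poly 0 F a" and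
     G: "finite G" "G \<subseteq> dual_lattice \<Gamma>" "(\<lambda>x. h x *s v) = trig_poly 0 G b" by blast
  have "(f x + h x) *s v = trig_poly 0 F a x + trig_poly 0 G b x" for x
    using F(3) G(3) by (simp add: fun_eq_iff vec.scale_left_distrib)
  then show ?case
    unfolding trig_poly_add[OF F(1) G(1)] using F G
    by (intro exI[of _ "F \<union> G"] exI conjI) (auto simp: fun_eq_iff)
qed

lemma trig_poly_dense_0:
  fixes f :: "real ^ 'n \<Rightarrow> complex ^ 's"
  assumes f: "f \<in> borel_measurable borel" "integrable M (\<lambda>x. (norm (f x))\<^sup>2)" and "\<epsilon> > 0"
  shows "\<exists>F a. finite F \<and> F \<subseteq> dual_lattice \<Gamma> \<and>
    integrable M (\<lambda>x. (norm (f x - trig_poly 0 F a x))\<^sup>2) \<and> (LINT x|M. (norm (f x - trig_poly 0 F a x))\<^sup>2) < \<epsilon>"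
proof -
  define N where "N = real CARD('s)"
  have N: "N > 0" by (simp add: N_def)
  \<comment> \<open>A spinor has 2 \<open>N\<close> real components, each of which gets an equal
    share of epsilon.\<close>
  define e where "e = \<epsilon> / (2 * N)"
  have e: "e > 0" using N \<open>\<epsilon> > 0\<close> by (simp add: e_def)
  note f(1)[measurable]
  have [measurable]: "f \<in> borel_measurable M" by (rule borel_M[OF f(1)])
  have "\<bar>Re (z $ i)\<bar> \<le> \<bar>norm z\<bar>" "\<bar>Im (z $ i)\<bar> \<le> \<bar>norm z\<bar>" for z :: "complex ^ 's" and i
    using Finite_Cartesian_Product.norm_nth_le[of z i] abs_Re_le_cmod[of "z $ i"] abs_Im_le_cmod[of "z $ i"]
    by linarith+
  then have comp: "(Re (z $ i))\<^sup>2 \<le> (norm z)\<^sup>2" "(Im (z $ i))\<^sup>2 \<le> (norm z)\<^sup>2" for z :: "complex ^ 's" and i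
    by (simp_all only: abs_le_square_iff)
  have int: "integrable M (\<lambda>x. (Re (f x $ i))\<^sup>2)" "integrable M (\<lambda>x. (Im (f x $ i))\<^sup>2)" for i
    by (rule Bochner_Integration.integrable_bound[OF f(2)]; simp add: comp)+
  \<comment> \<open>The four properties are bundled so that one choice function in \<open>i\<close>
    provides them together.\<close>
  define Rp where "Rp = (\<lambda>i p. continuous_on UNIV p \<and> trig (\<lambda>x. of_real (p x)) \<and>
    integrable M (\<lambda>x. (Re (f x $ i) - p x)\<^sup>2) \<and> (LINT x|M. (Re (f x $ i) - p x)\<^sup>2) < e)"
  have "\<exists>p. Rp i p" for i
    unfolding Rp_def by (rule trig_dense_real[OF _ int(1) e, of i]) auto
  then obtain p where "\<And>i. Rp i (p i)" by metis
  then have p: "continuous_on UNIV (p i)" "trig (\<lambda>x. of_real (p i x))"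
     "integrable M (\<lambda>x. (Re (f x $ i) - p i x)\<^sup>2)" "(LINT x|M. (Re (f x $ i) - p i x)\<^sup>2) < e" for i
    unfolding Rp_def by blast+
  define Rq where "Rq = (\<lambda>i p. continuous_on UNIV p \<and> trig (\<lambda>x. of_real (p x)) \<and>
    integrable M (\<lambda>x. (Im (f x $ i) - p x)\<^sup>2) \<and> (LINT x|M. (Im (f x $ i) - p x)\<^sup>2) < e)"
  have "\<exists>p. Rq i p" for i
    unfolding Rq_def by (rule trig_dense_real[OF _ int(2) e, of i]) auto
  then obtain q where "\<And>i. Rq i (q i)" by metis
  then have q: "continuous_on UNIV (q i)" "trig (\<lambda>x. of_real (q i x))"
     "integrable M (\<lambda>x. (Im (f x $ i) - q i x)\<^sup>2)" "(LINT x|M. (Im (f x $ i) - q i x)\<^sup>2) < e" for i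
    unfolding Rq_def by blast+
  define h where "h = (\<lambda>x. \<Sum>i\<in>UNIV. (of_real (p i x) + \<i> * of_real (q i x)) *s (axis i 1 :: complex ^ 's))"
  have h_nth: "h x $ i = Complex (p i x) (q i x)" for x i
    by (simp add: h_def axis_def if_distrib complex_eq_iff cong: if_cong)
  have "\<exists>F a. finite F \<and> F \<subseteq> dual_lattice \<Gamma> \<and> h = trig_poly 0 F a"
    unfolding h_def
    by (intro trig_poly_sum trig_imp_trig_poly trig.add trig_mult trig_const p q) auto
  then obtain F a where F: "finite F" "F \<subseteq> dual_lattice \<Gamma>" "h = trig_poly 0 F a" by blast
  have eq: "(norm (f x - h x))\<^sup>2 = (\<Sum>i\<in>UNIV. (Re (f x $ i) - p i x)\<^sup>2 + (Im (f x $ i) - q i x)\<^sup>2)" for x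
    by (simp add: norm_vec_square cmod_power2 h_nth)
  have i: "integrable M (\<lambda>x. (norm (f x - h x))\<^sup>2)"
    unfolding eq by (intro Bochner_Integration.integrable_sum Bochner_Integration.integrable_add p q)
  have "(LINT x|M. (norm (f x - h x))\<^sup>2) =
     (\<Sum>i\<in>UNIV. (LINT x|M. (Re (f x $ i) - p i x)\<^sup>2) + (LINT x|M. (Im (f x $ i) - q i x)\<^sup>2))"
    unfolding eq using p q by (simp add: Bochner_Integration.integral_sum)
  also have "\<dots> < (\<Sum>i\<in>(UNIV :: 's set). e + e)"
    by (intro sum_strict_mono add_strict_mono p q) auto
  also have "\<dots> = \<epsilon>" using N by (simp add: e_def N_def field_simps)
  finally show ?thesis
    using F(1,2) i unfolding F(3) by (intro exI conjI)
qed

text \<open>Multiplication by the wave of \<open>- \<tau>\<close> has modulus 1 and removes the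
  shift, which reduces the claim to \<open>\<tau> = 0\<close>.\<close>

lemma trig_poly_dense:
  fixes f :: "real ^ 'n \<Rightarrow> complex ^ 's"
  assumes f: "f \<in> borel_measurable borel" "integrable M (\<lambda>x. (norm (f x))\<^sup>2)" and "\<epsilon> > 0"
  shows "\<exists>F a. finite F \<and> F \<subseteq> dual_lattice \<Gamma> \<and>
    integrable M (\<lambda>x. (norm (f x - trig_poly \<tau> F a x))\<^sup>2) \<and> (LINT x|M. (norm (f x - trig_poly \<tau> F a x))\<^sup>2) < \<epsilon>"
proof -
  define f' where "f' = (\<lambda>x. wave (- \<tau>) x *s f x)"
  have "continuous_on UNIV (\<lambda>p :: complex \<times> (complex ^ 's). fst p *s snd p)"
    unfolding vector_scalar_mult_def by (intro continuous_intros)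
  moreover have "wave (- \<tau>) \<in> borel_measurable borel"
    by (intro borel_measurable_continuous_onI continuous_intros)
  ultimately have m: "f' \<in> borel_measurable borel"
    unfolding f'_def using f(1)
    by (intro borel_measurable_continuous_Pair[where H = "\<lambda>a v. a *s v"])
  have i: "integrable M (\<lambda>x. (norm (f' x))\<^sup>2)"
    using f(2) by (simp add: f'_def norm_smult_vec)
  obtain F a where F: "finite F" "F \<subseteq> dual_lattice \<Gamma>"
    "integrable M (\<lambda>x. (norm (f' x - trig_poly 0 F a x))\<^sup>2)" "(LINT x|M. (norm (f' x - trig_poly 0 F a x))\<^sup>2) < \<epsilon>"
    using trig_poly_dense_0[OF m i \<open>\<epsilon> > 0\<close>] by blast
  have "f x - trig_poly \<tau> F a x = wave \<tau> x *s (f' x - trig_poly 0 F a x)" for x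
    by (simp add: f'_def trig_poly_def vec.scale_right_diff_distrib vec.scale_sum_right wave_add wave_minus
        wave_mult_cnj mult.commute)
  then have n: "norm (f x - trig_poly \<tau> F a x) = norm (f' x - trig_poly 0 F a x)" for x
    by (simp only: norm_smult_vec norm_wave mult_1)
  show ?thesis
    by (rule exI[of _ F], rule exI[of _ a]) (simp add: F n)
qed

end

section \<open>Fourier coefficients\<close>

text \<open>The inner product on \<open>complex ^ 's\<close> is the real part of the Hermitian one,
  so a complex scalar crosses it as its conjugate.\<close>

lemma inner_smult_left: "(a *s v) \<bullet> w = v \<bullet> (cnj a *s (w :: complex ^ 's))"
  by (simp add: inner_vec_def inner_complex_def algebra_simps)

lemma continuous_on_smult [continuous_intros]:
  fixes g :: "'a::topological_space \<Rightarrow> complex ^ 's"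
  assumes "continuous_on S f" "continuous_on S g"
  shows "continuous_on S (\<lambda>x. f x *s g x)"
  unfolding vector_scalar_mult_def using assms by (intro continuous_intros)

lemma bounded_bilinear_smult: "bounded_bilinear (\<lambda>a (v :: complex ^ 's). a *s v)"
  by (rule bounded_bilinear.intro)
    (auto simp: vec.scale_left_distrib vec.scale_right_distrib vec_eq_iff norm_smult_vec intro: exI[of _ 1])

lemmas bounded_linear_smult_left = bounded_bilinear.bounded_linear_left[OF bounded_bilinear_smult]
lemmas bounded_linear_smult_right = bounded_bilinear.bounded_linear_right[OF bounded_bilinear_smult]

context flat_torus
begin

text \<open>Not normalised: the Fourier coefficient proper is this integral divided by
  \<open>vol\<close>.\<close>

definition coeff :: "(real ^ 'n \<Rightarrow> complex ^ 's) \<Rightarrow> ((real ^ 'n) \<Rightarrow>\<^sub>L real) \<Rightarrow> complex ^ 's" where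
  "coeff \<phi> \<zeta> = (LINT x|M. wave (- \<zeta>) x *s \<phi> x)"

lemma continuous_trig_poly [continuous_intros]: "continuous_on S (trig_poly \<tau> F a)"
  unfolding trig_poly_def by (intro continuous_intros)

lemma integral_wave_inner:
  fixes \<phi> :: "real ^ 'n \<Rightarrow> complex ^ 's"
  assumes "continuous_on UNIV \<phi>"
  shows "(LINT x|M. (wave \<zeta> x *s v) \<bullet> \<phi> x) = v \<bullet> coeff \<phi> \<zeta>"
proof -
  have "integrable M (\<lambda>x. wave (- \<zeta>) x *s \<phi> x)"
    by (intro integrable_M_cont continuous_intros assms)
  then show ?thesis
    unfolding coeff_def inner_smult_left wave_minus[symmetric] by simp
qed

lemma integral_trig_poly_inner:
  fixes \<phi> :: "real ^ 'n \<Rightarrow> complex ^ 's"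
  assumes "continuous_on UNIV \<phi>" "finite F"
  shows "(LINT x|M. trig_poly \<tau> F a x \<bullet> \<phi> x) = (\<Sum>g\<in>F. a g \<bullet> coeff \<phi> (g + \<tau>))"
proof -
  have "(LINT x|M. trig_poly \<tau> F a x \<bullet> \<phi> x) = (LINT x|M. (\<Sum>g\<in>F. (wave (g + \<tau>) x *s a g) \<bullet> \<phi> x))"
    by (simp add: trig_poly_def inner_sum_left)
  also have "\<dots> = (\<Sum>g\<in>F. LINT x|M. (wave (g + \<tau>) x *s a g) \<bullet> \<phi> x)"
    by (intro Bochner_Integration.integral_sum integrable_M_cont continuous_intros assms)
  finally show ?thesis by (simp add: integral_wave_inner[OF assms(1)])
qed

lemma coeff_trig_poly:
  assumes "finite F" "F \<subseteq> dual_lattice \<Gamma>" "h \<in> dual_lattice \<Gamma>"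
  shows "coeff (trig_poly \<tau> F a) (h + \<tau>) = (if h \<in> F then vol *\<^sub>R a h else 0 :: complex ^ 's)"
proof -
  have "coeff (trig_poly \<tau> F a) (h + \<tau>) = (LINT x|M. (\<Sum>g\<in>F. wave (g - h) x *s a g))"
  proof -
    have "wave (- (h + \<tau>)) x * wave (g + \<tau>) x = wave (g - h) x" for g x
      by (simp flip: wave_add)
    then show ?thesis
      by (simp add: coeff_def trig_poly_def vec.scale_sum_right)
  qed
  also have "\<dots> = (\<Sum>g\<in>F. LINT x|M. wave (g - h) x *s a g)"
    by (intro Bochner_Integration.integral_sum integrable_M_cont continuous_intros)
  also have "\<dots> = (\<Sum>g\<in>F. (LINT x|M. wave (g - h) x) *s a g)"
    by (intro sum.cong refl integral_bounded_linear[OF bounded_linear_smult_left] integrable_M_cont continuous_intros)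
  also have "\<dots> = (\<Sum>g\<in>F. if g = h then vol *\<^sub>R a h else 0)"
  proof (intro sum.cong refl)
    fix g assume "g \<in> F"
    then have "g - h \<in> dual_lattice \<Gamma>" using assms dual_lattice_diff by blast
    from integral_wave[OF this] show "(LINT x|M. wave (g - h) x) *s a g = (if g = h then vol *\<^sub>R a h else 0)"
      by (simp add: scaleR_eq_smult)
  qed
  also have "\<dots> = (if h \<in> F then vol *\<^sub>R a h else 0)" using assms(1) by simp
  finally show ?thesis .
qed

text \<open>Completing the square: this yields at once Bessel's inequality and the optimality of Fourier sums.\<close>

lemma integral_norm_diff_trig_poly:
  fixes \<phi> :: "real ^ 'n \<Rightarrow> complex ^ 's"
  assumes \<phi>: "continuous_on UNIV \<phi>" and F: "finite F" "F \<subseteq> dual_lattice \<Gamma>"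
  shows "(LINT x|M. (norm (\<phi> x - trig_poly \<tau> F a x))\<^sup>2) =
    (LINT x|M. (norm (\<phi> x))\<^sup>2) - (\<Sum>g\<in>F. (norm (coeff \<phi> (g + \<tau>)))\<^sup>2) / vol +
    vol * (\<Sum>g\<in>F. (norm (a g - coeff \<phi> (g + \<tau>) /\<^sub>R vol))\<^sup>2)"
proof -
  let ?p = "trig_poly \<tau> F a"
  have int: "integrable M (\<lambda>x. (norm (\<phi> x))\<^sup>2)" "integrable M (\<lambda>x. ?p x \<bullet> \<phi> x)" "integrable M (\<lambda>x. ?p x \<bullet> ?p x)"
    by (intro integrable_M_cont continuous_intros \<phi>)+
  have "(LINT x|M. (norm (\<phi> x - ?p x))\<^sup>2) = (LINT x|M. (norm (\<phi> x))\<^sup>2 - 2 * (?p x \<bullet> \<phi> x) + ?p x \<bullet> ?p x)"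
    by (simp add: power2_norm_eq_inner inner_diff_left inner_diff_right inner_commute algebra_simps)
  also have "\<dots> = (LINT x|M. (norm (\<phi> x))\<^sup>2) - 2 * (LINT x|M. ?p x \<bullet> \<phi> x) + (LINT x|M. ?p x \<bullet> ?p x)"
    using int by simp
  also have "\<dots> = (LINT x|M. (norm (\<phi> x))\<^sup>2) - 2 * (\<Sum>g\<in>F. a g \<bullet> coeff \<phi> (g + \<tau>)) +
      (\<Sum>g\<in>F. a g \<bullet> coeff ?p (g + \<tau>))"
    by (simp add: integral_trig_poly_inner F(1) \<phi> continuous_trig_poly)
  also have "(\<Sum>g\<in>F. a g \<bullet> coeff ?p (g + \<tau>)) = (\<Sum>g\<in>F. vol * (a g \<bullet> a g))"
  proof (intro sum.cong refl)
    fix g assume g: "g \<in> F"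
    with F(2) have "g \<in> dual_lattice \<Gamma>" by blast
    from coeff_trig_poly[OF F this, of \<tau> a] g
    show "a g \<bullet> coeff ?p (g + \<tau>) = vol * (a g \<bullet> a g)" by simp
  qed
  also have "(LINT x|M. (norm (\<phi> x))\<^sup>2) - 2 * (\<Sum>g\<in>F. a g \<bullet> coeff \<phi> (g + \<tau>)) + (\<Sum>g\<in>F. vol * (a g \<bullet> a g)) =
      (LINT x|M. (norm (\<phi> x))\<^sup>2) +
      (\<Sum>g\<in>F. vol * (a g \<bullet> a g) - 2 * (a g \<bullet> coeff \<phi> (g + \<tau>)))"
    by (simp add: sum_subtractf sum_distrib_left)
  also have "(\<Sum>g\<in>F. vol * (a g \<bullet> a g) - 2 * (a g \<bullet> coeff \<phi> (g + \<tau>))) =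
      (\<Sum>g\<in>F. vol * (norm (a g - coeff \<phi> (g + \<tau>) /\<^sub>R vol))\<^sup>2 - (norm (coeff \<phi> (g + \<tau>)))\<^sup>2 / vol)"
  proof (intro sum.cong refl)
    fix g
    define b where "b = coeff \<phi> (g + \<tau>)"
    have "vol * (norm (a g - b /\<^sub>R vol))\<^sup>2 = vol * (a g \<bullet> a g) - 2 * (a g \<bullet> b) + (b \<bullet> b) / vol"
      using vol_pos
      by (simp add: power2_norm_eq_inner inner_diff_left inner_diff_right inner_commute field_simps)
    then show "vol * (a g \<bullet> a g) - 2 * (a g \<bullet> coeff \<phi> (g + \<tau>)) =
        vol * (norm (a g - coeff \<phi> (g + \<tau>) /\<^sub>R vol))\<^sup>2 - (norm (coeff \<phi> (g + \<tau>)))\<^sup>2 / vol"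
      by (simp add: power2_norm_eq_inner b_def)
  qed
  also have "\<dots> = vol * (\<Sum>g\<in>F. (norm (a g - coeff \<phi> (g + \<tau>) /\<^sub>R vol))\<^sup>2) -
      (\<Sum>g\<in>F. (norm (coeff \<phi> (g + \<tau>)))\<^sup>2) / vol"
    by (simp add: sum_subtractf sum_distrib_left sum_divide_distrib)
  finally show ?thesis by simp
qed

lemma bessel:
  fixes \<phi> :: "real ^ 'n \<Rightarrow> complex ^ 's"
  assumes "continuous_on UNIV \<phi>" "finite F" "F \<subseteq> dual_lattice \<Gamma>"
  shows "(\<Sum>g\<in>F. (norm (coeff \<phi> (g + \<tau>)))\<^sup>2) / vol \<le> (LINT x|M. (norm (\<phi> x))\<^sup>2)"
proof -
  have "0 \<le> (LINT x|M. (norm (\<phi> x - trig_poly \<tau> F (\<lambda>g. coeff \<phi> (g + \<tau>) /\<^sub>R vol) x))\<^sup>2)" by simp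
  then show ?thesis
    unfolding integral_norm_diff_trig_poly[OF assms] by simp
qed

text \<open>Any trigonometric polynomial within epsilon works: in the completed square the last term
  is nonnegative and may be dropped.\<close>

lemma parseval_approx:
  fixes \<phi> :: "real ^ 'n \<Rightarrow> complex ^ 's"
  assumes "continuous_on UNIV \<phi>" "\<epsilon> > 0"
  obtains F where "finite F" "F \<subseteq> dual_lattice \<Gamma>"
    "(LINT x|M. (norm (\<phi> x))\<^sup>2) < (\<Sum>g\<in>F. (norm (coeff \<phi> (g + \<tau>)))\<^sup>2) / vol + \<epsilon>"
proof -
  have i: "integrable M (\<lambda>x. (norm (\<phi> x))\<^sup>2)"
    by (intro integrable_M_cont continuous_intros assms)
  obtain F and a :: "_ \<Rightarrow> complex ^ 's" where F: "finite F" "F \<subseteq> dual_lattice \<Gamma>"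
      and lt: "(LINT x|M. (norm (\<phi> x - trig_poly \<tau> F a x))\<^sup>2) < \<epsilon>"
    using trig_poly_dense[OF borel_measurable_continuous_onI[OF assms(1)] i assms(2), of \<tau>] by blast
  have "0 \<le> vol * (\<Sum>g\<in>F. (norm (a g - coeff \<phi> (g + \<tau>) /\<^sub>R vol))\<^sup>2)"
    using vol_pos by (intro mult_nonneg_nonneg sum_nonneg) auto
  then have "(LINT x|M. (norm (\<phi> x))\<^sup>2) < (\<Sum>g\<in>F. (norm (coeff \<phi> (g + \<tau>)))\<^sup>2) / vol + \<epsilon>"
    using lt unfolding integral_norm_diff_trig_poly[OF assms(1) F] by linarith
  with F that show thesis by blast
qed

text \<open>Transfers a bound on every mode to the L^2 norm using finite sums only: approximate
  Parseval for \<open>\<phi>\<close>, Bessel for \<open>\<psi>\<close>.\<close>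

lemma integral_norm_le_of_coeff:
  fixes \<phi> \<psi> :: "real ^ 'n \<Rightarrow> complex ^ 's"
  assumes \<phi>: "continuous_on UNIV \<phi>" and \<psi>: "continuous_on UNIV \<psi>" and C: "0 \<le> C"
    and le: "\<And>g. g \<in> dual_lattice \<Gamma> \<Longrightarrow> norm (coeff \<phi> (g + \<tau>)) \<le> C * norm (coeff \<psi> (g + \<tau>))"
  shows "(LINT x|M. (norm (\<phi> x))\<^sup>2) \<le> C\<^sup>2 * (LINT x|M. (norm (\<psi> x))\<^sup>2)"
proof (rule field_le_epsilon)
  fix \<epsilon> :: real assume "\<epsilon> > 0"
  then obtain F where F: "finite F" "F \<subseteq> dual_lattice \<Gamma>"
    "(LINT x|M. (norm (\<phi> x))\<^sup>2) < (\<Sum>g\<in>F. (norm (coeff \<phi> (g + \<tau>)))\<^sup>2) / vol + \<epsilon>"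
    using parseval_approx[OF \<phi>] by metis
  have "(\<Sum>g\<in>F. (norm (coeff \<phi> (g + \<tau>)))\<^sup>2) \<le> (\<Sum>g\<in>F. C\<^sup>2 * (norm (coeff \<psi> (g + \<tau>)))\<^sup>2)"
    unfolding power_mult_distrib[symmetric]
    using F(2) le by (intro sum_mono power_mono) auto
  then have "(\<Sum>g\<in>F. (norm (coeff \<phi> (g + \<tau>)))\<^sup>2) / vol \<le> C\<^sup>2 * ((\<Sum>g\<in>F. (norm (coeff \<psi> (g + \<tau>)))\<^sup>2) / vol)"
    using vol_pos by (simp add: sum_distrib_left[symmetric] divide_right_mono)
  also have "\<dots> \<le> C\<^sup>2 * (LINT x|M. (norm (\<psi> x))\<^sup>2)"
    by (intro mult_left_mono bessel \<psi> F) auto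
  finally show "(LINT x|M. (norm (\<phi> x))\<^sup>2) \<le> C\<^sup>2 * (LINT x|M. (norm (\<psi> x))\<^sup>2) + \<epsilon>"
    using F(3) by linarith
qed

lemma integral_norm_zero:
  fixes \<phi> :: "real ^ 'n \<Rightarrow> complex ^ 's"
  assumes \<phi>: "continuous_on UNIV \<phi>" and z: "(LINT x|M. (norm (\<phi> x))\<^sup>2) = 0"
    and x: "x \<in> fundamental_domain \<gamma>"
  shows "\<phi> x = 0"
proof -
  have c: "continuous_on UNIV (\<lambda>x. (norm (\<phi> x))\<^sup>2)" by (intro continuous_intros \<phi>)
  have "AE x in M. (norm (\<phi> x))\<^sup>2 = 0"
    using z by (subst (asm) integral_nonneg_eq_0_iff_AE) (auto intro: integrable_M_cont[OF c])
  from AE_M_cont_zero[OF c this x] show ?thesis by simp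
qed

lemma coeff_diff:
  fixes \<phi> \<psi> :: "real ^ 'n \<Rightarrow> complex ^ 's"
  assumes "continuous_on UNIV \<phi>" "continuous_on UNIV \<psi>"
  shows "coeff (\<lambda>x. \<phi> x - \<psi> x) \<zeta> = coeff \<phi> \<zeta> - coeff \<psi> \<zeta>"
proof -
  have "integrable M (\<lambda>x. wave (- \<zeta>) x *s \<phi> x)" "integrable M (\<lambda>x. wave (- \<zeta>) x *s \<psi> x)"
    by (intro integrable_M_cont continuous_intros assms)+
  then show ?thesis
    by (simp add: coeff_def vec.scale_right_diff_distrib)
qed

text \<open>The difference of the two sides has all coefficients zero. Equality is claimed only on
  the cell, since \<open>\<phi>\<close> is not assumed equivariant.\<close>

lemma fourier_finite:
  fixes \<phi> :: "real ^ 'n \<Rightarrow> complex ^ 's"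
  assumes \<phi>: "continuous_on UNIV \<phi>" and F: "finite F" "F \<subseteq> dual_lattice \<Gamma>"
    and z: "\<And>g. g \<in> dual_lattice \<Gamma> - F \<Longrightarrow> coeff \<phi> (g + \<tau>) = 0"
    and x: "x \<in> fundamental_domain \<gamma>"
  shows "\<phi> x = trig_poly \<tau> F (\<lambda>g. coeff \<phi> (g + \<tau>) /\<^sub>R vol) x"
proof -
  define p where "p = trig_poly \<tau> F (\<lambda>g. coeff \<phi> (g + \<tau>) /\<^sub>R vol)"
  have p: "continuous_on UNIV p" unfolding p_def by (rule continuous_trig_poly)
  have "coeff (\<lambda>x. \<phi> x - p x) (g + \<tau>) = 0" if "g \<in> dual_lattice \<Gamma>" for g
    using z[of g] that vol_pos
    by (simp add: coeff_diff[OF \<phi> p]) (simp add: p_def coeff_trig_poly[OF F that])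
  \<comment> \<open>The comparison lemma with constant 0 expresses that vanishing coefficients force
    vanishing norm.\<close>
  then have "(LINT x|M. (norm (\<phi> x - p x))\<^sup>2) \<le> 0\<^sup>2 * (LINT x|M. (norm (\<phi> x))\<^sup>2)"
    by (intro integral_norm_le_of_coeff continuous_intros \<phi> p) auto
  then have "(LINT x|M. (norm (\<phi> x - p x))\<^sup>2) = 0"
    by (intro antisym) auto
  from integral_norm_zero[OF _ this x] show ?thesis
    using \<phi> p by (simp add: p_def continuous_intros)
qed

lemma reduce_to_domain:
  obtains y v where "y \<in> fundamental_domain \<gamma>" "v \<in> \<Gamma>" "x = y + v"
proof -
  define y where "y = (\<Sum>j\<in>UNIV. frac (blinfun_apply (\<gamma>' j) x) *\<^sub>R \<gamma> j)"
  have "blinfun_apply (\<gamma>' j) y = frac (blinfun_apply (\<gamma>' j) x)" for j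
    by (simp only: y_def dual_sum)
  then have "y \<in> fundamental_domain \<gamma>" "x - y \<in> \<Gamma>"
    by (simp_all add: fundamental_domain_iff mem_lattice_iff blinfun.diff_right frac_lt_1) (simp add: frac_def)
  then show thesis by (intro that[of y "x - y"]) auto
qed

end

section \<open>The Dirac operator\<close>

lemma finite_int_functions: "finite {k :: 'n::finite \<Rightarrow> int. \<forall>j. k j \<in> {- m..m}}"
proof -
  have "finite (PiE (UNIV :: 'n set) (\<lambda>_. {- m..m}))" by (intro finite_PiE) auto
  then show ?thesis
    by (rule finite_subset[rotated]) (auto simp: PiE_UNIV_domain)
qed

lemma smooth_has_derivative:
  assumes "smooth \<phi>"
  shows "(\<phi> has_derivative frechet_derivative \<phi> (at x)) (at x)"
proof -
  have "C_diff (Suc 0) \<phi>" using assms by (simp only: smooth_def)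
  then have "\<phi> differentiable at x" by (simp add: differentiable_on_def)
  then show ?thesis by (simp add: frechet_derivative_works)
qed

lemma smooth_continuous:
  assumes "smooth \<phi>"
  shows "continuous_on UNIV \<phi>" "continuous_on UNIV (\<lambda>x. frechet_derivative \<phi> (at x) v)"
proof -
  have "C_diff 0 \<phi>" "C_diff (Suc 0) \<phi>" using assms by (simp_all only: smooth_def)
  then show "continuous_on UNIV \<phi>" "continuous_on UNIV (\<lambda>x. frechet_derivative \<phi> (at x) v)" by simp_all
qed

lemma (in flat_torus) coeff_add:
  fixes \<phi> \<psi> :: "real ^ 'n \<Rightarrow> complex ^ 's"
  assumes "continuous_on UNIV \<phi>" "continuous_on UNIV \<psi>"
  shows "coeff (\<lambda>x. \<phi> x + \<psi> x) \<zeta> = coeff \<phi> \<zeta> + coeff \<psi> \<zeta>"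
proof -
  have "integrable M (\<lambda>x. wave (- \<zeta>) x *s \<phi> x)" "integrable M (\<lambda>x. wave (- \<zeta>) x *s \<psi> x)"
    by (intro integrable_M_cont continuous_intros assms)+
  then show ?thesis
    by (simp add: coeff_def vec.scale_right_distrib)
qed

lemma (in flat_torus) coeff_smult:
  fixes \<phi> :: "real ^ 'n \<Rightarrow> complex ^ 's"
  assumes "continuous_on UNIV \<phi>"
  shows "coeff (\<lambda>x. a *s \<phi> x) \<zeta> = a *s coeff \<phi> \<zeta>"
proof -
  have "integrable M (\<lambda>x. wave (- \<zeta>) x *s \<phi> x)"
    by (intro integrable_M_cont continuous_intros assms)
  from integral_bounded_linear[OF bounded_linear_smult_right this, of a] show ?thesis
    by (simp add: coeff_def mult.commute)
qed

text \<open>The two homomorphisms of the spin^c data matter only through their product, which on the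
  lattice is the wave of one covector \<open>\<tau>\<close>.\<close>

locale dirac_torus = flat_torus \<Gamma> \<gamma> \<gamma>'
  for \<Gamma> :: "(real ^ 'n) set" and \<gamma> :: "'n \<Rightarrow> real ^ 'n" and \<gamma>' :: "'n \<Rightarrow> (real ^ 'n) \<Rightarrow>\<^sub>L real" +
  fixes \<tau> A :: "(real ^ 'n) \<Rightarrow>\<^sub>L real" and c :: "real ^ 'n \<Rightarrow> complex ^ 's ^ 's" and \<rho> :: "real ^ 'n \<Rightarrow> complex"
  assumes clifford: "clifford_mult c"
    and rho: "\<And>v. v \<in> \<Gamma> \<Longrightarrow> \<rho> v = wave \<tau> v"
begin

definition \<xi> :: "((real ^ 'n) \<Rightarrow>\<^sub>L real) \<Rightarrow> ((real ^ 'n) \<Rightarrow>\<^sub>L real)" where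
  "\<xi> g = g + \<tau> + (1 / (4 * pi)) *\<^sub>R A"

abbreviation symbol :: "((real ^ 'n) \<Rightarrow>\<^sub>L real) \<Rightarrow> complex ^ 's \<Rightarrow> complex ^ 's" where
  "symbol g \<equiv> dirac_symbol c (\<xi> g)"

abbreviation D :: "(real ^ 'n \<Rightarrow> complex ^ 's) \<Rightarrow> real ^ 'n \<Rightarrow> complex ^ 's" where
  "D \<equiv> dirac c A"

lemma linear_matrix_vector_left: "linear (\<lambda>A. A *v (v :: complex ^ 's))"
  by (rule linearI) (simp_all add: matrix_vector_mult_add_rdistrib scaleR_matrix_vector)

lemma dirac_symbol_sum: "dirac_symbol c \<zeta> v = (\<Sum>e\<in>Basis. c e *v ((2 * pi * \<i> * blinfun_apply \<zeta> e) *s v))"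
proof -
  have "c (sharp \<zeta>) = (\<Sum>e\<in>Basis. blinfun_apply \<zeta> e *\<^sub>R c e)"
    using linear_clifford[OF clifford] by (simp add: sharp_def linear_sum linear_scale)
  then have "c (sharp \<zeta>) *v v = (\<Sum>e\<in>Basis. blinfun_apply \<zeta> e *\<^sub>R (c e *v v))"
    by (simp add: linear_sum[OF linear_matrix_vector_left] scaleR_matrix_vector)
  then show ?thesis
    by (simp add: dirac_symbol_def vec.scale_sum_right scaleR_eq_smult vector_scalar_commute)
qed

lemma equivariant_iff: "equivariant \<Gamma> \<rho> \<phi> \<longleftrightarrow> (\<forall>x. \<forall>v\<in>\<Gamma>. \<phi> (x + v) = wave \<tau> v *s \<phi> x)"
  by (simp add: equivariant_def rho)

section \<open>The operator on twisted trigonometric polynomials\<close>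

lemma equivariant_trig_poly: "F \<subseteq> dual_lattice \<Gamma> \<Longrightarrow> equivariant \<Gamma> \<rho> (trig_poly \<tau> F a)"
proof -
  assume F: "F \<subseteq> dual_lattice \<Gamma>"
  have "wave (g + \<tau>) (x + v) *s a g = wave \<tau> v *s (wave (g + \<tau>) x *s a g)" if "g \<in> F" "v \<in> \<Gamma>" for g x v
  proof -
    have "wave g v = 1" using that F by (intro wave_eq_1) (auto simp: dual_lattice_def)
    then show ?thesis by (simp add: wave_add_arg wave_add mult_ac)
  qed
  then show ?thesis
    unfolding equivariant_iff trig_poly_def vec.scale_sum_right by (intro allI ballI sum.cong refl) auto
qed

lemma has_derivative_trig_poly:
  fixes a :: "_ \<Rightarrow> complex ^ 's"
  shows "(trig_poly \<tau> F a has_derivative (\<lambda>v. trig_poly \<tau> F (\<lambda>g. (2 * pi * \<i> * blinfun_apply (g + \<tau>) v) *s a g) x)) (at x)"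
proof -
  have "((\<lambda>x. wave (g + \<tau>) x *s a g) has_derivative
      (\<lambda>v. ((2 * pi * \<i> * blinfun_apply (g + \<tau>) v) * wave (g + \<tau>) x) *s a g)) (at x)" for g
    by (rule bounded_linear.has_derivative[OF bounded_linear_smult_left has_derivative_wave])
  from has_derivative_sum[of F, OF this] show ?thesis
    unfolding trig_poly_def[abs_def] by (simp add: mult_ac)
qed

lemma frechet_trig_poly:
  fixes a :: "_ \<Rightarrow> complex ^ 's"
  shows "frechet_derivative (trig_poly \<tau> F a) (at x) v = trig_poly \<tau> F (\<lambda>g. (2 * pi * \<i> * blinfun_apply (g + \<tau>) v) *s a g) x"
  by (rule fun_cong[OF frechet_derivative_at[OF has_derivative_trig_poly], symmetric])

text \<open>A derivative is again a trigonometric polynomial with other coefficients, so the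
  induction runs over all coefficient functions at once.\<close>

lemma C_diff_trig_poly:
  fixes a :: "_ \<Rightarrow> complex ^ 's"
  shows "C_diff k (trig_poly \<tau> F a)"
proof (induction k arbitrary: a)
  case 0
  show ?case by (simp add: continuous_trig_poly)
next
  case (Suc k)
  have "trig_poly \<tau> F a differentiable at x" for x
    using has_derivative_trig_poly differentiable_def by blast
  then have "trig_poly \<tau> F a differentiable_on UNIV"
    by (simp add: differentiable_on_def)
  then show ?case by (simp add: frechet_trig_poly Suc.IH)
qed

lemma trig_poly_smooth_spinor:
  fixes a :: "_ \<Rightarrow> complex ^ 's"
  shows "F \<subseteq> dual_lattice \<Gamma> \<Longrightarrow> trig_poly \<tau> F a \<in> smooth_spinors \<Gamma> \<rho>"
  by (simp add: smooth_spinors_def smooth_def C_diff_trig_poly equivariant_trig_poly)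

lemma connection_trig_poly:
  fixes a :: "_ \<Rightarrow> complex ^ 's"
  shows "spinor_connection A v (trig_poly \<tau> F a) x =
    trig_poly \<tau> F (\<lambda>g. (2 * pi * \<i> * blinfun_apply (\<xi> g) v) *s a g) x"
proof -
  have "2 * pi * \<i> * blinfun_apply (\<xi> g) v = 2 * pi * \<i> * blinfun_apply (g + \<tau>) v + \<i> / 2 * blinfun_apply A v" for g
    by (simp add: \<xi>_def blinfun.add_left blinfun.scaleR_left field_simps)
  then show ?thesis
    by (simp add: spinor_connection_def frechet_trig_poly trig_poly_def vec.scale_sum_right
        vec.scale_left_distrib vec.scale_right_distrib sum.distrib mult_ac)
qed

lemma dirac_trig_poly:
  fixes a :: "_ \<Rightarrow> complex ^ 's"
  shows "D (trig_poly \<tau> F a) x = trig_poly \<tau> F (\<lambda>g. symbol g (a g)) x"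
proof -
  have "c e *v trig_poly \<tau> F b x = trig_poly \<tau> F (\<lambda>g. c e *v b g) x" for e and b :: "_ \<Rightarrow> complex ^ 's"
    unfolding trig_poly_def by (simp add: linear_sum[OF matrix_vector_mul_linear] vector_scalar_commute)
  then have "D (trig_poly \<tau> F a) x = (\<Sum>e\<in>Basis. trig_poly \<tau> F (\<lambda>g. c e *v ((2 * pi * \<i> * blinfun_apply (\<xi> g) e) *s a g)) x)"
    by (simp add: dirac_def connection_trig_poly)
  also have "\<dots> = trig_poly \<tau> F (\<lambda>g. symbol g (a g)) x"
    unfolding trig_poly_def dirac_symbol_sum vec.scale_sum_right by (rule sum.swap)
  finally show ?thesis .
qed

section \<open>The operator on Fourier coefficients of smooth spinors\<close>

lemma continuous_dirac:
  assumes "smooth \<phi>"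
  shows "continuous_on UNIV (D \<phi>)"
  unfolding dirac_def spinor_connection_def
  by (intro continuous_intros smooth_continuous[OF assms] linear_continuous_on_compose[OF _ matrix_vector_mul_linear])

text \<open>Integration by parts: the product of \<open>\<phi>\<close> with the conjugate wave is
  periodic, so its derivative integrates to zero and the differentiation moves onto the
  wave.\<close>

lemma coeff_connection:
  assumes "\<phi> \<in> smooth_spinors \<Gamma> \<rho>" "g \<in> dual_lattice \<Gamma>"
  shows "coeff (spinor_connection A v \<phi>) (g + \<tau>) = (2 * pi * \<i> * blinfun_apply (\<xi> g) v) *s coeff \<phi> (g + \<tau>)"
proof -
  let ?z = "g + \<tau>" and ?d = "\<lambda>v x. frechet_derivative \<phi> (at x) v"
  have sm: "smooth \<phi>" and eq: "\<And>x v. v \<in> \<Gamma> \<Longrightarrow> \<phi> (x + v) = wave \<tau> v *s \<phi> x"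
    using assms(1) by (auto simp: smooth_spinors_def equivariant_iff)
  note cont = smooth_continuous[OF sm]
  have int: "integrable M (\<lambda>x. wave (- ?z) x *s \<phi> x)" "integrable M (\<lambda>x. wave (- ?z) x *s ?d v x)"
    by (intro integrable_M_cont continuous_intros cont)+
  let ?f' = "\<lambda>x v. wave (- ?z) x *s ?d v x + ((2 * pi * \<i> * blinfun_apply (- ?z) v) * wave (- ?z) x) *s \<phi> x"
  have "periodic (\<lambda>x. wave (- ?z) x *s \<phi> x)"
    unfolding periodic_def
  proof (intro allI ballI)
    fix x v assume v: "v \<in> \<Gamma>"
    \<comment> \<open>The shift \<open>\<tau>\<close> in the wave cancels the twist of
      \<open>\<phi>\<close>, leaving a wave of the dual lattice.\<close>
    have "wave (- ?z) v * wave \<tau> v = wave (- g) v" by (simp flip: wave_add)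
    also have "\<dots> = 1"
      using v assms(2) by (intro wave_eq_1) (auto simp: dual_lattice_def blinfun.minus_left)
    finally show "wave (- ?z) (x + v) *s \<phi> (x + v) = wave (- ?z) x *s \<phi> x"
      by (simp add: eq[OF v] wave_add_arg mult.assoc)
  qed
  moreover have "((\<lambda>x. wave (- ?z) x *s \<phi> x) has_derivative ?f' x) (at x)" for x
    by (rule bounded_bilinear.FDERIV[OF bounded_bilinear_smult has_derivative_wave smooth_has_derivative[OF sm]])
  moreover have "continuous_on UNIV (\<lambda>x. ?f' x v)" for v
    by (intro continuous_intros cont)
  ultimately have "(LINT x|M. ?f' x v) = 0"
    by (intro integral_M_derivative)
  also have "(LINT x|M. ?f' x v) = (LINT x|M. wave (- ?z) x *s ?d v x + (2 * pi * \<i> * blinfun_apply (- ?z) v) *s (wave (- ?z) x *s \<phi> x))"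
    by simp
  also have "\<dots> = coeff (?d v) ?z + (2 * pi * \<i> * blinfun_apply (- ?z) v) *s coeff \<phi> ?z"
    unfolding coeff_def
    using int integral_bounded_linear[OF bounded_linear_smult_right int(1)]
      integrable_bounded_linear[OF bounded_linear_smult_right int(1)]
    by (subst Bochner_Integration.integral_add) auto
  finally have "coeff (?d v) ?z - (2 * pi * \<i> * blinfun_apply ?z v) *s coeff \<phi> ?z = 0"
    unfolding blinfun.minus_left
    by (simp only: of_real_minus mult_minus_right vec.scale_minus_left add_uminus_conv_diff)
  then have d: "coeff (?d v) ?z = (2 * pi * \<i> * blinfun_apply ?z v) *s coeff \<phi> ?z"
    by (simp only: right_minus_eq)
  have "coeff (spinor_connection A v \<phi>) ?z = coeff (?d v) ?z + (\<i> / 2 * blinfun_apply A v) *s coeff \<phi> ?z"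
  proof -
    have "continuous_on UNIV (\<lambda>x. (\<i> / 2 * complex_of_real (blinfun_apply A v)) *s \<phi> x)"
      by (intro continuous_intros cont)
    from coeff_add[OF cont(2)[of v] this, of ?z] show ?thesis
      unfolding spinor_connection_def[abs_def] coeff_smult[OF cont(1)] .
  qed
  also have "\<dots> = (2 * pi * \<i> * blinfun_apply ?z v + \<i> / 2 * blinfun_apply A v) *s coeff \<phi> ?z"
    by (simp add: d vec.scale_left_distrib)
  also have "2 * pi * \<i> * blinfun_apply ?z v + \<i> / 2 * blinfun_apply A v = 2 * pi * \<i> * blinfun_apply (\<xi> g) v"
    by (simp add: \<xi>_def blinfun.add_left blinfun.scaleR_left field_simps)
  finally show ?thesis .
qed

lemma coeff_dirac:
  assumes "\<phi> \<in> smooth_spinors \<Gamma> \<rho>" "g \<in> dual_lattice \<Gamma>"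
  shows "coeff (D \<phi>) (g + \<tau>) = symbol g (coeff \<phi> (g + \<tau>))"
proof -
  let ?w = "wave (- (g + \<tau>))"
  have "smooth \<phi>" using assms(1) by (simp add: smooth_spinors_def)
  note cont = smooth_continuous[OF this]
  have int: "integrable M (\<lambda>x. ?w x *s spinor_connection A e \<phi> x)" for e
    unfolding spinor_connection_def by (intro integrable_M_cont continuous_intros cont)
  have "coeff (D \<phi>) (g + \<tau>) = (LINT x|M. (\<Sum>e\<in>Basis. c e *v (?w x *s spinor_connection A e \<phi> x)))"
    by (simp add: coeff_def dirac_def vec.scale_sum_right vector_scalar_commute)
  also have "\<dots> = (\<Sum>e\<in>Basis. LINT x|M. c e *v (?w x *s spinor_connection A e \<phi> x))"
    by (intro Bochner_Integration.integral_sum integrable_bounded_linear[OF matrix_vector_mul_bounded_linear int])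
  also have "\<dots> = (\<Sum>e\<in>Basis. c e *v coeff (spinor_connection A e \<phi>) (g + \<tau>))"
    unfolding coeff_def
    by (intro sum.cong refl integral_bounded_linear[OF matrix_vector_mul_bounded_linear int])
  also have "\<dots> = symbol g (coeff \<phi> (g + \<tau>))"
    by (simp add: coeff_connection[OF assms] dirac_symbol_sum)
  finally show ?thesis .
qed

lemma coeff_dirac_minus:
  assumes "\<phi> \<in> smooth_spinors \<Gamma> \<rho>" "g \<in> dual_lattice \<Gamma>"
  shows "coeff (\<lambda>x. D \<phi> x - \<mu> *s \<phi> x) (g + \<tau>) = symbol g (coeff \<phi> (g + \<tau>)) - \<mu> *s coeff \<phi> (g + \<tau>)"
proof -
  have sm: "smooth \<phi>" using assms(1) by (simp add: smooth_spinors_def)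
  have c: "continuous_on UNIV (\<lambda>x. \<mu> *s \<phi> x)"
    by (intro continuous_intros smooth_continuous[OF sm])
  show ?thesis
    by (simp add: coeff_diff[OF continuous_dirac[OF sm] c] coeff_dirac[OF assms]
        coeff_smult[OF smooth_continuous(1)[OF sm]])
qed

text \<open>A covector of the dual lattice is determined by its integer values on the generators,
  and a bound on its norm bounds these integers.\<close>

lemma finite_dual_norm_le: "finite {g \<in> dual_lattice \<Gamma>. dual_norm (\<xi> g) \<le> R}"
proof -
  define \<eta> where "\<eta> = \<tau> + (1 / (4 * pi)) *\<^sub>R A"
  \<comment> \<open>The sum over all j serves as a common bound for the values; |R| keeps its terms
    nonnegative when \<open>R\<close> is negative.\<close>
  define m where "m = \<lceil>\<Sum>j\<in>UNIV. \<bar>R\<bar> * norm (\<gamma> j) + \<bar>blinfun_apply \<eta> (\<gamma> j)\<bar>\<rceil>"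
  define k where "k = (\<lambda>(g :: (real ^ 'n) \<Rightarrow>\<^sub>L real) j. \<lfloor>blinfun_apply g (\<gamma> j)\<rfloor>)"
  have k: "blinfun_apply g (\<gamma> j) = of_int (k g j)" if "g \<in> dual_lattice \<Gamma>" for g j
    using that by (auto simp: k_def mem_dual_lattice_iff elim!: Ints_cases dest!: spec[of _ j])
  have inj: "inj_on k (dual_lattice \<Gamma>)"
  proof (rule inj_onI)
    fix g h assume gh: "g \<in> dual_lattice \<Gamma>" "h \<in> dual_lattice \<Gamma>" "k g = k h"
    then have gen: "blinfun_apply g (\<gamma> j) = blinfun_apply h (\<gamma> j)" for j by (simp add: k)
    show "g = h"
    proof (rule blinfun_eqI)
      fix x show "blinfun_apply g x = blinfun_apply h x"
        using covector_expansion[of x g] covector_expansion[of x h] by (simp only: gen)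
    qed
  qed
  have "k g j \<in> {- m..m}" if g: "g \<in> dual_lattice \<Gamma>" "dual_norm (\<xi> g) \<le> R" for g j
  proof -
    have "\<bar>blinfun_apply g (\<gamma> j)\<bar> \<le> \<bar>blinfun_apply (\<xi> g) (\<gamma> j)\<bar> + \<bar>blinfun_apply \<eta> (\<gamma> j)\<bar>"
      by (simp add: \<xi>_def \<eta>_def blinfun.add_left)
    also have "\<bar>blinfun_apply (\<xi> g) (\<gamma> j)\<bar> \<le> \<bar>R\<bar> * norm (\<gamma> j)"
      using abs_le_dual_norm[of "\<xi> g" "\<gamma> j"] g(2) by (meson abs_ge_self mult_right_mono norm_ge_zero order_trans)
    also have "\<bar>R\<bar> * norm (\<gamma> j) + \<bar>blinfun_apply \<eta> (\<gamma> j)\<bar> \<le> (\<Sum>j\<in>UNIV. \<bar>R\<bar> * norm (\<gamma> j) + \<bar>blinfun_apply \<eta> (\<gamma> j)\<bar>)"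
      by (rule member_le_sum) auto
    also have "\<dots> \<le> of_int m" unfolding m_def by (rule le_of_int_ceiling)
    finally have "\<bar>real_of_int (k g j)\<bar> \<le> of_int m" using k[OF g(1)] by simp
    then have "\<bar>k g j\<bar> \<le> m" by linarith
    then show ?thesis by auto
  qed
  then have "k ` {g \<in> dual_lattice \<Gamma>. dual_norm (\<xi> g) \<le> R} \<subseteq> {k. \<forall>j. k j \<in> {- m..m}}" by blast
  then have fin: "finite (k ` {g \<in> dual_lattice \<Gamma>. dual_norm (\<xi> g) \<le> R})"
    by (rule finite_subset) (rule finite_int_functions)
  show ?thesis
    by (rule finite_imageD[OF fin inj_on_subset[OF inj]]) blast
qed

section \<open>Modes carrying an eigenvalue, the spectrum and the eigenspaces\<close>

definition resonant :: "complex \<Rightarrow> ((real ^ 'n) \<Rightarrow>\<^sub>L real) set" where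
  "resonant \<mu> = {g \<in> dual_lattice \<Gamma>. \<exists>v. v \<noteq> 0 \<and> symbol g v = \<mu> *s v}"

text \<open>An eigenvalue at \<open>g\<close> forces |mu| = 2 pi |xi|, which bounds the
  covector.\<close>

lemma finite_resonant: "finite (resonant \<mu>)"
proof (rule finite_subset[OF _ finite_dual_norm_le[of "norm \<mu>"]], safe)
  fix g assume "g \<in> resonant \<mu>"
  then obtain v where g: "g \<in> dual_lattice \<Gamma>" "v \<noteq> 0" "symbol g v = \<mu> *s v" by (auto simp: resonant_def)
  then have "norm \<mu> = 2 * pi * dual_norm (\<xi> g)"
    using dirac_symbol_eigen[OF clifford g(3,2)] by (auto simp: norm_mult dual_norm_nonneg)
  moreover have "1 * dual_norm (\<xi> g) \<le> (2 * pi) * dual_norm (\<xi> g)"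
    using pi_gt3 by (intro mult_right_mono dual_norm_nonneg) auto
  ultimately show "dual_norm (\<xi> g) \<le> norm \<mu>" by simp
  show "g \<in> dual_lattice \<Gamma>" by fact
qed

lemma L2_norm_M: "L2_norm \<gamma> \<phi> = sqrt (LINT x|M. (norm (\<phi> x))\<^sup>2)"
  by (simp add: L2_norm_def integral_M)

lemma trig_poly_single: "trig_poly \<tau> {g} a x = wave (g + \<tau>) x *s a g"
  by (simp add: trig_poly_def)

text \<open>One eigenmode violates any lower bound of \<open>D - \<mu>\<close>. If there is none,
  the uniform bound on the modes gives the bounded inverse, and solving mode by mode puts every
  trigonometric polynomial into the range, which is therefore dense.\<close>

lemma dirac_spectrum_iff: "\<mu> \<in> dirac_spectrum \<Gamma> \<gamma> \<rho> c A \<longleftrightarrow> resonant \<mu> \<noteq> {}"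
proof
  assume "resonant \<mu> \<noteq> {}"
  then obtain g v where g: "g \<in> dual_lattice \<Gamma>" "v \<noteq> 0" "symbol g v = \<mu> *s v"
    by (auto simp: resonant_def)
  define \<phi> where "\<phi> = trig_poly \<tau> {g} (\<lambda>_. v)"
  have \<phi>: "\<phi> \<in> smooth_spinors \<Gamma> \<rho>"
    unfolding \<phi>_def using g by (intro trig_poly_smooth_spinor) auto
  have "D \<phi> x - \<mu> *s \<phi> x = 0" for x
    by (simp add: \<phi>_def dirac_trig_poly trig_poly_single g(3) mult.commute)
  then have "L2_norm \<gamma> (\<lambda>x. D \<phi> x - \<mu> *s \<phi> x) = 0" by (simp add: L2_norm_M)
  moreover have "L2_norm \<gamma> \<phi> > 0"
    using g(2) vol_pos by (simp add: L2_norm_M \<phi>_def trig_poly_single norm_smult_vec flip: vol_def)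
  ultimately have "\<not> (\<exists>C. \<forall>\<phi>\<in>smooth_spinors \<Gamma> \<rho>. L2_norm \<gamma> \<phi> \<le> C * L2_norm \<gamma> (\<lambda>x. D \<phi> x - \<mu> *s \<phi> x))"
    using \<phi> by force
  then show "\<mu> \<in> dirac_spectrum \<Gamma> \<gamma> \<rho> c A"
    unfolding dirac_spectrum_def dirac_resolvent_set_def by blast
next
  have "\<mu> \<in> dirac_resolvent_set \<Gamma> \<gamma> \<rho> c A" if "resonant \<mu> = {}"
  proof -
    have inj: "v = 0" if "g \<in> dual_lattice \<Gamma>" "symbol g v = \<mu> *s v" for g v
      using \<open>resonant \<mu> = {}\<close> that by (auto simp: resonant_def)
    have fin: "finite {\<zeta> \<in> \<xi> ` dual_lattice \<Gamma>. dual_norm \<zeta> \<le> R}" for R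
      by (rule finite_subset[OF _ finite_imageI[OF finite_dual_norm_le[of R], of \<xi>]]) auto
    obtain C where C: "C \<ge> 0"
        "\<And>g v. g \<in> dual_lattice \<Gamma> \<Longrightarrow> norm v \<le> C * norm (symbol g v - \<mu> *s v)"
      using dirac_symbol_bounded_below[OF clifford fin, of \<mu>] inj by blast
    have "L2_norm \<gamma> \<phi> \<le> C * L2_norm \<gamma> (\<lambda>x. D \<phi> x - \<mu> *s \<phi> x)" if \<phi>: "\<phi> \<in> smooth_spinors \<Gamma> \<rho>" for \<phi>
    proof -
      have sm: "smooth \<phi>" using \<phi> by (simp add: smooth_spinors_def)
      have "(LINT x|M. (norm (\<phi> x))\<^sup>2) \<le> C\<^sup>2 * (LINT x|M. (norm (D \<phi> x - \<mu> *s \<phi> x))\<^sup>2)"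
        using C by (intro integral_norm_le_of_coeff[where \<tau> = \<tau>] continuous_intros smooth_continuous[OF sm] continuous_dirac[OF sm])
          (auto simp: coeff_dirac_minus[OF \<phi>])
      then have "L2_norm \<gamma> \<phi> \<le> sqrt (C\<^sup>2 * (LINT x|M. (norm (D \<phi> x - \<mu> *s \<phi> x))\<^sup>2))"
        unfolding L2_norm_M by (rule real_sqrt_le_mono)
      then show ?thesis using C(1) by (simp add: L2_norm_M real_sqrt_mult)
    qed
    moreover have "\<exists>\<phi>\<in>smooth_spinors \<Gamma> \<rho>. L2_norm \<gamma> (\<lambda>x. D \<phi> x - \<mu> *s \<phi> x - \<psi> x) < \<epsilon>"
      if \<psi>: "\<psi> \<in> L2_spinors \<Gamma> \<gamma> \<rho>" and "\<epsilon> > 0" for \<psi> \<epsilon>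
    proof -
      \<comment> \<open>Injectivity implies surjectivity on the finite-dimensional module.\<close>
      have "\<exists>w. symbol g w - \<mu> *s w = v" if "g \<in> dual_lattice \<Gamma>" for g v
      proof -
        let ?f = "\<lambda>v. symbol g v - \<mu> *s v"
        have lin: "linear ?f"
          by (rule linearI) (simp_all add: dirac_symbol_add dirac_symbol_smult scaleR_eq_smult
              vec.scale_right_distrib vec.scale_right_diff_distrib mult.commute)
        have "inj ?f" using inj[OF that] by (subst linear_injective_0[OF lin]) auto
        then have "surj ?f" by (rule linear_injective_imp_surjective[OF lin _ refl])
        then obtain w where "v = ?f w" by (rule surjE)
        then show ?thesis by blast
      qed
      then obtain r where r: "\<And>g v. g \<in> dual_lattice \<Gamma> \<Longrightarrow> symbol g (r g v) - \<mu> *s r g v = v" by metis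
      have "\<psi> \<in> borel_measurable borel" "integrable M (\<lambda>x. (norm (\<psi> x))\<^sup>2)"
        using \<psi> by (auto simp: L2_spinors_def integrable_M)
      moreover have "\<epsilon>\<^sup>2 > 0" using \<open>\<epsilon> > 0\<close> by simp
      ultimately obtain F and a :: "_ \<Rightarrow> complex ^ 's" where F: "finite F" "F \<subseteq> dual_lattice \<Gamma>"
          "(LINT x|M. (norm (\<psi> x - trig_poly \<tau> F a x))\<^sup>2) < \<epsilon>\<^sup>2"
        using trig_poly_dense[of \<psi> "\<epsilon>\<^sup>2" \<tau>] by blast
      define \<phi> where "\<phi> = trig_poly \<tau> F (\<lambda>g. r g (a g))"
      have "D \<phi> x - \<mu> *s \<phi> x = trig_poly \<tau> F a x" for x
      proof -
        have "D \<phi> x - \<mu> *s \<phi> x = (\<Sum>g\<in>F. wave (g + \<tau>) x *s (symbol g (r g (a g)) - \<mu> *s r g (a g)))"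
          unfolding \<phi>_def dirac_trig_poly trig_poly_def
          by (simp add: vec.scale_sum_right vec.scale_right_diff_distrib sum_subtractf mult.commute)
        also have "\<dots> = trig_poly \<tau> F a x"
          unfolding trig_poly_def using F(2) by (intro sum.cong refl arg_cong2[where f = "(*s)"] r) auto
        finally show ?thesis .
      qed
      then have "L2_norm \<gamma> (\<lambda>x. D \<phi> x - \<mu> *s \<phi> x - \<psi> x) = sqrt (LINT x|M. (norm (\<psi> x - trig_poly \<tau> F a x))\<^sup>2)"
        by (simp add: L2_norm_M norm_minus_commute)
      also have "\<dots> < sqrt (\<epsilon>\<^sup>2)" using F(3) by (rule real_sqrt_less_mono)
      also have "\<dots> = \<epsilon>" using \<open>\<epsilon> > 0\<close> by simp
      finally show ?thesis
        using trig_poly_smooth_spinor[OF F(2)] unfolding \<phi>_def by blast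
    qed
    ultimately show ?thesis unfolding dirac_resolvent_set_def by blast
  qed
  moreover assume "\<mu> \<in> dirac_spectrum \<Gamma> \<gamma> \<rho> c A"
  ultimately show "resonant \<mu> \<noteq> {}" by (auto simp: dirac_spectrum_def)
qed

text \<open>Taking coefficients in the eigenvalue equation kills every mode outside the finite set
  \<open>resonant \<mu>\<close>, so an eigenspinor equals its finite Fourier sum.\<close>

lemma dirac_eigenspace_eq:
  "dirac_eigenspace \<Gamma> \<rho> c A \<mu> = {trig_poly \<tau> (resonant \<mu>) a | a. \<forall>g\<in>resonant \<mu>. symbol g (a g) = \<mu> *s a g}"
proof (intro equalityI subsetI)
  fix \<phi> assume "\<phi> \<in> dirac_eigenspace \<Gamma> \<rho> c A \<mu>"
  then have \<phi>: "\<phi> \<in> smooth_spinors \<Gamma> \<rho>" and eig: "\<And>x. D \<phi> x = \<mu> *s \<phi> x"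
    by (auto simp: dirac_eigenspace_def)
  have sm: "smooth \<phi>" using \<phi> by (simp add: smooth_spinors_def)
  have res: "resonant \<mu> \<subseteq> dual_lattice \<Gamma>" by (auto simp: resonant_def)
  have eig': "symbol g (coeff \<phi> (g + \<tau>)) = \<mu> *s coeff \<phi> (g + \<tau>)" if "g \<in> dual_lattice \<Gamma>" for g
  proof -
    have "D \<phi> = (\<lambda>x. \<mu> *s \<phi> x)" using eig by (rule ext)
    from coeff_dirac[OF \<phi> that, unfolded this coeff_smult[OF smooth_continuous(1)[OF sm]]]
    show ?thesis by (rule sym)
  qed
  then have z: "coeff \<phi> (g + \<tau>) = 0" if "g \<in> dual_lattice \<Gamma> - resonant \<mu>" for g
    using that by (auto simp: resonant_def)
  define a where "a = (\<lambda>g. coeff \<phi> (g + \<tau>) /\<^sub>R vol)"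
  have *: "\<phi> x = trig_poly \<tau> (resonant \<mu>) a x" if "x \<in> fundamental_domain \<gamma>" for x
    unfolding a_def by (rule fourier_finite[OF smooth_continuous(1)[OF sm] finite_resonant res z that])
  \<comment> \<open>From the cell to all of space: both sides obey the same equivariance.\<close>
  have "\<phi> x = trig_poly \<tau> (resonant \<mu>) a x" for x
  proof -
    obtain y v where "y \<in> fundamental_domain \<gamma>" "v \<in> \<Gamma>" "x = y + v" by (rule reduce_to_domain)
    then show ?thesis
      using *[of y] \<phi> equivariant_trig_poly[OF res, of a] by (auto simp: equivariant_iff smooth_spinors_def)
  qed
  moreover have "symbol g (a g) = \<mu> *s a g" if "g \<in> resonant \<mu>" for g
    using eig'[of g] that res by (auto simp: a_def scaleR_eq_smult dirac_symbol_smult mult.commute)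
  ultimately show "\<phi> \<in> {trig_poly \<tau> (resonant \<mu>) a | a. \<forall>g\<in>resonant \<mu>. symbol g (a g) = \<mu> *s a g}"
    by blast
next
  fix \<phi> assume "\<phi> \<in> {trig_poly \<tau> (resonant \<mu>) a | a. \<forall>g\<in>resonant \<mu>. symbol g (a g) = \<mu> *s a g}"
  then obtain a where a: "\<phi> = trig_poly \<tau> (resonant \<mu>) a" "\<And>g. g \<in> resonant \<mu> \<Longrightarrow> symbol g (a g) = \<mu> *s a g"
    by blast
  have "\<phi> \<in> smooth_spinors \<Gamma> \<rho>"
    unfolding a(1) by (intro trig_poly_smooth_spinor) (auto simp: resonant_def)
  moreover have "D \<phi> x = \<mu> *s \<phi> x" for x
    unfolding a(1) dirac_trig_poly by (simp add: trig_poly_def a(2) vec.scale_sum_right mult.commute)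
  ultimately show "\<phi> \<in> dirac_eigenspace \<Gamma> \<rho> c A \<mu>"
    by (simp add: dirac_eigenspace_def)
qed

end

section \<open>Multiplicities\<close>

interpretation spinor: vector_space "\<lambda>a (\<phi> :: 'a \<Rightarrow> complex ^ 's) x. a *s \<phi> x"
  by (rule vector_space_spinor_fields)

text \<open>Only the source, the spinor module, has to be finite-dimensional; this makes
  \<open>spinor.dim_image_eq\<close> available for maps into function spaces.\<close>

interpretation spinor: finite_dimensional_vector_space_pair_1
  "(*s) :: complex \<Rightarrow> complex ^ 's \<Rightarrow> complex ^ 's" cart_basis "\<lambda>a (\<phi> :: 'a \<Rightarrow> complex ^ 's) x. a *s \<phi> x"
  by unfold_locales

text \<open>Since \<open>dim\<close> is 0 for infinite-dimensional spaces, monotonicity needs a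
  finite set spanning the larger space.\<close>

lemma (in vector_space) dim_mono_finite:
  assumes "U \<subseteq> V" "V \<subseteq> span T" "finite T"
  shows "dim U \<le> dim V"
proof -
  obtain B where B: "B \<subseteq> U" "independent B" "U \<subseteq> span B" "card B = dim U"
    by (rule basis_exists)
  obtain C where C: "B \<subseteq> C" "C \<subseteq> V" "independent C" "V \<subseteq> span C"
    using maximal_independent_subset_extend[of B V] B assms(1) by blast
  have "finite C"
    using independent_span_bound[OF assms(3) C(3)] C(2) assms(2) by auto
  then have "card B \<le> card C" using C(1) by (rule card_mono)
  then show ?thesis using B(4) basis_card_eq_dim[OF C(2,4,3)] by simp
qed

lemma sum_fun_apply: "(\<Sum>i\<in>I. f i) x = (\<Sum>i\<in>I. f i x)" for f :: "_ \<Rightarrow> _ \<Rightarrow> 'b::comm_monoid_add"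
  by (induction I rule: infinite_finite_induct) auto

lemma dim_wave_image:
  fixes S :: "(complex ^ 's) set"
  shows "spinor.dim ((\<lambda>v x. wave \<zeta> x *s v) ` S) = vec.dim S"
proof (rule spinor.dim_image_eq)
  show "Vector_Spaces.linear (*s) (\<lambda>a \<phi> x. a *s \<phi> x) (\<lambda>(v :: complex ^ 's) x. wave \<zeta> x *s v)"
    by unfold_locales (auto simp: fun_eq_iff vec.scale_right_distrib mult.commute)
  show "inj_on (\<lambda>(v :: complex ^ 's) x. wave \<zeta> x *s v) (vec.span S)"
    by (rule inj_onI) (auto simp: fun_eq_iff)
qed

text \<open>The points where the two homomorphisms agree form a subgroup containing the
  generators.\<close>

lemma (in flat_torus) characters_eq:
  fixes f h :: "real ^ 'n \<Rightarrow> complex"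
  assumes f: "\<And>x y. x \<in> \<Gamma> \<Longrightarrow> y \<in> \<Gamma> \<Longrightarrow> f (x + y) = f x * f y" "\<And>x. x \<in> \<Gamma> \<Longrightarrow> f x \<noteq> 0"
    and h: "\<And>x y. x \<in> \<Gamma> \<Longrightarrow> y \<in> \<Gamma> \<Longrightarrow> h (x + y) = h x * h y" "\<And>x. x \<in> \<Gamma> \<Longrightarrow> h x \<noteq> 0"
    and gen: "\<And>j. f (\<gamma> j) = h (\<gamma> j)"
    and x: "x \<in> \<Gamma>"
  shows "f x = h x"
proof -
  define S where "S = {v \<in> \<Gamma>. f v = h v}"
  \<comment> \<open>The value at 0 equals its own square and is nonzero, hence is 1 for
    both.\<close>
  have zero: "0 \<in> S"
    using f(1)[of 0 0] f(2)[of 0] h(1)[of 0 0] h(2)[of 0] lattice_zero by (auto simp: S_def)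
  have add: "v + w \<in> S" if "v \<in> S" "w \<in> S" for v w
    using that f(1) h(1) by (auto simp: S_def lattice_add)
  have minus: "- v \<in> S" if v: "v \<in> S" for v
  proof -
    have v': "v \<in> \<Gamma>" "- v \<in> \<Gamma>" using v by (auto simp: S_def lattice_minus)
    have "f v * f (- v) = h v * h (- v)"
      using f(1)[OF v'] h(1)[OF v'] zero by (simp add: S_def)
    then show ?thesis using v v' f(2) by (auto simp: S_def)
  qed
  have nat: "real n *\<^sub>R \<gamma> j \<in> S" for n j
  proof (induction n)
    case (Suc n)
    have "\<gamma> j \<in> S" using gen lattice_gen by (simp add: S_def)
    with Suc add show ?case by (simp add: scaleR_left_distrib)
  qed (simp add: zero)
  have int: "real_of_int k *\<^sub>R \<gamma> j \<in> S" for k j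
    using nat[of "nat k" j] minus[OF nat[of "nat (- k)" j]] by (cases "k \<ge> 0") auto
  have sum: "(\<Sum>j\<in>J. real_of_int (k j) *\<^sub>R \<gamma> j) \<in> S" if "finite J" for J k
    using that by (induction rule: finite_induct) (auto intro: zero add int)
  obtain k :: "'n \<Rightarrow> int" where "x = (\<Sum>j\<in>UNIV. of_int (k j) *\<^sub>R \<gamma> j)"
    using x basis by (auto simp: lattice_basis_def)
  then show ?thesis using sum[of UNIV k] by (simp add: S_def)
qed

section \<open>Dimensions of the eigenspaces on the torus\<close>

context dirac_torus
begin

lemma dirac_eigenvalue_iff: "dirac_eigenvalue \<Gamma> \<rho> c A \<mu> \<longleftrightarrow> resonant \<mu> \<noteq> {}"
proof
  assume "dirac_eigenvalue \<Gamma> \<rho> c A \<mu>"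
  then show "resonant \<mu> \<noteq> {}"
    by (auto simp: dirac_eigenvalue_def dirac_eigenspace_eq trig_poly_def)
next
  assume "resonant \<mu> \<noteq> {}"
  then obtain g v where g: "g \<in> resonant \<mu>" "v \<noteq> 0" "symbol g v = \<mu> *s v"
    by (auto simp: resonant_def)
  define a where "a = (\<lambda>h. if h = g then v else 0)"
  have "\<forall>h\<in>resonant \<mu>. symbol h (a h) = \<mu> *s a h"
    using g(3) by (simp add: a_def linear_0[OF linear_dirac_symbol])
  then have "trig_poly \<tau> (resonant \<mu>) a \<in> dirac_eigenspace \<Gamma> \<rho> c A \<mu>"
    unfolding dirac_eigenspace_eq by blast
  moreover have "trig_poly \<tau> (resonant \<mu>) a 0 = v"
    using g(1) finite_resonant by (simp add: trig_poly_def a_def)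
  ultimately show "dirac_eigenvalue \<Gamma> \<rho> c A \<mu>"
    unfolding dirac_eigenvalue_def using g(2) by metis
qed

text \<open>Supplies the finite spanning set that \<open>dim_mono_finite\<close> asks for.\<close>

lemma dirac_eigenspace_span:
  "dirac_eigenspace \<Gamma> \<rho> c A \<mu> \<subseteq>
    spinor.span ((\<lambda>(g, i) x. wave (g + \<tau>) x *s axis i 1) ` (resonant \<mu> \<times> UNIV))"
proof
  let ?b = "\<lambda>(g, i) x. wave (g + \<tau>) x *s (axis i 1 :: complex ^ 's)"
  fix \<phi> assume "\<phi> \<in> dirac_eigenspace \<Gamma> \<rho> c A \<mu>"
  then obtain a :: "_ \<Rightarrow> complex ^ 's" where a: "\<phi> = trig_poly \<tau> (resonant \<mu>) a"
    unfolding dirac_eigenspace_eq by blast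
  have "\<phi> = (\<Sum>g\<in>resonant \<mu>. \<Sum>i\<in>UNIV. (\<lambda>x. (a g $ i) *s ?b (g, i) x))"
  proof
    fix x
    have "wave (g + \<tau>) x *s a g = (\<Sum>i\<in>UNIV. (a g $ i) *s (wave (g + \<tau>) x *s axis i 1))" for g
      by (simp add: vec_eq_iff axis_def if_distrib cong: if_cong)
    then show "\<phi> x = (\<Sum>g\<in>resonant \<mu>. \<Sum>i\<in>UNIV. (\<lambda>x. (a g $ i) *s ?b (g, i) x)) x"
      by (simp add: a trig_poly_def sum_fun_apply)
  qed
  also have "\<dots> \<in> spinor.span (?b ` (resonant \<mu> \<times> UNIV))"
    by (intro spinor.span_sum spinor.span_scale spinor.span_base) auto
  finally show "\<phi> \<in> spinor.span (?b ` (resonant \<mu> \<times> UNIV))" .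
qed

text \<open>One mode embeds its symbol eigenspace into the eigenspace of the operator. Several modes
  may share an eigenvalue, so there is only an inequality.\<close>

lemma dirac_multiplicity_ge:
  assumes g: "g \<in> resonant \<mu>"
  shows "vec.dim {v. symbol g v = \<mu> *s v} \<le> dirac_multiplicity \<Gamma> \<rho> c A \<mu>"
proof -
  let ?f = "\<lambda>(v :: complex ^ 's) x. wave (g + \<tau>) x *s v"
  have "?f ` {v. symbol g v = \<mu> *s v} \<subseteq> dirac_eigenspace \<Gamma> \<rho> c A \<mu>"
  proof (rule image_subsetI)
    fix v assume v: "v \<in> {v. symbol g v = \<mu> *s v}"
    define a where "a = (\<lambda>h. if h = g then v else 0)"
    have "\<forall>h\<in>resonant \<mu>. symbol h (a h) = \<mu> *s a h"
      using v by (simp add: a_def linear_0[OF linear_dirac_symbol])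
    moreover have "?f v = trig_poly \<tau> (resonant \<mu>) a"
    proof
      fix x
      have "trig_poly \<tau> (resonant \<mu>) a x = (\<Sum>h\<in>resonant \<mu>. if h = g then wave (g + \<tau>) x *s v else 0)"
        unfolding trig_poly_def a_def by (intro sum.cong) auto
      then show "?f v x = trig_poly \<tau> (resonant \<mu>) a x"
        using g finite_resonant by simp
    qed
    ultimately show "?f v \<in> dirac_eigenspace \<Gamma> \<rho> c A \<mu>"
      unfolding dirac_eigenspace_eq by blast
  qed
  from spinor.dim_mono_finite[OF this dirac_eigenspace_span] show ?thesis
    by (simp add: dim_wave_image dirac_multiplicity_def finite_resonant)
qed

lemma resonant_0: "resonant 0 = {g \<in> dual_lattice \<Gamma>. \<xi> g = 0}"
proof (intro equalityI subsetI)
  fix g assume "g \<in> resonant 0"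
  then obtain v where g: "g \<in> dual_lattice \<Gamma>" "v \<noteq> 0" "symbol g v = 0 *s v" by (auto simp: resonant_def)
  then have "dual_norm (\<xi> g) = 0"
    using dirac_symbol_eigen[OF clifford g(3,2)] by auto
  with g(1) show "g \<in> {g \<in> dual_lattice \<Gamma>. \<xi> g = 0}" by (simp add: dual_norm_eq_0_iff)
next
  fix g assume g: "g \<in> {g \<in> dual_lattice \<Gamma>. \<xi> g = 0}"
  then have "sharp (\<xi> g) = 0" by (simp add: sharp_def)
  then have "symbol g (axis undefined 1) = 0"
    using linear_0[OF linear_clifford[OF clifford]] by (simp add: dirac_symbol_def)
  moreover have "axis undefined 1 \<noteq> (0 :: complex ^ 's)" by (simp add: axis_eq_0_iff)
  ultimately show "g \<in> resonant 0"
    using g unfolding resonant_def by (intro CollectI conjI exI[of _ "axis undefined 1"]) auto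
qed

lemma \<xi>_eq_0_iff: "\<xi> g = 0 \<longleftrightarrow> A = - (4 * pi) *\<^sub>R (g + \<tau>)"
proof -
  have "\<xi> g = 0 \<longleftrightarrow> (4 * pi) *\<^sub>R \<xi> g = 0" by simp
  also have "(4 * pi) *\<^sub>R \<xi> g = (4 * pi) *\<^sub>R (g + \<tau>) + A"
    by (simp add: \<xi>_def scaleR_right_distrib)
  also have "\<dots> = 0 \<longleftrightarrow> A = - (4 * pi) *\<^sub>R (g + \<tau>)"
    by (simp add: add_eq_0_iff)
  finally show ?thesis .
qed

text \<open>As \<open>\<xi>\<close> is injective, at most one mode has \<open>\<xi> g = 0\<close>,
  and there the symbol vanishes on the whole module. This is why the multiplicity of 0 is
  exact.\<close>

lemma zero_eigenspace:
  assumes g: "g \<in> resonant 0"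
  shows "dirac_eigenspace \<Gamma> \<rho> c A 0 = (\<lambda>(v :: complex ^ 's) x. wave (g + \<tau>) x *s v) ` UNIV"
proof -
  have "\<xi> h = \<xi> g \<longleftrightarrow> h = g" for h by (simp add: \<xi>_def)
  then have res: "resonant 0 = {g}" using g unfolding resonant_0 by auto
  have "sharp (\<xi> g) = 0" using g by (simp add: resonant_0 sharp_def)
  then have "symbol g v = 0" for v
    using linear_0[OF linear_clifford[OF clifford]] by (simp add: dirac_symbol_def)
  then have "dirac_eigenspace \<Gamma> \<rho> c A 0 = {trig_poly \<tau> {g} a | a. True}"
    unfolding dirac_eigenspace_eq res by simp
  also have "\<dots> = (\<lambda>(v :: complex ^ 's) x. wave (g + \<tau>) x *s v) ` UNIV"
    by (auto simp: trig_poly_single[abs_def] image_def intro: exI[of _ "\<lambda>_. _"])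
  finally show ?thesis .
qed

lemma dirac_multiplicity_0:
  assumes "g \<in> resonant 0"
  shows "dirac_multiplicity \<Gamma> \<rho> c A 0 = CARD('s)"
  unfolding dirac_multiplicity_def zero_eigenspace[OF assms] dim_wave_image by (rule vec_dim_card)

lemma parallel_zero_eigenspace:
  assumes g: "g \<in> resonant 0" and "\<phi> \<in> dirac_eigenspace \<Gamma> \<rho> c A 0"
  shows "parallel_spinor A \<phi>"
proof -
  obtain v :: "complex ^ 's" where "\<phi> = (\<lambda>x. wave (g + \<tau>) x *s v)"
    using assms(2) unfolding zero_eigenspace[OF g] by blast
  then have "\<phi> = trig_poly \<tau> {g} (\<lambda>_. v)" by (simp add: trig_poly_single[abs_def])
  moreover have "\<xi> g = 0" using g by (simp add: resonant_0)
  ultimately show ?thesis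
    by (simp add: parallel_spinor_def connection_trig_poly) (simp add: trig_poly_def)
qed

lemma dim_symbol_eigenspace_real:
  assumes "2 \<le> CARD('n)" "CARD('s) = 2 ^ k" "\<mu>\<^sup>2 = complex_of_real ((2 * pi * dual_norm (\<xi> g))\<^sup>2)"
  shows "2 powr (real k - 1) \<le> vec.dim {v. symbol g v = \<mu> *s v}"
proof -
  have "real (2 ^ k) \<le> real (2 * vec.dim {v. symbol g v = \<mu> *s v})"
    using dim_dirac_symbol_eigenspace[OF clifford assms(1,3)] unfolding assms(2) by (simp only: of_nat_le_iff)
  then show ?thesis by (simp add: powr_diff powr_realpow)
qed

lemma resonant_square:
  assumes "g \<in> resonant \<mu>"
  shows "\<mu>\<^sup>2 = complex_of_real ((2 * pi * dual_norm (\<xi> g))\<^sup>2)"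
proof -
  obtain v where "v \<noteq> 0" "symbol g v = \<mu> *s v" using assms by (auto simp: resonant_def)
  from dirac_symbol_eigen[OF clifford this(2,1)] show ?thesis by auto
qed

text \<open>Both signs occur because the lower bound on the dimension is positive for either square
  root.\<close>

lemma resonant_iff:
  assumes n: "2 \<le> CARD('n)" and s: "CARD('s) = 2 ^ k"
  shows "g \<in> resonant \<mu> \<longleftrightarrow>
    g \<in> dual_lattice \<Gamma> \<and> (\<exists>s\<in>{1, -1}. \<mu> = complex_of_real (s * 2 * pi * dual_norm (\<xi> g)))"
proof
  assume g: "g \<in> resonant \<mu>"
  then obtain v where "v \<noteq> 0" "symbol g v = \<mu> *s v" by (auto simp: resonant_def)
  from dirac_symbol_eigen[OF clifford this(2,1)] g
  show "g \<in> dual_lattice \<Gamma> \<and> (\<exists>s\<in>{1, -1}. \<mu> = complex_of_real (s * 2 * pi * dual_norm (\<xi> g)))"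
    by (auto simp: resonant_def)
next
  assume g: "g \<in> dual_lattice \<Gamma> \<and> (\<exists>s\<in>{1, -1}. \<mu> = complex_of_real (s * 2 * pi * dual_norm (\<xi> g)))"
  then have "\<mu>\<^sup>2 = complex_of_real ((2 * pi * dual_norm (\<xi> g))\<^sup>2)" by auto
  from dim_symbol_eigenspace_real[OF n s this]
  have "vec.dim {v. symbol g v = \<mu> *s v} \<noteq> 0"
    using powr_gt_zero[of 2 "real k - 1"] by linarith
  then show "g \<in> resonant \<mu>"
    using g by (auto simp: resonant_def)
qed

end

text \<open>For n = 1 the spinor module is a line and each mode contributes one eigenvalue only, so
  including both signs would be wrong unless the set of all \<open>\<xi> g\<close> is symmetric;
  \<open>e\<close> fixes the sign. The multiplicity bound uses \<open>powr\<close> because its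
  exponent is -1 in that case.\<close>

theorem theorem5p3:
  fixes \<Gamma> :: "(real ^ 'n) set"
    and \<gamma> :: "'n \<Rightarrow> real ^ 'n"
    and \<gamma>' :: "'n \<Rightarrow> (real ^ 'n) \<Rightarrow>\<^sub>L real"
    and \<delta> :: "'n \<Rightarrow> nat"
    and \<theta> :: "'n \<Rightarrow> real"
    and \<beta> \<beta>' \<epsilon> :: "real ^ 'n \<Rightarrow> complex"
    and A :: "(real ^ 'n) \<Rightarrow>\<^sub>L real"
    and c :: "real ^ 'n \<Rightarrow> complex ^ 's ^ 's"
  assumes "lattice_basis \<Gamma> \<gamma>"
    and "dual_basis \<gamma> \<gamma>'"
    and "\<forall>j. \<delta> j \<in> {0, 1}"
    and "\<forall>j. \<theta> j \<in> {0..<1}"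
    and "character (sphere 0 1) \<Gamma> \<beta>"
    and "\<forall>j. \<beta> (\<gamma> j) = exp (2 * \<i> * pi * \<theta> j)"
    and "character (sphere 0 1) \<Gamma> \<beta>'"
    and "\<forall>j. \<beta>' (\<gamma> j) = exp (\<i> * pi * \<theta> j)"
    and "character {1, -1} \<Gamma> \<epsilon>"
    and "\<forall>j. \<epsilon> (\<gamma> j) = (-1) ^ \<delta> j"
    and "CARD('s) = 2 ^ (CARD('n) div 2)"
    and "clifford_mult c"
  shows
    "let \<rho> = (\<lambda>v. \<epsilon> v * \<beta>' v);
         \<tau> = (1 / 2) *\<^sub>R (\<Sum>j\<in>UNIV. (real (\<delta> j) + \<theta> j) *\<^sub>R \<gamma>' j);
         \<xi> = (\<lambda>g. g + \<tau> + (1 / (4 * pi)) *\<^sub>R A)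
     in
       (CARD('n) \<ge> 2 \<longrightarrow>
          dirac_spectrum \<Gamma> \<gamma> \<rho> c A =
            {complex_of_real (s * 2 * pi * dual_norm (\<xi> g)) | s g.
               s \<in> {1, -1} \<and> g \<in> dual_lattice \<Gamma>}) \<and>
       (CARD('n) = 1 \<longrightarrow>
          (\<exists>e. norm e = 1 \<and> c e = mat (- \<i>) \<and>
             dirac_spectrum \<Gamma> \<gamma> \<rho> c A =
               {complex_of_real (s * 2 * pi * dual_norm (\<xi> g)) | s g.
                  s \<in> {1, -1} \<and> g \<in> dual_lattice \<Gamma> \<and>
                  s * dual_norm (\<xi> g) = blinfun_apply (\<xi> g) e})) \<and>
       (\<forall>g\<in>dual_lattice \<Gamma>. \<forall>s\<in>{1, -1}.
          let \<mu> = complex_of_real (s * 2 * pi * dual_norm (\<xi> g)) in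
            \<mu> \<noteq> 0 \<and> \<mu> \<in> dirac_spectrum \<Gamma> \<gamma> \<rho> c A \<longrightarrow>
              dirac_eigenvalue \<Gamma> \<rho> c A \<mu> \<and>
              real (dirac_multiplicity \<Gamma> \<rho> c A \<mu>) \<ge> 2 powr (real (CARD('n) div 2) - 1)) \<and>
       (dirac_eigenvalue \<Gamma> \<rho> c A 0 \<longleftrightarrow>
          (\<exists>g\<in>dual_lattice \<Gamma>. A = - (4 * pi) *\<^sub>R (g + \<tau>))) \<and>
       (dirac_eigenvalue \<Gamma> \<rho> c A 0 \<longrightarrow>
          dirac_multiplicity \<Gamma> \<rho> c A 0 = 2 ^ (CARD('n) div 2) \<and>
          (\<forall>\<phi>\<in>dirac_eigenspace \<Gamma> \<rho> c A 0. parallel_spinor A \<phi>))"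
proof -
  define \<rho> where "\<rho> = (\<lambda>v. \<epsilon> v * \<beta>' v)"
  define \<tau> where "\<tau> = (1 / 2) *\<^sub>R (\<Sum>j\<in>UNIV. (real (\<delta> j) + \<theta> j) *\<^sub>R \<gamma>' j)"
  interpret flat_torus \<Gamma> \<gamma> \<gamma>' by unfold_locales fact+
  have \<tau>_gen: "blinfun_apply \<tau> (\<gamma> j) = (real (\<delta> j) + \<theta> j) / 2" for j
    by (simp add: \<tau>_def blinfun.scaleR_left blinfun.sum_left if_distrib cong: if_cong)
  have \<rho>_wave: "\<rho> v = wave \<tau> v" if "v \<in> \<Gamma>" for v
  proof (rule characters_eq[OF _ _ _ _ _ that])
    show "\<rho> (x + y) = \<rho> x * \<rho> y" if "x \<in> \<Gamma>" "y \<in> \<Gamma>" for x y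
      using assms(7,9) that by (simp add: \<rho>_def character_def mult_ac)
    show "\<rho> x \<noteq> 0" if "x \<in> \<Gamma>" for x
    proof -
      have "\<epsilon> x \<in> {1, -1}" "\<beta>' x \<in> sphere 0 1"
        using assms(7,9) that unfolding character_def by blast+
      then show ?thesis by (auto simp: \<rho>_def)
    qed
    show "\<rho> (\<gamma> j) = wave \<tau> (\<gamma> j)" for j
    proof -
      \<comment> \<open>The factor 1/2 in \<open>\<tau>\<close> turns 2 pi into pi, as befits the
        signs and the square root of the auxiliary bundle.\<close>
      have "wave \<tau> (\<gamma> j) = cis (pi * \<delta> j) * cis (pi * \<theta> j)"
        unfolding wave_def \<tau>_gen cis_mult by (rule arg_cong[where f = cis]) (simp add: field_simps)
      also have "cis (pi * \<delta> j) = (-1) ^ \<delta> j"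
        using assms(3)[rule_format, of j] by auto
      also have "cis (pi * \<theta> j) = exp (\<i> * pi * \<theta> j)"
        by (simp add: cis_conv_exp mult.assoc)
      finally show ?thesis using assms(8,10) by (simp add: \<rho>_def)
    qed
  qed (simp_all add: wave_add_arg)
  interpret dirac_torus \<Gamma> \<gamma> \<gamma>' \<tau> A c \<rho>
    by unfold_locales (use assms(12) \<rho>_wave in auto)
  note card_s = assms(11)
  have spec2: "dirac_spectrum \<Gamma> \<gamma> \<rho> c A =
      {complex_of_real (s * 2 * pi * dual_norm (\<xi> g)) | s g. s \<in> {1, -1} \<and> g \<in> dual_lattice \<Gamma>}"
    if n: "2 \<le> CARD('n)"
  proof (intro set_eqI)
    fix \<mu>
    have "\<mu> \<in> dirac_spectrum \<Gamma> \<gamma> \<rho> c A \<longleftrightarrow> (\<exists>g. g \<in> resonant \<mu>)"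
      by (auto simp: dirac_spectrum_iff)
    then show "\<mu> \<in> dirac_spectrum \<Gamma> \<gamma> \<rho> c A \<longleftrightarrow> \<mu> \<in>
        {complex_of_real (s * 2 * pi * dual_norm (\<xi> g)) | s g. s \<in> {1, -1} \<and> g \<in> dual_lattice \<Gamma>}"
      unfolding resonant_iff[OF n card_s] by blast
  qed
  have spec1: "\<exists>e. norm e = 1 \<and> c e = mat (- \<i>) \<and>
             dirac_spectrum \<Gamma> \<gamma> \<rho> c A =
               {complex_of_real (s * 2 * pi * dual_norm (\<xi> g)) | s g.
                  s \<in> {1, -1} \<and> g \<in> dual_lattice \<Gamma> \<and>
                  s * dual_norm (\<xi> g) = blinfun_apply (\<xi> g) e}"
    if n: "CARD('n) = 1"
  proof -
    have "CARD('s) = 1" using card_s n by simp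
    from dirac_symbol_dim_1[OF clifford n this] obtain e where e: "norm e = 1" "c e = mat (- \<i>)"
      and sym: "\<And>\<zeta> v. dirac_symbol c \<zeta> v = complex_of_real (2 * pi * blinfun_apply \<zeta> e) *s v"
      and nrm: "\<And>\<zeta>. \<bar>blinfun_apply \<zeta> e\<bar> = dual_norm \<zeta>" by metis
    have "g \<in> resonant \<mu> \<longleftrightarrow> g \<in> dual_lattice \<Gamma> \<and> \<mu> = complex_of_real (2 * pi * blinfun_apply (\<xi> g) e)" for g \<mu>
    proof -
      have "(\<exists>v :: complex ^ 's. v \<noteq> 0 \<and> a *s v = \<mu> *s v) \<longleftrightarrow> \<mu> = a" for a
        by (auto intro: exI[of _ "axis undefined 1"] simp: axis_eq_0_iff)
      then show ?thesis unfolding resonant_def sym by blast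
    qed
    then have "\<mu> \<in> dirac_spectrum \<Gamma> \<gamma> \<rho> c A \<longleftrightarrow>
        (\<exists>g\<in>dual_lattice \<Gamma>. \<mu> = complex_of_real (2 * pi * blinfun_apply (\<xi> g) e))" for \<mu>
      unfolding dirac_spectrum_iff by blast
    moreover have "\<exists>s\<in>{1, -1}. s * dual_norm \<zeta> = blinfun_apply \<zeta> e" for \<zeta>
      using nrm[of \<zeta>] by (auto simp: abs_if split: if_splits)
    ultimately have "dirac_spectrum \<Gamma> \<gamma> \<rho> c A =
               {complex_of_real (s * 2 * pi * dual_norm (\<xi> g)) | s g.
                  s \<in> {1, -1} \<and> g \<in> dual_lattice \<Gamma> \<and>
                  s * dual_norm (\<xi> g) = blinfun_apply (\<xi> g) e}"
    proof (intro set_eqI)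
      fix \<mu>
      assume spec: "\<And>\<mu>. \<mu> \<in> dirac_spectrum \<Gamma> \<gamma> \<rho> c A \<longleftrightarrow>
          (\<exists>g\<in>dual_lattice \<Gamma>. \<mu> = complex_of_real (2 * pi * blinfun_apply (\<xi> g) e))"
        and sgn: "\<And>\<zeta>. \<exists>s\<in>{1, -1}. s * dual_norm \<zeta> = blinfun_apply \<zeta> e"
      have eq: "complex_of_real (s * 2 * pi * dual_norm (\<xi> g)) = complex_of_real (2 * pi * blinfun_apply (\<xi> g) e)"
        if "s * dual_norm (\<xi> g) = blinfun_apply (\<xi> g) e" for s g
        unfolding that[symmetric] by simp
      show "\<mu> \<in> dirac_spectrum \<Gamma> \<gamma> \<rho> c A \<longleftrightarrow> \<mu> \<in> {complex_of_real (s * 2 * pi * dual_norm (\<xi> g)) | s g.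
                  s \<in> {1, -1} \<and> g \<in> dual_lattice \<Gamma> \<and> s * dual_norm (\<xi> g) = blinfun_apply (\<xi> g) e}"
        unfolding spec mem_Collect_eq using sgn eq by metis
    qed
    with e show ?thesis by blast
  qed
  have mult: "dirac_eigenvalue \<Gamma> \<rho> c A \<mu> \<and>
      2 powr (real (CARD('n) div 2) - 1) \<le> real (dirac_multiplicity \<Gamma> \<rho> c A \<mu>)"
    if "\<mu> \<in> dirac_spectrum \<Gamma> \<gamma> \<rho> c A" for \<mu>
  proof -
    from that obtain g where g: "g \<in> resonant \<mu>" by (auto simp: dirac_spectrum_iff)
    have "2 powr (real (CARD('n) div 2) - 1) \<le> real (vec.dim {v. symbol g v = \<mu> *s v})"
    proof (cases "2 \<le> CARD('n)")
      case True
      show ?thesis by (rule dim_symbol_eigenspace_real[OF True card_s resonant_square[OF g]])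
    next
      case False
      then have "CARD('n) div 2 = 0" by simp
      \<comment> \<open>For n = 1 the bound is 1/2, so a nonzero dimension is enough.\<close>
      then have "2 powr (real (CARD('n) div 2) - 1) = 1 / 2" by (simp add: powr_minus_divide)
      moreover have "vec.dim {v. symbol g v = \<mu> *s v} \<noteq> 0"
        using g by (auto simp: resonant_def)
      ultimately show ?thesis by linarith
    qed
    with dirac_multiplicity_ge[OF g] g show ?thesis
      unfolding dirac_eigenvalue_iff by (auto intro: order_trans)
  qed
  have zero: "dirac_eigenvalue \<Gamma> \<rho> c A 0 \<longleftrightarrow> (\<exists>g\<in>dual_lattice \<Gamma>. A = - (4 * pi) *\<^sub>R (g + \<tau>))"
    unfolding dirac_eigenvalue_iff resonant_0 \<xi>_eq_0_iff by blast
  have zero': "dirac_multiplicity \<Gamma> \<rho> c A 0 = 2 ^ (CARD('n) div 2) \<and>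
      (\<forall>\<phi>\<in>dirac_eigenspace \<Gamma> \<rho> c A 0. parallel_spinor A \<phi>)" if "dirac_eigenvalue \<Gamma> \<rho> c A 0"
  proof -
    from that obtain g where g: "g \<in> resonant 0" by (auto simp: dirac_eigenvalue_iff)
    show ?thesis
      using dirac_multiplicity_0[OF g] card_s parallel_zero_eigenspace[OF g] by simp
  qed
  show ?thesis
    unfolding Let_def \<rho>_def[symmetric] \<tau>_def[symmetric] \<xi>_def[symmetric]
    using spec2 spec1 mult zero zero' by blast
qed

end
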